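(* The following statements hold: (1) Let $0\le\alpha<1/2$. The sequence $\Lambda(\omega)$ is almost surely interpolating for $\mathcal{D}_\alpha$ if and only if it is almost surely separated. (2) Let $1/2\le\alpha<1$. The sequence $\Lambda(\omega)$ is almost surely interpolating for $\mathcal{D}_\alpha$ if and only if it is almost surely a zero sequence for $\mathcal{D}_\alpha$.
   Context: $\mathbb{D}$ is the open unit disk. Random sequence: $(\rho_n)\subset[0,1)$ is a fixed (deterministic) sequence of radii, $(\theta_n(\omega))$ is a sequence of independent random variables, all uniformly distributed on $[0,2\pi]$, and $\Lambda(\omega)=\{\lambda_n\}$ is the set of points $\lambda_n=\rho_n e^{i\theta_n(\omega)}$. The weighted Dirichlet space $\mathcal{D}_\alpha$ is the space of analytic functions $f$ on $\mathbb{D}$ with $\|f\|_\alpha^2=|f(0)|^2+\int_{\mathbb{D}}|f'(z)|^2(1-|z|^2)^{1-\alpha}\,dA(z)<\infty$, where $dA=dx\,dy/\pi$; $\mathcal{D}_0=H^2$ is the Hardy space. For $0\le\alpha<1$ its reproducing kernel (for an equivalent norm) is $k_z(w)=(1-\bar z w)^{-(1-\alpha)}$, and $\|k_\lambda\|_\alpha^2=k_\lambda(\lambda)=(1-|\lambda|^2)^{-(1-\alpha)}$. "Interpolating" always means universal interpolating: a set $\Lambda$ of distinct points of $\mathbb{D}$ is (universal) interpolating for $\mathcal{D}_\alpha$ if the map $R_\Lambda: f\mapsto (f(\lambda)/\|k_\lambda\|_\alpha)_{\lambda\in\Lambda}$ is well defined from $\mathcal{D}_\alpha$ into $\ell^2(\Lambda)$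 and is onto $\ell^2(\Lambda)$. $\Lambda$ is separated (pseudohyperbolically) if $\inf_{\lambda,\lambda^*\in\Lambda,\ \lambda\ne\lambda^*}\frac{|\lambda-\lambda^*|}{|1-\overline{\lambda}\lambda^*|}>0$. $\Lambda$ is a zero sequence for $\mathcal{D}_\alpha$ if there is a function $f\in\mathcal{D}_\alpha$, not identically zero, vanishing at every point of $\Lambda$. *)

theory Defs
  imports "HOL-Probability.Probability" "HOL-Complex_Analysis.Complex_Analysis"
begin

text \<open>
  Functions on the open unit disk \<open>ball 0 1\<close> are total functions of type \<open>complex \<Rightarrow> complex\<close>
  whose values outside the disk are irrelevant.
\<close>

text \<open>
  The norm takes values in \<open>ennreal\<close>, so that finiteness is meaningful;
  the factor \<open>1 / pi\<close> normalises planar Lebesgue measure to \<open>dA = dx dy / pi\<close>.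
\<close>

definition dirichlet_norm_sq :: "real \<Rightarrow> (complex \<Rightarrow> complex) \<Rightarrow> ennreal" where
  "dirichlet_norm_sq \<alpha> f =
     ennreal ((cmod (f 0))\<^sup>2) +
     ennreal (1 / pi) *
       (\<integral>\<^sup>+z\<in>ball 0 1. ennreal ((cmod (deriv f z))\<^sup>2 * (1 - (cmod z)\<^sup>2) powr (1 - \<alpha>)) \<partial>lborel)"

definition dirichlet_space :: "real \<Rightarrow> (complex \<Rightarrow> complex) set" where
  "dirichlet_space \<alpha> = {f. f holomorphic_on ball 0 1 \<and> dirichlet_norm_sq \<alpha> f < \<infinity>}"

text \<open>
  The kernel reproduces \<open>dirichlet_space \<alpha>\<close> for an equivalent norm, not for
  \<open>dirichlet_norm_sq\<close> itself. Its norm comes from \<open>\<parallel>k\<^sub>z\<parallel>\<^sup>2 = k\<^sub>z(z)\<close>, a positive real number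
  for \<open>z\<close> in the disk. For such \<open>z\<close> and \<open>w\<close> the base \<open>1 - cnj z * w\<close> has positive real part,
  so the principal branch of \<open>powr\<close> is the usual one.
\<close>

definition dirichlet_kernel :: "real \<Rightarrow> complex \<Rightarrow> complex \<Rightarrow> complex" where
  "dirichlet_kernel \<alpha> z w = (1 - cnj z * w) powr of_real (- (1 - \<alpha>))"

definition dirichlet_kernel_norm :: "real \<Rightarrow> complex \<Rightarrow> real" where
  "dirichlet_kernel_norm \<alpha> z = sqrt (Re (dirichlet_kernel \<alpha> z z))"

lemma dirichlet_kernel_diag:
  assumes "z \<in> ball 0 1"
  shows "dirichlet_kernel \<alpha> z z = of_real ((1 - (cmod z)\<^sup>2) powr (- (1 - \<alpha>)))"
proof -
  have "cmod z < 1"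
    using assms by simp
  then have "0 \<le> 1 - (cmod z)\<^sup>2"
    by (simp add: power_le_one)
  moreover have "1 - cnj z * z = of_real (1 - (cmod z)\<^sup>2)"
    by (simp only: mult.commute[of "cnj z" z] complex_norm_square[symmetric] of_real_diff of_real_1)
  ultimately show ?thesis
    unfolding dirichlet_kernel_def by (simp only: powr_of_real)
qed

lemma dirichlet_kernel_norm_sq:
  assumes "z \<in> ball 0 1"
  shows "(dirichlet_kernel_norm \<alpha> z)\<^sup>2 = (1 - (cmod z)\<^sup>2) powr (- (1 - \<alpha>))"
  unfolding dirichlet_kernel_norm_def dirichlet_kernel_diag[OF assms] by simp

definition ell2 :: "complex set \<Rightarrow> (complex \<Rightarrow> complex) set" where
  "ell2 \<Lambda> = {a. (\<lambda>x. (cmod (a x))\<^sup>2) summable_on \<Lambda>}"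

definition normalized_eval :: "real \<Rightarrow> (complex \<Rightarrow> complex) \<Rightarrow> complex \<Rightarrow> complex" where
  "normalized_eval \<alpha> f x = f x / of_real (dirichlet_kernel_norm \<alpha> x)"

definition universal_interpolating :: "real \<Rightarrow> complex set \<Rightarrow> bool" where
  "universal_interpolating \<alpha> \<Lambda> \<longleftrightarrow>
     \<Lambda> \<subseteq> ball 0 1 \<and>
     (\<forall>f\<in>dirichlet_space \<alpha>. normalized_eval \<alpha> f \<in> ell2 \<Lambda>) \<and>
     (\<forall>a\<in>ell2 \<Lambda>. \<exists>f\<in>dirichlet_space \<alpha>. \<forall>x\<in>\<Lambda>. normalized_eval \<alpha> f x = a x)"

text \<open>
  Positivity of the infimum is expressed by a uniform lower bound, so that
  the infimum over no pairs counts as positive (\<open>\<Lambda>\<close> with at most one point).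
\<close>

definition separated :: "complex set \<Rightarrow> bool" where
  "separated \<Lambda> \<longleftrightarrow>
     (\<exists>\<delta>>0. \<forall>x\<in>\<Lambda>. \<forall>y\<in>\<Lambda>. x \<noteq> y \<longrightarrow> \<delta> \<le> cmod (x - y) / cmod (1 - cnj x * y))"

definition zero_sequence :: "real \<Rightarrow> complex set \<Rightarrow> bool" where
  "zero_sequence \<alpha> \<Lambda> \<longleftrightarrow>
     (\<exists>f\<in>dirichlet_space \<alpha>. (\<exists>z\<in>ball 0 1. f z \<noteq> 0) \<and> (\<forall>x\<in>\<Lambda>. f x = 0))"

text \<open>
  The random sequence is regarded as the set of its points, so coinciding points
  (for instance if several radii vanish) are counted once.
\<close>

definition random_points :: "(nat \<Rightarrow> real) \<Rightarrow> (nat \<Rightarrow> 'a \<Rightarrow> real) \<Rightarrow> 'a \<Rightarrow> complex set" where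
  "random_points \<rho> \<theta> \<omega> = range (\<lambda>n. rcis (\<rho> n) (\<theta> n \<omega>))"

end

theory Submission
  imports Defs
begin

text \<open>
  Put \<open>\<beta> = 1 - \<alpha>\<close>, let \<open>d\<close> be \<open>1 - \<rho>\<^sup>2\<close> for each radius, and let \<open>p\<close> be the pseudohyperbolic
  distance.

  \<^bold>\<open>Reduction to sequences.\<close> Averaging over rotations turns the area integral of \<open>|f'|\<^sup>2\<close> into Beta
  integrals, so \<open>f\<close> lies in the space exactly if \<open>\<Sum> |a n|\<^sup>2 / c n\<close> is finite, where \<open>a\<close> are its Taylor
  coefficients and \<open>c\<close> those of \<open>(1 - t) powr (- \<beta>)\<close> (\<open>dirichlet_space_iff\<close>). Normalized point
  evaluations become pairings with unit vectors of \<open>\<ell>\<^sup>2\<close> whose inner products have modulus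
  \<open>(1 - p\<^sup>2) powr (\<beta> / 2)\<close>, and interpolation is a question about these vectors alone
  (\<open>universal_interpolating_iff\<close>).

  \<^bold>\<open>Necessity\<close> holds pointwise, without probability. Two close points have almost parallel vectors,
  so values of different size cannot be prescribed at too many close pairs
  (\<open>universal_interpolating_imp_separated\<close>). A function with value 1 at one point and 0 at the others,
  times a linear factor, vanishes at all of them (\<open>universal_interpolating_imp_zero_sequence\<close>).

  \<^bold>\<open>Sufficiency.\<close> If the absolute values of the off-diagonal Gram entries form a matrix of finite
  Schatten 4-norm, then removing finitely many points makes this norm small, the Gram matrix is close
  to the identity, and interpolation is solved by iterating an approximate solution; the removed points
  are put back one at a time (\<open>universal_interpolating_cycle_sum\<close>). For random points it is enough to
  bound expectations of the Gram entries \<open>G i j\<close>: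

  \<^item> For \<open>\<alpha> < 1/2\<close> the mean of \<open>|G i j|\<^sup>2\<close> is of order \<open>d powr \<beta>\<close> for the smaller defect times
    \<open>d powr (1 - \<beta>)\<close> for the larger one. Group the radii into generations of geometrically decreasing
    distance to the circle. Two points of one generation are close with a probability comparable to that
    distance, and these collisions are pairwise independent. Hence almost sure separation forces their
    expected number to be finite (\<open>AE_separated_imp_generation_bound\<close>), which bounds the squares inside
    each generation. Different generations interact with geometric decay, so the Hilbert--Schmidt norm
    has finite mean.

  \<^item> For \<open>\<alpha> > 1/2\<close> the mean of \<open>|G i j|\<^sup>2\<close> is at most a constant times \<open>(d i * d j) powr \<beta>\<close>, so
    \<open>\<Sum> d powr \<beta> < \<infinity>\<close> suffices.

  \<^item> For \<open>\<alpha> = 1/2\<close> these means carry an additional logarithm, which \<open>\<Sum> sqrt d < \<infinity>\<close> does not absorb.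
    Products of four entries along a cycle have no logarithm, which is why the Schatten 4-norm is used.

  \<^bold>\<open>Zero sequences.\<close> Averages of the kernels at the random points with weights proportional to
  \<open>d powr \<beta>\<close> have the kernel at 0 as their mean, and a variance of at most \<open>1 / \<Sum> d powr \<beta>\<close>. If this sum
  diverges, then almost surely the constant 1 is a limit of combinations of the kernels, so every function
  that vanishes at the points vanishes at 0. Applied to \<open>f / z ^ m\<close>, this excludes all nonzero functions
  (\<open>AE_zero_sequence_imp_bounded\<close>). So an almost sure zero sequence has \<open>\<Sum> d powr \<beta> < \<infinity>\<close>, the sum being
  over the positive radii: points at the centre coincide.
\<close>

section \<open>Rotation averages over the disk and the circle\<close>

lemma nn_integral_lborel_translate:
  fixes f :: "'a::euclidean_space \<Rightarrow> ennreal"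
  assumes [measurable]: "f \<in> borel_measurable borel"
  shows "(\<integral>\<^sup>+x. f (a + x) \<partial>lborel) = (\<integral>\<^sup>+x. f x \<partial>lborel)"
  by (subst lborel_distr_plus[of a, symmetric], subst nn_integral_distr) auto

lemma nn_integral_lborel_reflect:
  fixes f :: "'a::euclidean_space \<Rightarrow> ennreal"
  assumes [measurable]: "f \<in> borel_measurable borel"
  shows "(\<integral>\<^sup>+x. f (a - x) \<partial>lborel) = (\<integral>\<^sup>+x. f x \<partial>lborel)"
  by (subst lborel_affine[of "-1" a], simp, subst nn_integral_density, simp, simp,
      subst nn_integral_distr) auto

text \<open>Integrating the product of the indicators of a rotated set and of the unit ball in both orders,
  with translations and a reflection in between, shows that a rotation multiplies the area of every set
  by one common factor. The unit ball is invariant, so the factor is 1.\<close>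

lemma nn_integral_lborel_rotate:
  fixes f :: "complex \<Rightarrow> ennreal"
  assumes c: "cmod c = 1" and [measurable]: "f \<in> borel_measurable borel"
  shows "(\<integral>\<^sup>+z. f (c * z) \<partial>lborel) = (\<integral>\<^sup>+z. f z \<partial>lborel)"
proof -
  have c0: "c \<noteq> 0" using c by auto
  have "distr lborel borel ((*) c) = lborel"
  proof (rule measure_eqI)
    fix A assume "A \<in> sets (distr lborel borel ((*) c))"
    then have A[measurable]: "A \<in> sets borel" by simp
    let ?B = "ball 0 1 :: complex set"
    have B[measurable]: "?B \<in> sets borel" by simp
    have e: "emeasure (distr lborel borel ((*) c)) S = (\<integral>\<^sup>+x. indicator S (c * x) \<partial>lborel)"
      if [measurable]: "S \<in> sets borel" for S
      by (subst nn_integral_indicator[symmetric], simp, subst nn_integral_distr) auto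
    have "emeasure (distr lborel borel ((*) c)) A * emeasure lborel ?B
        = (\<integral>\<^sup>+x. \<integral>\<^sup>+y. indicator A (c * x) * indicator ?B y \<partial>lborel \<partial>lborel)"
      by (simp add: e nn_integral_cmult nn_integral_multc)
    also have "\<dots> = (\<integral>\<^sup>+x. \<integral>\<^sup>+y. indicator A (c * x) * indicator ?B (c * x + y) \<partial>lborel \<partial>lborel)"
      by (intro nn_integral_cong nn_integral_lborel_translate[symmetric]) measurable
    also have "\<dots> = (\<integral>\<^sup>+y. \<integral>\<^sup>+x. indicator A (c * x) * indicator ?B (c * x + y) \<partial>lborel \<partial>lborel)"
      by (rule lborel_pair.Fubini'[symmetric]) measurable
    also have "\<dots> = (\<integral>\<^sup>+y. \<integral>\<^sup>+x. indicator A (c * x - y) * indicator ?B (c * x) \<partial>lborel \<partial>lborel)"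
    proof (rule nn_integral_cong)
      fix y
      have "(\<integral>\<^sup>+x. indicator A (c * x) * indicator ?B (c * x + y) \<partial>lborel)
         = (\<integral>\<^sup>+x. indicator A (c * (- (y / c) + x)) * indicator ?B (c * (- (y / c) + x) + y) \<partial>lborel)"
        by (rule nn_integral_lborel_translate[symmetric]) measurable
      then show "(\<integral>\<^sup>+x. indicator A (c * x) * indicator ?B (c * x + y) \<partial>lborel)
         = (\<integral>\<^sup>+x. indicator A (c * x - y) * indicator ?B (c * x) \<partial>lborel)"
        using c0 by (simp add: algebra_simps)
    qed
    also have "\<dots> = (\<integral>\<^sup>+x. \<integral>\<^sup>+y. indicator A (c * x - y) * indicator ?B (c * x) \<partial>lborel \<partial>lborel)"
      by (rule lborel_pair.Fubini') measurable
    also have "\<dots> = (\<integral>\<^sup>+x. emeasure lborel A * indicator ?B (c * x) \<partial>lborel)"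
      by (intro nn_integral_cong)
        (simp add: nn_integral_multc nn_integral_lborel_reflect[of "indicator A"])
    also have "\<dots> = emeasure lborel A * (\<integral>\<^sup>+x. indicator ?B (c * x) \<partial>lborel)"
      by (rule nn_integral_cmult) measurable
    also have "(\<lambda>x. indicator ?B (c * x)) = (indicator ?B :: complex \<Rightarrow> ennreal)"
      by (auto simp: indicator_def norm_mult c fun_eq_iff)
    finally have *: "emeasure (distr lborel borel ((*) c)) A * emeasure lborel ?B
        = emeasure lborel A * emeasure lborel ?B" by simp
    have "emeasure lborel ?B = ennreal pi"
      by (simp add: emeasure_ball unit_ball_vol_2)
    then show "emeasure (distr lborel borel ((*) c)) A = emeasure lborel A"
      using * by (simp add: ennreal_mult_cancel_left mult.commute[of _ "ennreal pi"])
  qed simp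
  then have "(\<integral>\<^sup>+z. f z \<partial>lborel) = (\<integral>\<^sup>+z. f z \<partial>distr lborel borel ((*) c))" by simp
  then show ?thesis by (simp add: nn_integral_distr)
qed

text \<open>The image of the area measure under \<open>z \<mapsto> |z|\<^sup>2\<close> has the constant density \<open>pi\<close>, because a disk of
  squared radius \<open>x\<close> has area \<open>pi * x\<close>.\<close>

lemma nn_integral_ball_radial:
  fixes h :: "real \<Rightarrow> ennreal"
  assumes [measurable]: "h \<in> borel_measurable borel"
  shows "(\<integral>\<^sup>+z\<in>ball 0 1. h ((cmod z)\<^sup>2) \<partial>lborel) = ennreal pi * (\<integral>\<^sup>+t\<in>{0..1}. h t \<partial>lborel)"
proof -
  let ?M = "distr (density lborel (indicator (ball 0 1 :: complex set))) borel (\<lambda>z. (cmod z)\<^sup>2)"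
  let ?N = "density lborel (\<lambda>t::real. ennreal pi * indicator {0..1} t)"
  have [measurable]: "ball (0::complex) 1 \<in> sets borel" by simp
  have area: "emeasure ?M {x<..} = (if x < 0 then ennreal pi else if x \<le> 1 then ennreal (pi * (1 - x)) else 0)" for x
  proof -
    have eqM: "emeasure ?M {x<..} = emeasure lborel {z \<in> ball (0::complex) 1. x < (cmod z)\<^sup>2}"
    proof -
      have "emeasure ?M {x<..} = (\<integral>\<^sup>+z. indicator (ball 0 1) z * indicator {x<..} ((cmod z)\<^sup>2) \<partial>lborel)"
        by (subst nn_integral_indicator[symmetric], simp,
            subst nn_integral_distr, simp, simp, subst nn_integral_density) (simp_all, measurable)
      also have "\<dots> = (\<integral>\<^sup>+z. indicator {z \<in> ball (0::complex) 1. x < (cmod z)\<^sup>2} z \<partial>lborel)"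
        by (intro nn_integral_cong) (auto simp: indicator_def)
      also have "\<dots> = emeasure lborel {z \<in> ball (0::complex) 1. x < (cmod z)\<^sup>2}"
        by (intro nn_integral_indicator) auto
      finally show ?thesis .
    qed
    consider "x < 0" | "0 \<le> x" "x \<le> 1" | "x > 1" by linarith
    then have "emeasure lborel {z \<in> ball (0::complex) 1. x < (cmod z)\<^sup>2} = (if x < 0 then ennreal pi else if x \<le> 1 then ennreal (pi * (1 - x)) else 0)"
    proof cases
      case 1
      then have "{z \<in> ball (0::complex) 1. x < (cmod z)\<^sup>2} = ball 0 1"
        by (auto intro: less_le_trans)
      then show ?thesis using 1 by (simp add: emeasure_ball unit_ball_vol_2)
    next
      case 2
      have sq: "x < (cmod z)\<^sup>2 \<longleftrightarrow> sqrt x < cmod z" for z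
        by (subst real_sqrt_less_iff[symmetric], subst real_sqrt_abs, subst abs_norm_cancel) (rule refl)
      have eq: "{z \<in> ball (0::complex) 1. x < (cmod z)\<^sup>2} = ball 0 1 - (ball 0 1 \<inter> cball 0 (sqrt x))"
        unfolding sq by auto
      have "emeasure lborel (ball 0 1 \<inter> cball (0::complex) (sqrt x)) = ennreal (pi * x)"
      proof (cases "x = 1")
        case True
        then have "ball 0 1 \<inter> cball (0::complex) (sqrt x) = ball 0 1" by auto
        then show ?thesis using True by (simp add: emeasure_ball unit_ball_vol_2)
      next
        case False
        then have "sqrt x < 1" using 2 by simp
        then have "cball (0::complex) (sqrt x) \<subseteq> ball 0 1" by (metis cball_subset_ball_iff dist_self add_0)
        then have "ball 0 1 \<inter> cball (0::complex) (sqrt x) = cball 0 (sqrt x)" by blast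
        then show ?thesis using 2 by (simp add: emeasure_cball unit_ball_vol_2)
      qed
      then have "emeasure lborel (ball 0 1 - (ball 0 1 \<inter> cball (0::complex) (sqrt x))) = ennreal pi - ennreal (pi * x)"
        by (subst emeasure_Diff) (auto simp: emeasure_ball unit_ball_vol_2)
      then show ?thesis unfolding eq using 2 by (simp add: ennreal_minus right_diff_distrib)
    next
      case 3
      then have e: "{z \<in> ball (0::complex) 1. x < (cmod z)\<^sup>2} = {}"
        by (auto simp: not_less) (smt (verit) norm_ge_zero power_le_one)
      show ?thesis unfolding e using 3 by simp
    qed
    then show ?thesis unfolding eqM .
  qed
  have "?M = ?N"
  proof (rule measure_eqI_lessThan)
    fix x :: real
    show "emeasure ?M {x<..} < \<infinity>" by (simp add: area)
    have "emeasure ?N {x<..} = ennreal pi * emeasure lborel ({0..1} \<inter> {x<..})"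
      by (simp add: emeasure_density mult.assoc nn_integral_cmult indicator_inter_arith[symmetric])
    also have "{0..1} \<inter> {x<..} = (if x < 0 then {0..1} else if x \<le> 1 then {x<..1} else {})" by auto
    finally show "emeasure ?M {x<..} = emeasure ?N {x<..}"
      unfolding area by (auto simp: ennreal_mult)
  qed auto
  then have "(\<integral>\<^sup>+t. h t \<partial>?M) = (\<integral>\<^sup>+t. h t \<partial>?N)" by simp
  then have "(\<integral>\<^sup>+z\<in>ball 0 1. h ((cmod z)\<^sup>2) \<partial>lborel) = (\<integral>\<^sup>+t. ennreal pi * (h t * indicator {0..1} t) \<partial>lborel)"
    by (simp add: nn_integral_distr nn_integral_density mult.commute mult.left_commute)
  then show ?thesis by (simp add: nn_integral_cmult)
qed

lemma borel_measurable_cis [measurable]: "cis \<in> borel_measurable borel"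
  by (intro borel_measurable_continuous_onI continuous_intros)

lemma borel_measurable_cnj [measurable]: "cnj \<in> borel_measurable borel"
  by (intro borel_measurable_continuous_onI continuous_intros)

abbreviation circle_measure :: "real measure" where
  "circle_measure \<equiv> uniform_measure lborel {0..2 * pi}"

lemma prob_space_circle_measure: "prob_space circle_measure"
  by (rule prob_space_uniform_measure) auto

lemma circle_measure_density:
  "circle_measure = density lborel (\<lambda>t. ennreal (indicator {0..2 * pi} t / (2 * pi)))"
  unfolding uniform_measure_def
  by (rule density_cong) (auto simp: indicator_def divide_ennreal ennreal_1[symmetric] simp del: ennreal_1)

lemma circle_average_cis:
  assumes "k \<noteq> (0::int)"
  shows "(\<integral>t. cis (of_int k * t) \<partial>circle_measure) = 0"
proof -
  let ?F = "\<lambda>t. cis (of_int k * t) / (\<i> * of_int k)"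
  have "(\<integral>t. cis (of_int k * t) \<partial>circle_measure)
      = (\<integral>t. (1 / (2 * pi)) *\<^sub>R (indicator {0..2 * pi} t *\<^sub>R cis (of_int k * t)) \<partial>lborel)"
    unfolding circle_measure_density
    by (subst integral_density) (auto intro!: borel_measurable_continuous_onI continuous_intros)
  also have "\<dots> = (1 / (2 * pi)) *\<^sub>R (\<integral>t. indicator {0..2 * pi} t *\<^sub>R cis (of_int k * t) \<partial>lborel)"
    by (rule integral_scaleR_right)
  also have "(\<integral>t. indicator {0..2 * pi} t *\<^sub>R cis (of_int k * t) \<partial>lborel) = ?F (2 * pi) - ?F 0"
  proof (rule integral_FTC_Icc)
    fix t :: real
    have D: "((\<lambda>z. exp (c * z) / c) has_field_derivative exp (c * z)) (at z)" if "c \<noteq> 0" for c z :: complex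
      using that by (auto intro!: derivative_eq_intros)
    show "(?F has_vector_derivative cis (of_int k * t)) (at t within {0..2 * pi})"
      unfolding cis_conv_exp of_real_mult of_real_of_int_eq
      by (rule has_vector_derivative_real_field[where f="\<lambda>z. exp (\<i> * (of_int k * z)) / (\<i> * of_int k)"])
        (use D[of "\<i> * of_int k" "of_real t"] assms in \<open>simp only: mult.assoc mult_eq_0_iff of_int_eq_0_iff complex_i_not_zero simp_thms\<close>)
  qed (auto intro!: continuous_intros)
  also have "?F (2 * pi) - ?F 0 = 0"
    using cis_multiple_2pi[of "of_int k"] by (simp add: mult_ac)
  finally show ?thesis by simp
qed

lemma circle_parseval_finite:
  fixes b :: "nat \<Rightarrow> complex"
  shows "(\<integral>t. (cmod (\<Sum>n<N. b n * cis (real n * t)))\<^sup>2 \<partial>circle_measure) = (\<Sum>n<N. (cmod (b n))\<^sup>2)"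
proof -
  interpret prob_space circle_measure by (rule prob_space_circle_measure)
  have [simp]: "integrable circle_measure (\<lambda>t. c * cis (of_int k * t))" for c k
    by (rule integrable_const_bound[of _ "cmod c"])
      (auto simp: norm_mult)
  have av: "(\<integral>t. cis (of_int k * t) \<partial>circle_measure) = (if k = 0 then 1 else 0)" for k
    using circle_average_cis[of k] prob_space by auto
  have "complex_of_real (\<integral>t. (cmod (\<Sum>n<N. b n * cis (real n * t)))\<^sup>2 \<partial>circle_measure)
      = (\<integral>t. complex_of_real ((cmod (\<Sum>n<N. b n * cis (real n * t)))\<^sup>2) \<partial>circle_measure)"
    by (simp only: integral_complex_of_real)
  also have "\<dots> = (\<integral>t. (\<Sum>n<N. \<Sum>m<N. (b n * cnj (b m)) * cis (of_int (int n - int m) * t)) \<partial>circle_measure)"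
  proof (rule Bochner_Integration.integral_cong[OF refl])
    fix t
    have "cis (real n * t) * cnj (cis (real m * t)) = cis (of_int (int n - int m) * t)" for n m :: nat
      by (simp add: cis_cnj cis_mult algebra_simps)
    then show "complex_of_real ((cmod (\<Sum>n<N. b n * cis (real n * t)))\<^sup>2)
       = (\<Sum>n<N. \<Sum>m<N. (b n * cnj (b m)) * cis (of_int (int n - int m) * t))"
      unfolding complex_norm_square cnj_sum sum_product complex_cnj_mult
      by (intro sum.cong refl) (simp add: mult_ac del: of_int_diff)
  qed
  also have "\<dots> = (\<Sum>n<N. \<Sum>m<N. (b n * cnj (b m)) * (if n = m then 1 else 0))"
    by (simp add: Bochner_Integration.integral_sum av del: of_int_diff cong: if_cong)
  also have "\<dots> = of_real (\<Sum>n<N. (cmod (b n))\<^sup>2)"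
    by (simp add: complex_norm_square[symmetric] if_distrib cong: if_cong)
  finally show ?thesis by (simp only: of_real_eq_iff)
qed

text \<open>Orthogonality gives the identity for partial sums. They are dominated by \<open>\<Sum> |b n|\<close>, so it passes
  to the limit.\<close>

lemma circle_parseval:
  fixes b :: "nat \<Rightarrow> complex"
  assumes b: "summable (\<lambda>n. cmod (b n))"
  shows "(\<integral>\<^sup>+t. ennreal ((cmod (\<Sum>n. b n * cis (real n * t)))\<^sup>2) \<partial>circle_measure)
       = (\<Sum>n. ennreal ((cmod (b n))\<^sup>2))"
proof -
  interpret prob_space circle_measure by (rule prob_space_circle_measure)
  let ?S = "\<lambda>N t. \<Sum>n<N. b n * cis (real n * t)" and ?T = "\<lambda>t. \<Sum>n. b n * cis (real n * t)"
  have sm: "summable (\<lambda>n. b n * cis (real n * t))" for t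
    by (rule summable_norm_cancel) (simp add: norm_mult b)
  have lim: "(\<lambda>N. ?S N t) \<longlonglongrightarrow> ?T t" for t
    by (rule summable_LIMSEQ[OF sm])
  have bd: "cmod (?S N t) \<le> (\<Sum>n. cmod (b n))" for N t
    by (rule order_trans[OF norm_sum]) (simp add: norm_mult sum_le_suminf[OF b])
  have meas[measurable]: "?S N \<in> borel_measurable borel" for N
    by (intro borel_measurable_continuous_onI continuous_intros)
  have [measurable]: "?T \<in> borel_measurable borel"
    by (rule borel_measurable_LIMSEQ_metric[OF meas lim])
  have bdT: "cmod (?T t) \<le> (\<Sum>n. cmod (b n))" for t
    by (rule LIMSEQ_le_const2[OF tendsto_norm[OF lim]]) (use bd in blast)
  have "(\<lambda>N. \<integral>t. (cmod (?S N t))\<^sup>2 \<partial>circle_measure) \<longlonglongrightarrow> (\<integral>t. (cmod (?T t))\<^sup>2 \<partial>circle_measure)"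
    by (rule integral_dominated_convergence[where w="\<lambda>_. (\<Sum>n. cmod (b n))\<^sup>2"])
      (auto intro!: tendsto_intros lim power_mono bd)
  then have sums: "(\<lambda>n. (cmod (b n))\<^sup>2) sums (\<integral>t. (cmod (?T t))\<^sup>2 \<partial>circle_measure)"
    unfolding circle_parseval_finite sums_def .
  have "(\<integral>\<^sup>+t. ennreal ((cmod (?T t))\<^sup>2) \<partial>circle_measure) = ennreal (\<integral>t. (cmod (?T t))\<^sup>2 \<partial>circle_measure)"
    by (intro nn_integral_eq_integral integrable_const_bound[of _ "(\<Sum>n. cmod (b n))\<^sup>2"])
      (auto intro!: power_mono bdT)
  also have "\<dots> = (\<Sum>n. ennreal ((cmod (b n))\<^sup>2))"
    using sums by (intro suminf_ennreal_eq[symmetric]) auto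
  finally show ?thesis .
qed

text \<open>The weight is radial, so \<open>|g|\<^sup>2\<close> may be replaced by its mean over circles around 0, in which
  Parseval's identity separates the coefficients.\<close>

lemma nn_integral_ball_power_series:
  fixes b :: "nat \<Rightarrow> complex" and w :: "real \<Rightarrow> real"
  assumes g: "continuous_on (ball 0 1) g" "\<And>z. z \<in> ball 0 1 \<Longrightarrow> (\<lambda>n. b n * z ^ n) sums g z"
    and [measurable]: "w \<in> borel_measurable borel" and w: "\<And>t. 0 \<le> w t"
  shows "(\<integral>\<^sup>+z\<in>ball 0 1. ennreal ((cmod (g z))\<^sup>2 * w ((cmod z)\<^sup>2)) \<partial>lborel)
    = (\<Sum>n. ennreal ((cmod (b n))\<^sup>2) * (ennreal pi * (\<integral>\<^sup>+t\<in>{0..1}. ennreal (t ^ n * w t) \<partial>lborel)))"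
proof -
  interpret C: prob_space circle_measure by (rule prob_space_circle_measure)
  interpret P: pair_sigma_finite circle_measure "lborel :: complex measure" ..
  have [measurable]: "ball (0::complex) 1 \<in> sets borel" by simp
  define g' where "g' = (\<lambda>z. indicator (ball 0 1) z *\<^sub>R g z)"
  have [measurable]: "g' \<in> borel_measurable borel"
    unfolding g'_def by (rule borel_measurable_continuous_on_indicator) (auto intro: g)
  let ?G = "\<lambda>z. ennreal ((cmod (g' z))\<^sup>2 * w ((cmod z)\<^sup>2))"
  have avg: "(\<integral>\<^sup>+t. ?G (cis t * z) \<partial>circle_measure)
      = (\<Sum>n. ennreal ((cmod (b n))\<^sup>2) * (ennreal (((cmod z)\<^sup>2) ^ n * w ((cmod z)\<^sup>2)))) * indicator (ball 0 1) z" for z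
  proof (cases "z \<in> ball 0 1")
    case True
    define s where "s = (1 + cmod z) / 2"
    have s: "cmod z < s" "s < 1" using True by (auto simp: s_def)
    then have "cmod (of_real s) < 1" using norm_ge_zero[of z] by (simp only: norm_of_real)
    then have "summable (\<lambda>n. b n * (of_real s) ^ n)"
      using g(2)[of "of_real s"] by (intro sums_summable) auto
    then have sm: "summable (\<lambda>n. cmod (b n * z ^ n))"
      by (rule powser_insidea) (use s in auto)
    have "g' (cis t * z) = (\<Sum>n. (b n * z ^ n) * cis (real n * t))" for t
    proof -
      have "cis t * z \<in> ball 0 1" using True by (simp add: norm_mult)
      then show ?thesis unfolding g'_def
        using sums_unique[OF g(2)[of "cis t * z"]]
        by (simp add: power_mult_distrib Complex.DeMoivre mult.commute mult.left_commute)
    qed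
    then have "(\<integral>\<^sup>+t. ?G (cis t * z) \<partial>circle_measure)
       = (\<integral>\<^sup>+t. ennreal (w ((cmod z)\<^sup>2)) * ennreal ((cmod (\<Sum>n. (b n * z ^ n) * cis (real n * t)))\<^sup>2) \<partial>circle_measure)"
      by (simp add: norm_mult ennreal_mult w mult.commute)
    also have "\<dots> = ennreal (w ((cmod z)\<^sup>2)) * (\<Sum>n. ennreal ((cmod (b n * z ^ n))\<^sup>2))"
    proof (subst nn_integral_cmult)
      have "(\<lambda>t. g' (cis t * z)) \<in> borel_measurable borel" by measurable
      then show "(\<lambda>t. ennreal ((cmod (\<Sum>n. b n * z ^ n * cis (real n * t)))\<^sup>2)) \<in> borel_measurable circle_measure"
        using \<open>\<And>t. g' (cis t * z) = _ t\<close> by simp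
    qed (simp add: circle_parseval[OF sm])
    finally show ?thesis using True
      by (simp add: norm_mult norm_power power_mult_distrib ennreal_mult w mult_ac
          flip: ennreal_suminf_cmult power_mult)
  qed (simp add: g'_def norm_mult)
  have "(\<integral>\<^sup>+z\<in>ball 0 1. ennreal ((cmod (g z))\<^sup>2 * w ((cmod z)\<^sup>2)) \<partial>lborel) = (\<integral>\<^sup>+z. ?G z \<partial>lborel)"
    by (intro nn_integral_cong) (auto simp: g'_def indicator_def)
  also have "\<dots> = (\<integral>\<^sup>+t. \<integral>\<^sup>+z. ?G z \<partial>lborel \<partial>circle_measure)"
    by (simp add: C.emeasure_space_1)
  also have "\<dots> = (\<integral>\<^sup>+t. \<integral>\<^sup>+z. ?G (cis t * z) \<partial>lborel \<partial>circle_measure)"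
    by (intro nn_integral_cong nn_integral_lborel_rotate[symmetric]) auto
  also have "\<dots> = (\<integral>\<^sup>+z. \<integral>\<^sup>+t. ?G (cis t * z) \<partial>circle_measure \<partial>lborel)"
    by (rule P.Fubini'[symmetric]) measurable
  also have "\<dots> = (\<integral>\<^sup>+z. (\<Sum>n. ennreal ((cmod (b n))\<^sup>2) * (ennreal (((cmod z)\<^sup>2) ^ n * w ((cmod z)\<^sup>2)) * indicator (ball 0 1) z)) \<partial>lborel)"
    unfolding avg by (simp add: mult.assoc flip: ennreal_suminf_multc)
  also have "\<dots> = (\<Sum>n. ennreal ((cmod (b n))\<^sup>2) * (\<integral>\<^sup>+z\<in>ball 0 1. ennreal (((cmod z)\<^sup>2) ^ n * w ((cmod z)\<^sup>2)) \<partial>lborel))"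
  proof (subst nn_integral_suminf)
    have [measurable]: "(\<lambda>z. ennreal (((cmod z)\<^sup>2) ^ n * w ((cmod z)\<^sup>2)) * indicator (ball 0 1) z) \<in> borel_measurable borel" for n
      by measurable
    then show "(\<lambda>z. ennreal ((cmod (b n))\<^sup>2) * (ennreal (((cmod z)\<^sup>2) ^ n * w ((cmod z)\<^sup>2)) * indicator (ball 0 1) z)) \<in> borel_measurable lborel" for n
      by simp
  qed (simp add: nn_integral_cmult)
  also have "\<dots> = (\<Sum>n. ennreal ((cmod (b n))\<^sup>2) * (ennreal pi * (\<integral>\<^sup>+t\<in>{0..1}. ennreal (t ^ n * w t) \<partial>lborel)))"
    by (subst nn_integral_ball_radial[symmetric]) auto
  finally show ?thesis .
qed

text \<open>The Taylor coefficients of \<open>(1 - t) powr (- \<beta>)\<close>, see \<open>kernel_coeff_sums\<close>.\<close>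

definition kernel_coeff :: "real \<Rightarrow> nat \<Rightarrow> real" where
  "kernel_coeff \<beta> n = pochhammer \<beta> n / fact n"

lemma kernel_coeff_0 [simp]: "kernel_coeff \<beta> 0 = 1"
  by (simp add: kernel_coeff_def)

lemma kernel_coeff_Suc: "kernel_coeff \<beta> (Suc n) = kernel_coeff \<beta> n * ((\<beta> + real n) / (real n + 1))"
  by (simp add: kernel_coeff_def pochhammer_Suc field_simps)

lemma kernel_coeff_pos: "0 < \<beta> \<Longrightarrow> 0 < kernel_coeff \<beta> n"
  by (simp add: kernel_coeff_def pochhammer_pos)

lemma kernel_coeff_antimono: "0 < \<beta> \<Longrightarrow> \<beta> \<le> 1 \<Longrightarrow> kernel_coeff \<beta> (Suc n) \<le> kernel_coeff \<beta> n"
  unfolding kernel_coeff_Suc using kernel_coeff_pos[of \<beta> n]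
  by (intro mult_left_le) auto

lemma kernel_coeff_sums:
  fixes z :: complex
  assumes "cmod z < 1"
  shows "(\<lambda>n. of_real (kernel_coeff \<beta> n) * z ^ n) sums (1 - z) powr (of_real (- \<beta>))"
proof -
  have "((of_real (- \<beta>) gchoose n) * (- z) ^ n) = of_real (kernel_coeff \<beta> n) * z ^ n" for n
  proof -
    have "(- z) ^ n = (-1) ^ n * z ^ n" by (rule power_minus)
    then show ?thesis
      by (simp add: gbinomial_pochhammer kernel_coeff_def pochhammer_of_real[symmetric] mult.assoc[symmetric]
          power_mult_distrib[symmetric])
  qed
  then show ?thesis
    using gen_binomial_complex[of "- z" "of_real (- \<beta>)"] assms by simp
qed

lemma nn_integral_Beta:
  assumes "0 < \<beta>"
  shows "(\<integral>\<^sup>+t\<in>{0..1}. ennreal (t ^ n * (1 - t) powr \<beta>) \<partial>lborel) = ennreal (Beta (real n + 1) (\<beta> + 1))"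
proof -
  have "(\<integral>\<^sup>+t\<in>{0..1}. ennreal (t ^ n * (1 - t) powr \<beta>) \<partial>lborel)
      = (\<integral>\<^sup>+t\<in>{0..1}. ennreal (t powr ((real n + 1) - 1) * (1 - t) powr ((\<beta> + 1) - 1)) \<partial>lborel)"
  proof (rule nn_integral_cong_AE)
    have "AE t in lborel. t \<noteq> (0::real)" by (rule AE_lborel_singleton)
    then show "AE t in lborel. ennreal (t ^ n * (1 - t) powr \<beta>) * indicator {0..1} t
        = ennreal (t powr ((real n + 1) - 1) * (1 - t) powr ((\<beta> + 1) - 1)) * indicator {0..1} t"
      by eventually_elim (auto simp: indicator_def powr_realpow)
  qed
  also have "\<dots> = ennreal (Beta (real n + 1) (\<beta> + 1))"
    using has_integral_Beta_real[of "real n + 1" "\<beta> + 1"] assms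
    by (intro nn_integral_has_integral_lebesgue') auto
  finally show ?thesis .
qed

text \<open>The squared norm of \<open>z ^ Suc n\<close> in the area integral is the reciprocal kernel coefficient up to a
  factor that stays between \<open>\<beta> / 2\<close> and \<open>\<beta>\<close>. This is the equivalence of the two norms.\<close>

lemma Beta_kernel_coeff:
  assumes "0 < \<beta>"
  shows "(real (Suc n))\<^sup>2 * Beta (real n + 1) (\<beta> + 1)
       = (real (Suc n) * \<beta> / (real (Suc n) + \<beta>)) / kernel_coeff \<beta> (Suc n)"
proof -
  have G: "Gamma \<beta> > 0" using assms by (rule Gamma_real_pos)
  have 1: "Gamma (real n + 1) = fact n" using Gamma_fact[of n, where 'a=real] by (simp add: add.commute)
  have 2: "Gamma (\<beta> + 1) = \<beta> * Gamma \<beta>" using assms by (subst Gamma_plus1) auto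
  have 3: "Gamma (real n + 1 + (\<beta> + 1)) = pochhammer \<beta> (Suc n) * (\<beta> + real (Suc n)) * Gamma \<beta>"
  proof -
    have "pochhammer \<beta> (Suc (Suc n)) = Gamma (\<beta> + real (Suc (Suc n))) / Gamma \<beta>"
      using assms by (intro pochhammer_Gamma) auto
    then show ?thesis using G by (simp add: pochhammer_Suc field_simps)
  qed
  have p: "pochhammer \<beta> (Suc n) > 0" using assms by (rule pochhammer_pos)
  have f: "real (Suc n) * fact n = fact (Suc n)" by simp
  have "(real (Suc n))\<^sup>2 * Beta (real n + 1) (\<beta> + 1)
      = real (Suc n) * fact (Suc n) * \<beta> / (pochhammer \<beta> (Suc n) * (\<beta> + real (Suc n)))"
    unfolding Beta_def 1 2 3 f[symmetric] using G p by (simp add: power2_eq_square del: of_nat_Suc)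
  then show ?thesis
    unfolding kernel_coeff_def using p by (simp add: mult_ac add_ac del: of_nat_Suc fact_Suc)
qed

lemma deriv_power_series:
  fixes a :: "nat \<Rightarrow> complex"
  assumes f: "\<And>z. z \<in> ball 0 1 \<Longrightarrow> (\<lambda>n. a n * z ^ n) sums f z" and z: "z \<in> ball 0 1"
  shows "(\<lambda>n. (of_nat (Suc n) * a (Suc n)) * z ^ n) sums deriv f z"
proof -
  have sm: "summable (\<lambda>n. a n * w ^ n)" if "cmod w < 1" for w
    using f[of w] that by (auto simp: sums_iff)
  have "((\<lambda>z. \<Sum>n. a n * z ^ n) has_field_derivative (\<Sum>n. diffs a n * z ^ n)) (at z)"
    by (rule termdiffs_strong'[of 1]) (use sm z in auto)
  then have "(f has_field_derivative (\<Sum>n. diffs a n * z ^ n)) (at z)"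
    by (rule DERIV_cong_ev[THEN iffD1, rotated -1])
      (use z f in \<open>auto simp: sums_iff intro!: eventually_nhds_in_open[of "ball 0 1", THEN eventually_mono]\<close>)
  then have "deriv f z = (\<Sum>n. diffs a n * z ^ n)" by (rule DERIV_imp_deriv)
  moreover have "summable (\<lambda>n. diffs a n * z ^ n)"
    by (rule termdiff_converges[of _ 1]) (use sm z in auto)
  ultimately show ?thesis by (simp add: sums_iff diffs_def)
qed

theorem dirichlet_space_iff:
  assumes "0 \<le> \<alpha>" "\<alpha> < 1"
  shows "f \<in> dirichlet_space \<alpha> \<longleftrightarrow>
    (\<exists>a. summable (\<lambda>n. (cmod (a n))\<^sup>2 / kernel_coeff (1 - \<alpha>) n) \<and>
         (\<forall>z\<in>ball 0 1. (\<lambda>n. a n * z ^ n) sums f z))"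
proof -
  define \<beta> where "\<beta> = 1 - \<alpha>"
  have \<beta>: "0 < \<beta>" "\<beta> \<le> 1" using assms by (auto simp: \<beta>_def)
  have key: "dirichlet_norm_sq \<alpha> f < \<infinity> \<longleftrightarrow> summable (\<lambda>n. (cmod (a n))\<^sup>2 / kernel_coeff \<beta> n)"
    if hol: "f holomorphic_on ball 0 1" and a: "\<And>z. z \<in> ball 0 1 \<Longrightarrow> (\<lambda>n. a n * z ^ n) sums f z" for a
  proof -
    define q where "q n = real (Suc n) * \<beta> / (real (Suc n) + \<beta>)" for n
    define u where "u n = (cmod (a (Suc n)))\<^sup>2 / kernel_coeff \<beta> (Suc n)" for n
    have q: "\<beta> / 2 \<le> q n" "q n \<le> \<beta>" for n
    proof -
      have "\<beta> * \<beta> \<le> \<beta>" "0 \<le> \<beta> * real n" using \<beta> by (auto intro: mult_left_le)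
      then have "\<beta> * \<beta> \<le> \<beta> + \<beta> * real n" by linarith
      then show "\<beta> / 2 \<le> q n" "q n \<le> \<beta>" using \<beta> by (simp_all add: q_def field_simps)
    qed
    have u: "0 \<le> u n" for n
      using kernel_coeff_pos[OF \<beta>(1)] by (simp add: u_def less_imp_le)
    have "(\<integral>\<^sup>+z\<in>ball 0 1. ennreal ((cmod (deriv f z))\<^sup>2 * (1 - (cmod z)\<^sup>2) powr (1 - \<alpha>)) \<partial>lborel)
        = (\<Sum>n. ennreal ((cmod (of_nat (Suc n) * a (Suc n)))\<^sup>2) *
            (ennreal pi * (\<integral>\<^sup>+t\<in>{0..1}. ennreal (t ^ n * (1 - t) powr \<beta>) \<partial>lborel)))"
      unfolding \<beta>_def
      by (rule nn_integral_ball_power_series[where w="\<lambda>t. (1 - t) powr (1 - \<alpha>)"])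
        (use hol deriv_power_series[OF a] in \<open>auto intro!: holomorphic_on_imp_continuous_on holomorphic_deriv\<close>)
    also have "\<dots> = (\<Sum>n. ennreal pi * ennreal (q n * u n))"
    proof (intro suminf_cong)
      fix n
      have B: "0 < Beta (real n + 1) (\<beta> + 1)"
        unfolding Beta_def using \<beta> by (intro divide_pos_pos mult_pos_pos Gamma_real_pos) auto
      have "q n * u n = (cmod (a (Suc n)))\<^sup>2 * ((real (Suc n))\<^sup>2 * Beta (real n + 1) (\<beta> + 1))"
        unfolding Beta_kernel_coeff[OF \<beta>(1)] q_def u_def by simp
      then show "ennreal ((cmod (of_nat (Suc n) * a (Suc n)))\<^sup>2) *
            (ennreal pi * (\<integral>\<^sup>+t\<in>{0..1}. ennreal (t ^ n * (1 - t) powr \<beta>) \<partial>lborel))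
          = ennreal pi * ennreal (q n * u n)"
        unfolding nn_integral_Beta[OF \<beta>(1)] using B
        by (simp add: norm_mult power_mult_distrib ennreal_mult'[symmetric] mult_ac del: of_nat_Suc)
    qed
    also have "\<dots> = ennreal pi * (\<Sum>n. ennreal (q n * u n))" by simp
    finally have "dirichlet_norm_sq \<alpha> f < \<infinity> \<longleftrightarrow> (\<Sum>n. ennreal (q n * u n)) \<noteq> \<top>"
      unfolding dirichlet_norm_sq_def by (auto simp: less_top[symmetric] ennreal_mult_eq_top_iff ennreal_eq_0_iff not_le)
    also have "\<dots> \<longleftrightarrow> summable (\<lambda>n. q n * u n)"
    proof -
      have "0 \<le> q n * u n" for n using q(1)[of n] u[of n] \<beta> by (intro mult_nonneg_nonneg) auto
      then show ?thesis
        using summable_suminf_not_top[of "\<lambda>n. q n * u n"] ennreal_suminf_neq_top[of "\<lambda>n. q n * u n"] by blast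
    qed
    also have "\<dots> \<longleftrightarrow> summable u"
    proof
      assume "summable u"
      then have "summable (\<lambda>n. \<beta> * u n)" by (rule summable_mult)
      then show "summable (\<lambda>n. q n * u n)"
      proof (rule summable_comparison_test'[of _ 0])
        show "norm (q n * u n) \<le> \<beta> * u n" for n
        proof -
          have "0 \<le> q n * u n" using q(1)[of n] u[of n] \<beta> by (intro mult_nonneg_nonneg) auto
          then show ?thesis using mult_right_mono[OF q(2)[of n] u[of n]] by (simp only: real_norm_def abs_of_nonneg)
        qed
      qed
    next
      assume "summable (\<lambda>n. q n * u n)"
      then have "summable (\<lambda>n. 2 / \<beta> * (q n * u n))" by (rule summable_mult)
      moreover have "u n \<le> 2 / \<beta> * (q n * u n)" for n
      proof -
        have "2 / \<beta> * (\<beta> / 2 * u n) \<le> 2 / \<beta> * (q n * u n)"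
          using mult_right_mono[OF q(1)[of n] u[of n]] \<beta> by (intro mult_left_mono) auto
        then show ?thesis using \<beta> by simp
      qed
      ultimately show "summable u"
        using u by (intro summable_comparison_test'[of "\<lambda>n. 2 / \<beta> * (q n * u n)" 0 u]) auto
    qed
    also have "\<dots> \<longleftrightarrow> summable (\<lambda>n. (cmod (a n))\<^sup>2 / kernel_coeff \<beta> n)"
      unfolding u_def by (rule summable_Suc_iff)
    finally show ?thesis .
  qed
  show ?thesis unfolding \<beta>_def[symmetric]
  proof
    assume "f \<in> dirichlet_space \<alpha>"
    then have hol: "f holomorphic_on ball 0 1" and fin: "dirichlet_norm_sq \<alpha> f < \<infinity>"
      by (auto simp: dirichlet_space_def)
    have s: "(\<lambda>n. ((deriv ^^ n) f 0 / fact n) * z ^ n) sums f z" if "z \<in> ball 0 1" for z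
      using holomorphic_power_series[OF hol that] unfolding diff_zero .
    show "\<exists>a. summable (\<lambda>n. (cmod (a n))\<^sup>2 / kernel_coeff \<beta> n) \<and> (\<forall>z\<in>ball 0 1. (\<lambda>n. a n * z ^ n) sums f z)"
      by (intro exI[of _ "\<lambda>n. (deriv ^^ n) f 0 / fact n"] conjI ballI s key[OF hol s, THEN iffD1] fin)
  next
    assume "\<exists>a. summable (\<lambda>n. (cmod (a n))\<^sup>2 / kernel_coeff \<beta> n) \<and> (\<forall>z\<in>ball 0 1. (\<lambda>n. a n * z ^ n) sums f z)"
    then obtain a where a: "summable (\<lambda>n. (cmod (a n))\<^sup>2 / kernel_coeff \<beta> n)"
      "\<And>z. z \<in> ball 0 1 \<Longrightarrow> (\<lambda>n. a n * z ^ n) sums f z" by blast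
    have hol: "f holomorphic_on ball 0 1"
      by (rule power_series_holomorphic[of 0 1 a]) (use a(2) in auto)
    then show "f \<in> dirichlet_space \<alpha>"
      using key[OF hol a(2)] a(1) by (simp add: dirichlet_space_def)
  qed
qed

section \<open>Square-summable families and normalized kernels\<close>

text \<open>Having \<open>\<ell>\<^sup>2\<close> norm at most \<open>N\<close>. Testing on finite subsets works for every index set and makes
  limits and triangle inequalities available without convergence conditions.\<close>

definition l2_bounded :: "real \<Rightarrow> ('i \<Rightarrow> complex) \<Rightarrow> 'i set \<Rightarrow> bool" where
  "l2_bounded N a S \<longleftrightarrow> (\<forall>F. finite F \<longrightarrow> F \<subseteq> S \<longrightarrow> L2_set (\<lambda>i. cmod (a i)) F \<le> N)"

lemma l2_boundedD: "l2_bounded N a S \<Longrightarrow> finite F \<Longrightarrow> F \<subseteq> S \<Longrightarrow> L2_set (\<lambda>i. cmod (a i)) F \<le> N"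
  by (simp add: l2_bounded_def)

lemma l2_bounded_nonneg: "l2_bounded N a S \<Longrightarrow> 0 \<le> N"
  by (auto simp: l2_bounded_def dest: spec[of _ "{}"])

lemma l2_bounded_sq:
  "0 \<le> N \<Longrightarrow> l2_bounded N a S \<longleftrightarrow> (\<forall>F. finite F \<longrightarrow> F \<subseteq> S \<longrightarrow> (\<Sum>i\<in>F. (cmod (a i))\<^sup>2) \<le> N\<^sup>2)"
  unfolding l2_bounded_def L2_set_def by (metis abs_of_nonneg real_sqrt_abs real_sqrt_le_iff)

lemma l2_bounded_mono: "l2_bounded N a S \<Longrightarrow> N \<le> M \<Longrightarrow> T \<subseteq> S \<Longrightarrow> l2_bounded M a T"
  by (meson l2_bounded_def order_trans)

lemma l2_bounded_mem: "l2_bounded N a S \<Longrightarrow> i \<in> S \<Longrightarrow> cmod (a i) \<le> N"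
  using l2_boundedD[of N a S "{i}"] by simp

lemma L2_set_norm_add_le:
  "L2_set (\<lambda>i. cmod (a i + b i)) F \<le> L2_set (\<lambda>i. cmod (a i)) F + L2_set (\<lambda>i. cmod (b i)) F"
  by (rule order_trans[OF L2_set_mono L2_set_triangle_ineq]) (auto intro: norm_triangle_ineq)

lemma l2_bounded_add: "l2_bounded N a S \<Longrightarrow> l2_bounded M b S \<Longrightarrow> l2_bounded (N + M) (\<lambda>i. a i + b i) S"
  unfolding l2_bounded_def
  by (intro allI impI, rule order_trans[OF L2_set_norm_add_le], rule add_mono) auto

lemma l2_bounded_scale: "l2_bounded N a S \<Longrightarrow> l2_bounded (cmod c * N) (\<lambda>i. c * a i) S"
  unfolding l2_bounded_def
  by (auto simp: norm_mult L2_set_right_distrib[symmetric] intro!: mult_left_mono)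

lemma l2_bounded_sum:
  "finite K \<Longrightarrow> (\<And>k. k \<in> K \<Longrightarrow> l2_bounded (N k) (a k) S) \<Longrightarrow> l2_bounded (\<Sum>k\<in>K. N k) (\<lambda>i. \<Sum>k\<in>K. a k i) S"
proof (induction K rule: finite_induct)
  case empty
  then show ?case by (simp add: l2_bounded_def L2_set_def)
next
  case (insert k K)
  then show ?case using l2_bounded_add[of "N k" "a k" S "sum N K" "\<lambda>i. \<Sum>k\<in>K. a k i"] by simp
qed

lemma l2_bounded_dominated:
  "l2_bounded N a S \<Longrightarrow> (\<And>i. i \<in> S \<Longrightarrow> cmod (b i) \<le> cmod (a i)) \<Longrightarrow> l2_bounded N b S"
  unfolding l2_bounded_def
  by (intro allI impI, rule order_trans[OF L2_set_mono[where g="\<lambda>i. cmod (a i)"]]) auto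

lemma l2_bounded_cong: "(\<And>i. i \<in> S \<Longrightarrow> a i = b i) \<Longrightarrow> l2_bounded N a S \<longleftrightarrow> l2_bounded N b S"
  using l2_bounded_dominated[of N a S b] l2_bounded_dominated[of N b S a] by auto

lemma l2_bounded_lim:
  assumes "\<And>k. l2_bounded N (a k) S" "\<And>i. i \<in> S \<Longrightarrow> (\<lambda>k. a k i) \<longlonglongrightarrow> b i"
  shows "l2_bounded N b S"
  unfolding l2_bounded_def
proof (intro allI impI)
  fix F assume F: "finite F" "F \<subseteq> S"
  have "(\<lambda>k. L2_set (\<lambda>i. cmod (a k i)) F) \<longlonglongrightarrow> L2_set (\<lambda>i. cmod (b i)) F"
    unfolding L2_set_def using F assms(2) by (intro tendsto_intros) auto
  then show "L2_set (\<lambda>i. cmod (b i)) F \<le> N"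
    by (rule LIMSEQ_le_const2) (use assms(1) F in \<open>auto simp: l2_bounded_def\<close>)
qed

lemma ex_l2_bounded_iff: "(\<exists>N. l2_bounded N a S) \<longleftrightarrow> (\<lambda>i. (cmod (a i))\<^sup>2) summable_on S"
proof
  assume "\<exists>N. l2_bounded N a S"
  then obtain N where N: "l2_bounded N a S" by blast
  then show "(\<lambda>i. (cmod (a i))\<^sup>2) summable_on S"
    using l2_bounded_nonneg[OF N] unfolding l2_bounded_sq[OF l2_bounded_nonneg[OF N]]
    by (intro nonneg_bdd_above_summable_on) (auto intro!: bdd_aboveI2[where M="N\<^sup>2"])
next
  assume s: "(\<lambda>i. (cmod (a i))\<^sup>2) summable_on S"
  have "0 \<le> infsum (\<lambda>i. (cmod (a i))\<^sup>2) S" by (rule infsum_nonneg) simp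
  then have "l2_bounded (sqrt (infsum (\<lambda>i. (cmod (a i))\<^sup>2) S)) a S"
    using s by (auto simp: l2_bounded_sq intro!: finite_sum_le_infsum)
  then show "\<exists>N. l2_bounded N a S" by blast
qed

lemma ell2_iff: "a \<in> ell2 S \<longleftrightarrow> (\<exists>N. l2_bounded N a S)"
  by (simp add: ell2_def ex_l2_bounded_iff)

lemma ex_l2_bounded_UNIV_iff: "(\<exists>N. l2_bounded N a UNIV) \<longleftrightarrow> summable (\<lambda>n. (cmod (a n))\<^sup>2)"
  by (simp add: ex_l2_bounded_iff summable_on_UNIV_nonneg_real_iff)

lemma l2_bounded_UNIV_sums:
  assumes "(\<lambda>n. (cmod (a n))\<^sup>2) sums s"
  shows "l2_bounded (sqrt s) a UNIV"
proof -
  have "(\<Sum>i\<in>F. (cmod (a i))\<^sup>2) \<le> s" if "finite F" for F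
    using assms that sum_le_suminf[of "\<lambda>n. (cmod (a n))\<^sup>2" F] by (auto simp: sums_iff)
  then show ?thesis by (auto simp: l2_bounded_def L2_set_def)
qed

lemma l2_pairing:
  fixes b v :: "nat \<Rightarrow> complex"
  assumes b: "l2_bounded N b UNIV" and v: "l2_bounded M v UNIV"
  shows "summable (\<lambda>n. cmod (b n * v n))" "cmod (\<Sum>n. b n * v n) \<le> N * M"
proof -
  have le: "(\<Sum>n<k. cmod (b n * v n)) \<le> N * M" for k
  proof -
    have "(\<Sum>n<k. cmod (b n * v n)) \<le> L2_set (\<lambda>n. cmod (b n)) {..<k} * L2_set (\<lambda>n. cmod (v n)) {..<k}"
      using L2_set_mult_ineq[of "\<lambda>n. cmod (b n)" "\<lambda>n. cmod (v n)" "{..<k}"] by (simp add: norm_mult)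
    also have "\<dots> \<le> N * M"
      by (intro mult_mono l2_boundedD[OF b] l2_boundedD[OF v] l2_bounded_nonneg[OF b]) auto
    finally show ?thesis .
  qed
  show s: "summable (\<lambda>n. cmod (b n * v n))"
    by (rule summableI_nonneg_bounded[OF _ le]) simp
  have "cmod (\<Sum>n. b n * v n) \<le> (\<Sum>n. cmod (b n * v n))" by (rule summable_norm[OF s])
  also have "\<dots> \<le> N * M" by (rule suminf_le_const[OF s le])
  finally show "cmod (\<Sum>n. b n * v n) \<le> N * M" .
qed

text \<open>The unit vector that represents the normalized evaluation at \<open>z\<close>. The pairing is bilinear: the
  vector is not conjugated in \<open>kernel_eval\<close> below.\<close>

definition kernel_vec :: "real \<Rightarrow> complex \<Rightarrow> nat \<Rightarrow> complex" where
  "kernel_vec \<beta> z n = of_real (sqrt (kernel_coeff \<beta> n) * (1 - (cmod z)\<^sup>2) powr (\<beta> / 2)) * z ^ n"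

text \<open>The modulus of the inner product of two kernel vectors, see \<open>kernel_vec_gram_abs\<close>.\<close>

definition gram_abs :: "real \<Rightarrow> complex \<Rightarrow> complex \<Rightarrow> real" where
  "gram_abs \<beta> x y = ((1 - (cmod x)\<^sup>2) * (1 - (cmod y)\<^sup>2)) powr (\<beta> / 2) * cmod (1 - cnj x * y) powr (- \<beta>)"

lemma ball_norm_sq: "z \<in> ball (0::complex) 1 \<Longrightarrow> 0 < 1 - (cmod z)\<^sup>2"
  by (simp add: power_less_one_iff)

lemma one_minus_cnj_mult_nz:
  assumes "x \<in> ball 0 1" "y \<in> ball 0 1" shows "0 < cmod (1 - cnj x * y)"
proof -
  have "cmod (cnj x * y) < 1"
    using assms mult_strict_mono'[of "cmod x" 1 "cmod y" 1] by (simp add: norm_mult)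
  then show ?thesis by auto
qed

lemma gram_abs_sym: "gram_abs \<beta> x y = gram_abs \<beta> y x"
proof -
  have "cmod (1 - cnj x * y) = cmod (cnj (1 - cnj x * y))" by (simp only: complex_mod_cnj)
  then show ?thesis unfolding gram_abs_def by (simp add: mult.commute)
qed

lemma gram_abs_nonneg: "0 \<le> gram_abs \<beta> x y" by (simp add: gram_abs_def)

lemma kernel_vec_gram:
  assumes "0 < \<beta>" "x \<in> ball 0 1" "y \<in> ball 0 1"
  shows "(\<lambda>n. kernel_vec \<beta> x n * cnj (kernel_vec \<beta> y n)) sums
     (of_real (((1 - (cmod x)\<^sup>2) * (1 - (cmod y)\<^sup>2)) powr (\<beta> / 2)) * (1 - x * cnj y) powr (of_real (- \<beta>)))"
proof -
  have "cmod (x * cnj y) < 1"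
    using assms mult_strict_mono'[of "cmod x" 1 "cmod y" 1] by (simp add: norm_mult)
  then have "(\<lambda>n. of_real (((1 - (cmod x)\<^sup>2) * (1 - (cmod y)\<^sup>2)) powr (\<beta> / 2)) *
       (of_real (kernel_coeff \<beta> n) * (x * cnj y) ^ n)) sums
     (of_real (((1 - (cmod x)\<^sup>2) * (1 - (cmod y)\<^sup>2)) powr (\<beta> / 2)) * (1 - x * cnj y) powr (of_real (- \<beta>)))"
    by (intro sums_mult kernel_coeff_sums)
  moreover have "of_real (((1 - (cmod x)\<^sup>2) * (1 - (cmod y)\<^sup>2)) powr (\<beta> / 2)) *
       (of_real (kernel_coeff \<beta> n) * (x * cnj y) ^ n) = kernel_vec \<beta> x n * cnj (kernel_vec \<beta> y n)" for n
  proof -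
    have "complex_of_real (kernel_coeff \<beta> n) = of_real (sqrt (kernel_coeff \<beta> n)) * of_real (sqrt (kernel_coeff \<beta> n))"
      using kernel_coeff_pos[OF assms(1), of n] by (simp flip: of_real_mult)
    then show ?thesis
      using ball_norm_sq[OF assms(2)] ball_norm_sq[OF assms(3)]
      by (simp add: kernel_vec_def powr_mult power_mult_distrib mult_ac)
  qed
  ultimately show ?thesis by simp
qed

lemma kernel_vec_gram_abs:
  assumes "0 < \<beta>" "x \<in> ball 0 1" "y \<in> ball 0 1"
  shows "cmod (\<Sum>n. kernel_vec \<beta> x n * cnj (kernel_vec \<beta> y n)) = gram_abs \<beta> x y"
proof -
  have "cmod (1 - x * cnj y) = cmod (cnj (1 - x * cnj y))" by (simp only: complex_mod_cnj)
  then show ?thesis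
    unfolding sums_unique[OF kernel_vec_gram[OF assms], symmetric]
    by (simp add: norm_mult norm_powr_real_powr' gram_abs_def)
qed

lemma kernel_vec_norm:
  assumes "0 < \<beta>" "x \<in> ball 0 1"
  shows "(\<lambda>n. (cmod (kernel_vec \<beta> x n))\<^sup>2) sums 1"
proof -
  have p: "0 < 1 - (cmod x)\<^sup>2" by (rule ball_norm_sq[OF assms(2)])
  have e: "1 - x * cnj x = of_real (1 - (cmod x)\<^sup>2)" by (simp only: complex_norm_square of_real_diff of_real_1)
  have "(\<lambda>n. complex_of_real ((cmod (kernel_vec \<beta> x n))\<^sup>2)) sums
    (of_real (((1 - (cmod x)\<^sup>2) * (1 - (cmod x)\<^sup>2)) powr (\<beta> / 2)) * (1 - x * cnj x) powr (of_real (- \<beta>)))"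
    using kernel_vec_gram[OF assms assms(2)] by (simp only: complex_norm_square)
  also have "(1 - x * cnj x) powr (of_real (- \<beta>)) = of_real ((1 - (cmod x)\<^sup>2) powr (- \<beta>))"
    unfolding e using p by (intro powr_of_real) auto
  also have "complex_of_real (((1 - (cmod x)\<^sup>2) * (1 - (cmod x)\<^sup>2)) powr (\<beta> / 2)) * of_real ((1 - (cmod x)\<^sup>2) powr (- \<beta>)) = of_real 1"
    unfolding of_real_mult[symmetric] using p by (simp add: powr_mult powr_add[symmetric])
  finally show ?thesis by (simp only: sums_of_real_iff)
qed

lemma l2_bounded_kernel_vec: "0 < \<beta> \<Longrightarrow> x \<in> ball 0 1 \<Longrightarrow> l2_bounded 1 (kernel_vec \<beta> x) UNIV"
  using l2_bounded_UNIV_sums[OF kernel_vec_norm] by simp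

definition kernel_eval :: "real \<Rightarrow> (nat \<Rightarrow> complex) \<Rightarrow> complex \<Rightarrow> complex" where
  "kernel_eval \<beta> b z = (\<Sum>n. b n * kernel_vec \<beta> z n)"

lemma kernel_eval_sums:
  assumes "0 < \<beta>" "x \<in> ball 0 1" "l2_bounded N b UNIV"
  shows "(\<lambda>n. b n * kernel_vec \<beta> x n) sums kernel_eval \<beta> b x"
  unfolding kernel_eval_def
  by (rule summable_sums, rule summable_norm_cancel, rule l2_pairing[OF assms(3) l2_bounded_kernel_vec[OF assms(1,2)]])

lemma kernel_eval_le:
  assumes "0 < \<beta>" "x \<in> ball 0 1" "l2_bounded N b UNIV"
  shows "cmod (kernel_eval \<beta> b x) \<le> N"
  using l2_pairing(2)[OF assms(3) l2_bounded_kernel_vec[OF assms(1,2)]] by (simp add: kernel_eval_def)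

lemma normalized_eval_power_series:
  assumes \<alpha>: "0 \<le> \<alpha>" "\<alpha> < 1" and z: "z \<in> ball 0 1"
  shows "(\<lambda>n. a n * z ^ n) sums f z \<longleftrightarrow>
    (\<lambda>n. (a n / of_real (sqrt (kernel_coeff (1 - \<alpha>) n))) * kernel_vec (1 - \<alpha>) z n) sums normalized_eval \<alpha> f z"
proof -
  let ?\<beta> = "1 - \<alpha>"
  have c: "kernel_coeff ?\<beta> n > 0" for n using \<alpha> by (intro kernel_coeff_pos) auto
  have p: "0 < 1 - (cmod z)\<^sup>2" by (rule ball_norm_sq[OF z])
  have "(dirichlet_kernel_norm \<alpha> z)\<^sup>2 = ((1 - (cmod z)\<^sup>2) powr (- (?\<beta> / 2)))\<^sup>2"
    unfolding dirichlet_kernel_norm_sq[OF z] using p by (simp add: power2_eq_square powr_add[symmetric])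
  moreover have "0 \<le> dirichlet_kernel_norm \<alpha> z"
    unfolding dirichlet_kernel_norm_def dirichlet_kernel_diag[OF z] by simp
  ultimately have "dirichlet_kernel_norm \<alpha> z = (1 - (cmod z)\<^sup>2) powr (- (?\<beta> / 2))"
    by (simp add: power2_eq_iff_nonneg)
  then have k: "normalized_eval \<alpha> f z = f z * of_real ((1 - (cmod z)\<^sup>2) powr (?\<beta> / 2))"
    by (simp add: normalized_eval_def powr_minus field_simps)
  have "(\<lambda>n. (a n / of_real (sqrt (kernel_coeff ?\<beta> n))) * kernel_vec ?\<beta> z n)
      = (\<lambda>n. a n * z ^ n * of_real ((1 - (cmod z)\<^sup>2) powr (?\<beta> / 2)))"
    using less_imp_neq[OF c] by (auto simp: kernel_vec_def fun_eq_iff)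
  then show ?thesis unfolding k using p by (simp add: sums_mult2_iff)
qed

lemma dirichlet_space_kernel_eval:
  assumes \<alpha>: "0 \<le> \<alpha>" "\<alpha> < 1" and f: "f \<in> dirichlet_space \<alpha>"
  obtains b N where "l2_bounded N b UNIV" "\<And>z. z \<in> ball 0 1 \<Longrightarrow> normalized_eval \<alpha> f z = kernel_eval (1 - \<alpha>) b z"
proof -
  obtain a where s: "summable (\<lambda>n. (cmod (a n))\<^sup>2 / kernel_coeff (1 - \<alpha>) n)"
    and a: "\<And>z. z \<in> ball 0 1 \<Longrightarrow> (\<lambda>n. a n * z ^ n) sums f z"
    using f unfolding dirichlet_space_iff[OF \<alpha>] by blast
  define b where "b n = a n / of_real (sqrt (kernel_coeff (1 - \<alpha>) n))" for n
  have c: "kernel_coeff (1 - \<alpha>) n > 0" for n using \<alpha> by (intro kernel_coeff_pos) auto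
  have "(cmod (b n))\<^sup>2 = (cmod (a n))\<^sup>2 / kernel_coeff (1 - \<alpha>) n" for n
    using less_imp_le[OF c] by (simp add: b_def norm_divide power_divide)
  then have "\<exists>N. l2_bounded N b UNIV" using s by (simp add: ex_l2_bounded_UNIV_iff)
  moreover have "normalized_eval \<alpha> f z = kernel_eval (1 - \<alpha>) b z" if "z \<in> ball 0 1" for z
    using a[OF that] unfolding normalized_eval_power_series[OF \<alpha> that] b_def kernel_eval_def by (simp add: sums_iff)
  ultimately show ?thesis using that by blast
qed

lemma kernel_eval_dirichlet_space:
  assumes \<alpha>: "0 \<le> \<alpha>" "\<alpha> < 1" and b: "l2_bounded N b UNIV"
  obtains f where "f \<in> dirichlet_space \<alpha>" "\<And>z. z \<in> ball 0 1 \<Longrightarrow> normalized_eval \<alpha> f z = kernel_eval (1 - \<alpha>) b z"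
proof -
  define a where "a n = b n * of_real (sqrt (kernel_coeff (1 - \<alpha>) n))" for n
  have c: "kernel_coeff (1 - \<alpha>) n > 0" for n using \<alpha> by (intro kernel_coeff_pos) auto
  have ba: "a n / of_real (sqrt (kernel_coeff (1 - \<alpha>) n)) = b n" for n
    using less_imp_neq[OF c[of n]] by (simp add: a_def)
  define f where "f z = kernel_eval (1 - \<alpha>) b z * of_real (dirichlet_kernel_norm \<alpha> z)" for z
  have n0: "dirichlet_kernel_norm \<alpha> z \<noteq> 0" if "z \<in> ball 0 1" for z
    using dirichlet_kernel_norm_sq[OF that, of \<alpha>] ball_norm_sq[OF that] by auto
  then have ne: "normalized_eval \<alpha> f z = kernel_eval (1 - \<alpha>) b z" if "z \<in> ball 0 1" for z
    using that by (simp add: normalized_eval_def f_def)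
  have "(\<lambda>n. a n * z ^ n) sums f z" if "z \<in> ball 0 1" for z
    unfolding normalized_eval_power_series[OF \<alpha> that] ba ne[OF that]
    using \<alpha> that b by (intro kernel_eval_sums) auto
  moreover have "(cmod (a n))\<^sup>2 / kernel_coeff (1 - \<alpha>) n = (cmod (b n))\<^sup>2" for n
    using c[of n] by (simp add: a_def norm_mult power_mult_distrib)
  then have "summable (\<lambda>n. (cmod (a n))\<^sup>2 / kernel_coeff (1 - \<alpha>) n)"
    using b ex_l2_bounded_UNIV_iff[of b] by auto
  ultimately have "f \<in> dirichlet_space \<alpha>" unfolding dirichlet_space_iff[OF \<alpha>] by blast
  then show ?thesis using ne that by blast
qed

theorem universal_interpolating_iff:
  assumes \<alpha>: "0 \<le> \<alpha>" "\<alpha> < 1"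
  shows "universal_interpolating \<alpha> \<Lambda> \<longleftrightarrow> \<Lambda> \<subseteq> ball 0 1 \<and>
    (\<forall>b N. l2_bounded N b UNIV \<longrightarrow> kernel_eval (1 - \<alpha>) b \<in> ell2 \<Lambda>) \<and>
    (\<forall>a\<in>ell2 \<Lambda>. \<exists>b N. l2_bounded N b UNIV \<and> (\<forall>x\<in>\<Lambda>. kernel_eval (1 - \<alpha>) b x = a x))"
proof (cases "\<Lambda> \<subseteq> ball 0 1")
  case sub: True
  have cong: "normalized_eval \<alpha> f \<in> ell2 \<Lambda> \<longleftrightarrow> kernel_eval (1 - \<alpha>) b \<in> ell2 \<Lambda>"
    if "\<And>z. z \<in> ball 0 1 \<Longrightarrow> normalized_eval \<alpha> f z = kernel_eval (1 - \<alpha>) b z" for f b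
    unfolding ell2_iff using sub that
    by (intro ex_cong1 l2_bounded_cong) blast
  have 1: "(\<forall>f\<in>dirichlet_space \<alpha>. normalized_eval \<alpha> f \<in> ell2 \<Lambda>) \<longleftrightarrow>
    (\<forall>b N. l2_bounded N b UNIV \<longrightarrow> kernel_eval (1 - \<alpha>) b \<in> ell2 \<Lambda>)"
  proof (intro iffI ballI allI impI)
    fix b :: "nat \<Rightarrow> complex" and N assume h: "\<forall>f\<in>dirichlet_space \<alpha>. normalized_eval \<alpha> f \<in> ell2 \<Lambda>" and b: "l2_bounded N b UNIV"
    obtain f where "f \<in> dirichlet_space \<alpha>" "\<And>z. z \<in> ball 0 1 \<Longrightarrow> normalized_eval \<alpha> f z = kernel_eval (1 - \<alpha>) b z"
      using kernel_eval_dirichlet_space[OF \<alpha> b] by blast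
    then show "kernel_eval (1 - \<alpha>) b \<in> ell2 \<Lambda>" using h cong[of f b] by simp
  next
    fix f assume h: "\<forall>b N. l2_bounded N b UNIV \<longrightarrow> kernel_eval (1 - \<alpha>) b \<in> ell2 \<Lambda>" and f: "f \<in> dirichlet_space \<alpha>"
    obtain b :: "nat \<Rightarrow> complex" and N where "l2_bounded N b UNIV" "\<And>z. z \<in> ball 0 1 \<Longrightarrow> normalized_eval \<alpha> f z = kernel_eval (1 - \<alpha>) b z"
      using dirichlet_space_kernel_eval[OF \<alpha> f] by blast
    then show "normalized_eval \<alpha> f \<in> ell2 \<Lambda>" using h cong[of f b] by blast
  qed
  have 2: "(\<exists>f\<in>dirichlet_space \<alpha>. \<forall>x\<in>\<Lambda>. normalized_eval \<alpha> f x = a x) \<longleftrightarrow>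
    (\<exists>b N. l2_bounded N b UNIV \<and> (\<forall>x\<in>\<Lambda>. kernel_eval (1 - \<alpha>) b x = a x))" for a
  proof
    assume "\<exists>f\<in>dirichlet_space \<alpha>. \<forall>x\<in>\<Lambda>. normalized_eval \<alpha> f x = a x"
    then obtain f where f: "f \<in> dirichlet_space \<alpha>" "\<forall>x\<in>\<Lambda>. normalized_eval \<alpha> f x = a x" by blast
    obtain b :: "nat \<Rightarrow> complex" and N where "l2_bounded N b UNIV" "\<And>z. z \<in> ball 0 1 \<Longrightarrow> normalized_eval \<alpha> f z = kernel_eval (1 - \<alpha>) b z"
      using dirichlet_space_kernel_eval[OF \<alpha> f(1)] by blast
    then show "\<exists>b N. l2_bounded N b UNIV \<and> (\<forall>x\<in>\<Lambda>. kernel_eval (1 - \<alpha>) b x = a x)"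
      using f(2) subsetD[OF sub] by (intro exI[of _ b] exI[of _ N]) (metis (no_types))
  next
    assume "\<exists>b N. l2_bounded N b UNIV \<and> (\<forall>x\<in>\<Lambda>. kernel_eval (1 - \<alpha>) b x = a x)"
    then obtain b :: "nat \<Rightarrow> complex" and N where b: "l2_bounded N b UNIV" "\<forall>x\<in>\<Lambda>. kernel_eval (1 - \<alpha>) b x = a x" by blast
    obtain f where "f \<in> dirichlet_space \<alpha>" "\<And>z. z \<in> ball 0 1 \<Longrightarrow> normalized_eval \<alpha> f z = kernel_eval (1 - \<alpha>) b z"
      using kernel_eval_dirichlet_space[OF \<alpha> b(1)] by blast
    then show "\<exists>f\<in>dirichlet_space \<alpha>. \<forall>x\<in>\<Lambda>. normalized_eval \<alpha> f x = a x"
      using b(2) subsetD[OF sub] by (intro bexI[of _ f]) (metis (no_types))+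
  qed
  show ?thesis unfolding universal_interpolating_def 1 2 ..
qed (simp add: universal_interpolating_def)

section \<open>Multiplication by polynomials and pseudohyperbolic estimates\<close>

lemma dirichlet_space_const:
  assumes "0 \<le> \<alpha>" "\<alpha> < 1" shows "(\<lambda>_. c) \<in> dirichlet_space \<alpha>"
  unfolding dirichlet_space_iff[OF assms]
proof (intro exI[of _ "\<lambda>n. if n = 0 then c else 0"] conjI ballI)
  show "summable (\<lambda>n. (cmod (if n = 0 then c else 0))\<^sup>2 / kernel_coeff (1 - \<alpha>) n)"
    by (rule summable_finite[of "{0}"]) auto
  show "(\<lambda>n. (if n = 0 then c else 0) * z ^ n) sums c" for z
    using sums_finite[of "{0}" "\<lambda>n. (if n = 0 then c else 0) * z ^ n"] by simp
qed

lemma dirichlet_space_add: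
  assumes \<alpha>: "0 \<le> \<alpha>" "\<alpha> < 1" and f: "f \<in> dirichlet_space \<alpha>" and g: "g \<in> dirichlet_space \<alpha>"
  shows "(\<lambda>z. f z + g z) \<in> dirichlet_space \<alpha>"
proof -
  have c: "kernel_coeff (1 - \<alpha>) n > 0" for n using \<alpha> by (intro kernel_coeff_pos) auto
  obtain a where a: "summable (\<lambda>n. (cmod (a n))\<^sup>2 / kernel_coeff (1 - \<alpha>) n)"
    and af: "\<And>z. z \<in> ball 0 1 \<Longrightarrow> (\<lambda>n. a n * z ^ n) sums f z"
    using f unfolding dirichlet_space_iff[OF \<alpha>] by blast
  obtain b where b: "summable (\<lambda>n. (cmod (b n))\<^sup>2 / kernel_coeff (1 - \<alpha>) n)"
    and bg: "\<And>z. z \<in> ball 0 1 \<Longrightarrow> (\<lambda>n. b n * z ^ n) sums g z"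
    using g unfolding dirichlet_space_iff[OF \<alpha>] by blast
  show ?thesis unfolding dirichlet_space_iff[OF \<alpha>]
  proof (intro exI[of _ "\<lambda>n. a n + b n"] conjI ballI)
    have le: "(cmod (a n + b n))\<^sup>2 \<le> 2 * (cmod (a n))\<^sup>2 + 2 * (cmod (b n))\<^sup>2" for n
    proof -
      have "(cmod (a n + b n))\<^sup>2 \<le> (cmod (a n) + cmod (b n))\<^sup>2"
        by (intro power_mono norm_triangle_ineq) simp
      also have "\<dots> \<le> 2 * (cmod (a n))\<^sup>2 + 2 * (cmod (b n))\<^sup>2"
        using zero_le_power2[of "cmod (a n) - cmod (b n)"] by (simp add: power2_eq_square algebra_simps)
      finally show ?thesis .
    qed
    have "summable (\<lambda>n. 2 * ((cmod (a n))\<^sup>2 / kernel_coeff (1 - \<alpha>) n) + 2 * ((cmod (b n))\<^sup>2 / kernel_coeff (1 - \<alpha>) n))"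
      by (intro summable_add summable_mult a b)
    then show "summable (\<lambda>n. (cmod (a n + b n))\<^sup>2 / kernel_coeff (1 - \<alpha>) n)"
    proof (rule summable_comparison_test'[of _ 0])
      show "norm ((cmod (a n + b n))\<^sup>2 / kernel_coeff (1 - \<alpha>) n)
        \<le> 2 * ((cmod (a n))\<^sup>2 / kernel_coeff (1 - \<alpha>) n) + 2 * ((cmod (b n))\<^sup>2 / kernel_coeff (1 - \<alpha>) n)" for n
        using divide_right_mono[OF le[of n] less_imp_le[OF c[of n]]] c[of n] by (simp add: add_divide_distrib)
    qed
    show "(\<lambda>n. (a n + b n) * z ^ n) sums (f z + g z)" if "z \<in> ball 0 1" for z
      using sums_add[OF af[OF that] bg[OF that]] by (simp add: algebra_simps)
  qed
qed

lemma dirichlet_space_cmult: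
  assumes \<alpha>: "0 \<le> \<alpha>" "\<alpha> < 1" and f: "f \<in> dirichlet_space \<alpha>"
  shows "(\<lambda>z. c * f z) \<in> dirichlet_space \<alpha>"
proof -
  obtain a where a: "summable (\<lambda>n. (cmod (a n))\<^sup>2 / kernel_coeff (1 - \<alpha>) n)"
    and af: "\<And>z. z \<in> ball 0 1 \<Longrightarrow> (\<lambda>n. a n * z ^ n) sums f z"
    using f unfolding dirichlet_space_iff[OF \<alpha>] by blast
  show ?thesis unfolding dirichlet_space_iff[OF \<alpha>]
  proof (intro exI[of _ "\<lambda>n. c * a n"] conjI ballI)
    show "summable (\<lambda>n. (cmod (c * a n))\<^sup>2 / kernel_coeff (1 - \<alpha>) n)"
      using summable_mult[OF a, of "(cmod c)\<^sup>2"] by (simp add: norm_mult power_mult_distrib)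
    show "(\<lambda>n. (c * a n) * z ^ n) sums (c * f z)" if "z \<in> ball 0 1" for z
      using sums_mult[OF af[OF that]] by (simp add: mult.assoc)
  qed
qed

lemma dirichlet_space_mult_z:
  assumes \<alpha>: "0 \<le> \<alpha>" "\<alpha> < 1" and f: "f \<in> dirichlet_space \<alpha>"
  shows "(\<lambda>z. z * f z) \<in> dirichlet_space \<alpha>"
proof -
  let ?c = "kernel_coeff (1 - \<alpha>)"
  have c: "?c n > 0" for n using \<alpha> by (intro kernel_coeff_pos) auto
  obtain a where a: "summable (\<lambda>n. (cmod (a n))\<^sup>2 / ?c n)"
    and af: "\<And>z. z \<in> ball 0 1 \<Longrightarrow> (\<lambda>n. a n * z ^ n) sums f z"
    using f unfolding dirichlet_space_iff[OF \<alpha>] by blast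
  define a' where "a' n = (case n of 0 \<Rightarrow> 0 | Suc m \<Rightarrow> a m)" for n
  show ?thesis unfolding dirichlet_space_iff[OF \<alpha>]
  proof (intro exI[of _ a'] conjI ballI)
    have "?c n \<le> ?c (Suc n) * (1 / (1 - \<alpha>))" for n
    proof -
      have "(1 - \<alpha>) * (real n + 1) \<le> 1 - \<alpha> + real n"
        using \<alpha> mult_right_mono[of "1 - \<alpha>" 1 "real n"] by (simp add: algebra_simps)
      then have "1 \<le> (1 - \<alpha> + real n) / ((1 - \<alpha>) * (real n + 1))"
        using \<alpha> by (subst le_divide_eq_1_pos) auto
      then have "?c n * 1 \<le> ?c n * ((1 - \<alpha> + real n) / ((1 - \<alpha>) * (real n + 1)))"
        using c[of n] by (intro mult_left_mono) auto
      then show ?thesis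
        unfolding kernel_coeff_Suc by (simp add: mult.commute)
    qed
    then have "1 / ?c (Suc n) \<le> (1 / (1 - \<alpha>)) * (1 / ?c n)" for n
      using c[of n] c[of "Suc n"] \<alpha> by (simp add: field_simps)
    then have le: "(cmod (a n))\<^sup>2 / ?c (Suc n) \<le> (1 / (1 - \<alpha>)) * ((cmod (a n))\<^sup>2 / ?c n)" for n
      using mult_left_mono[of "1 / ?c (Suc n)" "(1 / (1 - \<alpha>)) * (1 / ?c n)" "(cmod (a n))\<^sup>2"] by (simp add: mult_ac)
    have "summable (\<lambda>n. (cmod (a n))\<^sup>2 / ?c (Suc n))"
      by (rule summable_comparison_test'[OF summable_mult[OF a, of "1 / (1 - \<alpha>)"], of 0])
        (use le less_imp_le[OF c] in simp)
    then show "summable (\<lambda>n. (cmod (a' n))\<^sup>2 / ?c n)"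
      by (subst summable_Suc_iff[symmetric]) (simp add: a'_def)
    show "(\<lambda>n. a' n * z ^ n) sums (z * f z)" if "z \<in> ball 0 1" for z
      using sums_mult[OF af[OF that], of z] sums_Suc_iff[of "\<lambda>n. a' n * z ^ n" "z * f z"]
      by (simp add: a'_def mult_ac)
  qed
qed

lemma pseudohyperbolic_identity:
  assumes "x \<in> ball (0::complex) 1" "y \<in> ball 0 1"
  shows "1 - (cmod (x - y) / cmod (1 - cnj x * y))\<^sup>2
       = (1 - (cmod x)\<^sup>2) * (1 - (cmod y)\<^sup>2) / (cmod (1 - cnj x * y))\<^sup>2"
proof -
  have "(cmod (1 - cnj x * y))\<^sup>2 - (cmod (x - y))\<^sup>2 = (1 - (cmod x)\<^sup>2) * (1 - (cmod y)\<^sup>2)"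
    unfolding cmod_power2 by (simp add: power2_eq_square algebra_simps)
  then show ?thesis
    using one_minus_cnj_mult_nz[OF assms] by (simp add: power_divide field_simps)
qed

lemma gram_abs_sq:
  assumes "x \<in> ball (0::complex) 1" "y \<in> ball 0 1"
  shows "(gram_abs \<beta> x y)\<^sup>2 = (1 - (cmod (x - y) / cmod (1 - cnj x * y))\<^sup>2) powr \<beta>"
proof -
  note p = ball_norm_sq[OF assms(1)] ball_norm_sq[OF assms(2)] one_minus_cnj_mult_nz[OF assms]
  have "(cmod (1 - cnj x * y) powr - \<beta>)\<^sup>2 = 1 / ((cmod (1 - cnj x * y))\<^sup>2) powr \<beta>"
    using p by (simp add: power2_eq_square powr_mult powr_minus field_simps)
  moreover have "((((1 - (cmod x)\<^sup>2) * (1 - (cmod y)\<^sup>2))) powr (\<beta> / 2))\<^sup>2 = ((1 - (cmod x)\<^sup>2) * (1 - (cmod y)\<^sup>2)) powr \<beta>"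
    by (simp add: power2_eq_square powr_add[symmetric])
  ultimately show ?thesis
    unfolding pseudohyperbolic_identity[OF assms] gram_abs_def power_mult_distrib
    using p by (simp add: powr_divide)
qed

text \<open>Evaluate at \<open>x\<close> minus \<open>G\<close> times the evaluation at \<open>y\<close>, where \<open>G\<close> is the inner product of the two
  unit vectors. The difference vector has squared norm \<open>1 - |G|\<^sup>2 = 1 - (1 - p\<^sup>2) powr \<beta>\<close>, which is at
  most \<open>p\<^sup>2\<close> as \<open>\<beta> \<le> 1\<close>; here \<open>p\<close> is the pseudohyperbolic distance.\<close>

lemma kernel_eval_close:
  assumes \<beta>: "0 < \<beta>" "\<beta> \<le> 1" and xy: "x \<in> ball 0 1" "y \<in> ball 0 1" and b: "l2_bounded N b UNIV"
  shows "cmod (kernel_eval \<beta> b x) - cmod (kernel_eval \<beta> b y) \<le> N * (cmod (x - y) / cmod (1 - cnj x * y))"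
proof -
  let ?\<rho> = "cmod (x - y) / cmod (1 - cnj x * y)"
  define G where "G = (\<Sum>n. kernel_vec \<beta> x n * cnj (kernel_vec \<beta> y n))"
  define d where "d n = kernel_vec \<beta> x n - G * kernel_vec \<beta> y n" for n
  have G: "(\<lambda>n. kernel_vec \<beta> x n * cnj (kernel_vec \<beta> y n)) sums G"
    using kernel_vec_gram[OF \<beta>(1) xy] by (simp add: G_def sums_iff)
  have G2: "(cmod G)\<^sup>2 = (1 - ?\<rho>\<^sup>2) powr \<beta>"
    unfolding G_def kernel_vec_gram_abs[OF \<beta>(1) xy] by (rule gram_abs_sq[OF xy])
  have r: "0 < 1 - ?\<rho>\<^sup>2"
    unfolding pseudohyperbolic_identity[OF xy]
    using ball_norm_sq[OF xy(1)] ball_norm_sq[OF xy(2)] one_minus_cnj_mult_nz[OF xy] by simp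
  have "(1 - ?\<rho>\<^sup>2) powr 1 \<le> (1 - ?\<rho>\<^sup>2) powr \<beta>"
    using r \<beta> by (intro powr_mono') auto
  then have G_ge: "1 - (cmod G)\<^sup>2 \<le> ?\<rho>\<^sup>2" using r unfolding G2 by simp
  have "(1 - ?\<rho>\<^sup>2) powr \<beta> \<le> 1"
    using powr_mono2[of \<beta> "1 - ?\<rho>\<^sup>2" 1] r \<beta> by simp
  then have G1: "cmod G \<le> 1" unfolding G2[symmetric] by (simp add: power_le_one_iff)
  have "(\<lambda>n. complex_of_real ((cmod (d n))\<^sup>2)) sums
     (of_real 1 - cnj G * G - G * cnj G + G * cnj G * of_real 1)"
  proof -
    have e: "complex_of_real ((cmod (d n))\<^sup>2) = of_real ((cmod (kernel_vec \<beta> x n))\<^sup>2)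
       - cnj G * (kernel_vec \<beta> x n * cnj (kernel_vec \<beta> y n))
       - G * cnj (kernel_vec \<beta> x n * cnj (kernel_vec \<beta> y n))
       + G * cnj G * of_real ((cmod (kernel_vec \<beta> y n))\<^sup>2)" for n
      unfolding complex_norm_square d_def by (simp add: algebra_simps)
    show ?thesis unfolding e
      by (intro sums_add sums_diff sums_mult G sums_cnj[THEN iffD2] sums_of_real kernel_vec_norm \<beta> xy)
  qed
  also have "complex_of_real 1 - cnj G * G - G * cnj G + G * cnj G * of_real 1 = of_real (1 - (cmod G)\<^sup>2)"
    unfolding of_real_diff complex_norm_square by simp
  finally have "(\<lambda>n. (cmod (d n))\<^sup>2) sums (1 - (cmod G)\<^sup>2)" by (simp only: sums_of_real_iff)
  then have "l2_bounded (sqrt (1 - (cmod G)\<^sup>2)) d UNIV" by (rule l2_bounded_UNIV_sums)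
  then have d: "l2_bounded ?\<rho> d UNIV"
    by (rule l2_bounded_mono) (use real_sqrt_le_mono[OF G_ge] in auto)
  have "(\<lambda>n. b n * kernel_vec \<beta> x n - G * (b n * kernel_vec \<beta> y n)) sums (kernel_eval \<beta> b x - G * kernel_eval \<beta> b y)"
    by (intro sums_diff sums_mult kernel_eval_sums[OF \<beta>(1) xy(1) b] kernel_eval_sums[OF \<beta>(1) xy(2) b])
  then have "kernel_eval \<beta> b x - G * kernel_eval \<beta> b y = (\<Sum>n. b n * d n)"
    by (simp add: sums_iff d_def algebra_simps)
  then have "cmod (kernel_eval \<beta> b x - G * kernel_eval \<beta> b y) \<le> N * ?\<rho>"
    using l2_pairing(2)[OF b d] by simp
  moreover have "cmod (G * kernel_eval \<beta> b y) \<le> cmod (kernel_eval \<beta> b y)"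
    using G1 by (simp add: norm_mult mult_left_le_one_le)
  ultimately show ?thesis
    using norm_triangle_ineq2[of "kernel_eval \<beta> b x" "G * kernel_eval \<beta> b y"] by linarith
qed

section \<open>Necessary conditions for interpolation, and adding a point\<close>

lemma infinite_choice:
  fixes S :: "nat \<Rightarrow> 'a set"
  assumes "\<And>j. infinite (S j)"
  obtains x where "inj x" "\<And>j. x j \<in> S j"
proof -
  have "\<exists>x. \<forall>j::nat. x j \<in> S j \<and> x j \<notin> x ` {..<j}"
  proof (rule dependent_wellorder_choice)
    fix r and f g :: "nat \<Rightarrow> 'a" and j :: nat
    assume "\<And>i. i < j \<Longrightarrow> f i = g i"
    then have "f ` {..<j} = g ` {..<j}" by (intro image_cong) auto
    then show "(r \<in> S j \<and> r \<notin> f ` {..<j}) = (r \<in> S j \<and> r \<notin> g ` {..<j})" by simp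
  next
    fix j :: nat and f :: "nat \<Rightarrow> 'a"
    have "infinite (S j - f ` {..<j})" using assms by simp
    then show "\<exists>r. r \<in> S j \<and> r \<notin> f ` {..<j}" by (metis Diff_iff infinite_imp_nonempty ex_in_conv)
  qed
  then obtain x where x: "\<And>j. x j \<in> S j" "\<And>j. x j \<notin> x ` {..<j}" by blast
  have "inj x"
  proof (rule linorder_injI)
    fix i j :: nat assume "i < j"
    then show "x i \<noteq> x j" using x(2)[of j] by (metis imageI lessThan_iff)
  qed
  then show ?thesis using x that by blast
qed

text \<open>If the points are not separated, then for every \<open>\<delta>\<close> infinitely many of them have a neighbour
  closer than \<open>\<delta>\<close>: finitely many would leave only finitely many close pairs. Choose distinct \<open>x j\<close> with a
  neighbour closer than \<open>8 powr (- j)\<close> and prescribe \<open>2 powr (- j)\<close> at \<open>x j\<close> and 0 elsewhere. The neighbour may itself be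
  some \<open>x k\<close>, but in any case the two prescribed values differ by at least \<open>2 powr (- j) / 2\<close>, whereas an
  interpolating function of norm \<open>N\<close> allows a difference of at most \<open>N * 8 powr (- j)\<close>.\<close>

theorem universal_interpolating_imp_separated:
  assumes \<alpha>: "0 \<le> \<alpha>" "\<alpha> < 1" and ui: "universal_interpolating \<alpha> \<Lambda>"
  shows "separated \<Lambda>"
proof (rule ccontr)
  assume ns: "\<not> separated \<Lambda>"
  let ?\<rho> = "\<lambda>x y. cmod (x - y) / cmod (1 - cnj x * y)"
  have sym: "?\<rho> x y = ?\<rho> y x" for x y
  proof -
    have "cmod (1 - cnj x * y) = cmod (cnj (1 - cnj x * y))" by (simp only: complex_mod_cnj)
    then show ?thesis by (simp add: norm_minus_commute mult.commute)
  qed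
  have sub: "\<Lambda> \<subseteq> ball 0 1" using ui by (simp add: universal_interpolating_def)
  have pos: "0 < ?\<rho> x y" if "x \<in> \<Lambda>" "y \<in> \<Lambda>" "x \<noteq> y" for x y
    using that(3) one_minus_cnj_mult_nz[OF subsetD[OF sub that(1)] subsetD[OF sub that(2)]] by simp
  define S where "S \<delta> = {x \<in> \<Lambda>. \<exists>y\<in>\<Lambda>. x \<noteq> y \<and> ?\<rho> x y < \<delta>}" for \<delta>
  have inf: "infinite (S \<delta>)" if "0 < \<delta>" for \<delta>
  proof
    assume fin: "finite (S \<delta>)"
    \<comment> \<open>The element \<open>\<delta>\<close> keeps the set nonempty and covers the pairs that are not close.\<close>
    let ?T = "insert \<delta> ((\<lambda>p. ?\<rho> (fst p) (snd p)) ` {p \<in> S \<delta> \<times> S \<delta>. fst p \<noteq> snd p})"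
    have fT: "finite ?T" using fin by simp
    have "Min ?T \<in> ?T" by (rule Min_in[OF fT]) simp
    then have "Min ?T > 0" using that pos by (force simp: S_def simp del: Min_in Min_insert)
    moreover have "Min ?T \<le> ?\<rho> x y" if "x \<in> \<Lambda>" "y \<in> \<Lambda>" "x \<noteq> y" for x y
    proof (cases "?\<rho> x y < \<delta>")
      case True
      then have "x \<in> S \<delta>" "y \<in> S \<delta>" using that sym[of x y] unfolding S_def by (auto simp: eq_commute)
      then have "(x, y) \<in> {p \<in> S \<delta> \<times> S \<delta>. fst p \<noteq> snd p}" using that by simp
      then have "?\<rho> (fst (x, y)) (snd (x, y)) \<in> ?T" by blast
      then show ?thesis using Min_le[OF fT] by simp
    next
      case False
      then show ?thesis using Min_le[OF fT, of \<delta>] by simp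
    qed
    ultimately have "separated \<Lambda>" unfolding separated_def by blast
    then show False using ns by simp
  qed
  have "\<And>j::nat. infinite (S ((1/8) ^ j))" by (rule inf) simp
  from infinite_choice[of "\<lambda>j. S ((1/8) ^ j)", OF this]
  obtain x where inj: "inj x" and x: "\<And>j. x j \<in> S ((1/8) ^ j)" by blast
  define a :: "complex \<Rightarrow> complex" where "a z = (if z \<in> range x then of_real ((1/2) ^ (inv x z)) else 0)" for z
  have ax: "a (x j) = of_real ((1/2) ^ j)" for j by (simp add: a_def inv_f_f[OF inj])
  have "(\<lambda>j. (cmod (a (x j)))\<^sup>2) summable_on UNIV"
  proof -
    have "summable (\<lambda>j::nat. (1/4::real) ^ j)" by (rule summable_geometric) simp
    moreover have "(cmod (a (x j)))\<^sup>2 = (1/4) ^ j" for j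
      unfolding ax norm_of_real by (simp add: power2_eq_square power_mult_distrib[symmetric])
    ultimately show ?thesis by (simp add: summable_on_UNIV_nonneg_real_iff)
  qed
  then have "(\<lambda>z. (cmod (a z))\<^sup>2) summable_on range x"
    by (subst summable_on_reindex[OF inj]) (simp add: o_def)
  then have "(\<lambda>z. (cmod (a z))\<^sup>2) summable_on UNIV"
    by (rule summable_on_cong_neutral[THEN iffD1, rotated -1]) (auto simp: a_def)
  then have "a \<in> ell2 \<Lambda>" unfolding ell2_def using summable_on_subset_banach by blast
  then obtain b N where b: "l2_bounded N b UNIV" and ba: "\<And>x. x \<in> \<Lambda> \<Longrightarrow> kernel_eval (1 - \<alpha>) b x = a x"
    using ui unfolding universal_interpolating_iff[OF \<alpha>] by blast
  have "4 ^ j \<le> 2 * N" for j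
  proof -
    obtain y where y: "x j \<in> \<Lambda>" "y \<in> \<Lambda>" "x j \<noteq> y" "?\<rho> (x j) y < (1/8) ^ j"
      using x[of j] unfolding S_def by blast
    have N: "0 \<le> N" by (rule l2_bounded_nonneg[OF b])
    have le: "cmod (a u) - cmod (a v) \<le> N * ?\<rho> u v" if "u \<in> \<Lambda>" "v \<in> \<Lambda>" for u v
      using kernel_eval_close[of "1 - \<alpha>" u v N b] \<alpha> b ba[OF that(1)] ba[OF that(2)]
        subsetD[OF sub that(1)] subsetD[OF sub that(2)] by simp
    have "\<bar>cmod (a (x j)) - cmod (a y)\<bar> \<le> N * ?\<rho> (x j) y"
      using le[of "x j" y] le[of y "x j"] sym[of "x j" y] y by (simp add: abs_le_iff)
    also have "\<dots> \<le> N * (1/8) ^ j" using y N by (intro mult_left_mono) auto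
    finally have "\<bar>(1/2) ^ j - cmod (a y)\<bar> \<le> N * (1/8) ^ j" by (simp add: ax norm_power)
    moreover have "(1/2) ^ j / 2 \<le> \<bar>(1/2) ^ j - cmod (a y)\<bar>"
    proof (cases "y \<in> range x")
      case True
      then obtain k where k: "y = x k" by blast
      then have "k \<noteq> j" using y by auto
      then consider "Suc j \<le> k" | "Suc k \<le> j" by linarith
      then have "(1/2::real) ^ j / 2 \<le> \<bar>(1/2) ^ j - (1/2) ^ k\<bar>"
      proof cases
        case 1
        then have "(1/2::real) ^ k \<le> (1/2) ^ Suc j" by (intro power_decreasing) auto
        then show ?thesis using abs_ge_self[of "(1/2::real) ^ j - (1/2) ^ k"] by (simp only: power_Suc)
      next
        case 2
        then have "(1/2::real) ^ j \<le> (1/2) ^ Suc k" by (intro power_decreasing) auto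
        then show ?thesis using abs_ge_minus_self[of "(1/2::real) ^ j - (1/2) ^ k"] zero_le_power[of "1/2::real" j]
          by (simp only: power_Suc)
      qed
      then show ?thesis by (simp add: k ax norm_power)
    qed (simp add: a_def)
    ultimately have "(1/2) ^ j / 2 \<le> N * (1/8) ^ j" by linarith
    then have "8 ^ j * ((1/2) ^ j / 2) \<le> 8 ^ j * (N * (1/8) ^ j)" by (intro mult_left_mono) auto
    moreover have "(8::real) ^ j * (1/2) ^ j = 4 ^ j" "(8::real) ^ j * (1/8) ^ j = 1"
      by (simp_all add: power_mult_distrib[symmetric])
    ultimately show ?thesis by (simp add: mult_ac)
  qed
  moreover obtain j where "2 * N < 4 ^ j" using real_arch_pow[of 4 "2 * N"] by auto
  ultimately show False by (meson not_le)
qed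

lemma dirichlet_space_mult_linear:
  assumes \<alpha>: "0 \<le> \<alpha>" "\<alpha> < 1" and f: "f \<in> dirichlet_space \<alpha>"
  shows "(\<lambda>z. (z - p) * f z) \<in> dirichlet_space \<alpha>"
proof -
  have "(\<lambda>z. z * f z + (- p) * f z) \<in> dirichlet_space \<alpha>"
    by (intro dirichlet_space_add[OF \<alpha>] dirichlet_space_mult_z[OF \<alpha>] dirichlet_space_cmult[OF \<alpha>] f)
  then show ?thesis by (simp add: algebra_simps)
qed

lemma dirichlet_kernel_norm_pos: "z \<in> ball 0 1 \<Longrightarrow> 0 < dirichlet_kernel_norm \<alpha> z"
  unfolding dirichlet_kernel_norm_def dirichlet_kernel_diag using ball_norm_sq[of z] by (simp add: dirichlet_kernel_diag)

text \<open>Interpolate 1 at one point and 0 at the others, and cancel the single remaining value with a linear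
  factor.\<close>

theorem universal_interpolating_imp_zero_sequence:
  assumes \<alpha>: "0 \<le> \<alpha>" "\<alpha> < 1" and ui: "universal_interpolating \<alpha> \<Lambda>"
  shows "zero_sequence \<alpha> \<Lambda>"
proof (cases "\<Lambda> = {}")
  case True
  then show ?thesis
    unfolding zero_sequence_def using dirichlet_space_const[OF \<alpha>, of 1] by (intro bexI[of _ "\<lambda>_. 1"]) (auto intro!: exI[of _ 0])
next
  case False
  then obtain p where p: "p \<in> \<Lambda>" by blast
  have sub: "\<Lambda> \<subseteq> ball 0 1" using ui by (simp add: universal_interpolating_def)
  have "(\<lambda>z. if z = p then 1 else 0) \<in> ell2 \<Lambda>"
    unfolding ell2_def mem_Collect_eq
    by (rule summable_on_cong_neutral[THEN iffD1, OF _ _ _ summable_on_finite[of "{p}"]]) (use p in auto)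
  from ui[unfolded universal_interpolating_def, THEN conjunct2, THEN conjunct2, rule_format, OF this]
  obtain f where f: "f \<in> dirichlet_space \<alpha>"
    and fa: "\<And>x. x \<in> \<Lambda> \<Longrightarrow> normalized_eval \<alpha> f x = (if x = p then 1 else 0)"
    by blast
  have kn: "dirichlet_kernel_norm \<alpha> x > 0" if "x \<in> \<Lambda>" for x
    using that sub by (intro dirichlet_kernel_norm_pos) auto
  have fp: "f p \<noteq> 0" using fa[OF p] by (auto simp: normalized_eval_def)
  have f0: "f x = 0" if "x \<in> \<Lambda>" "x \<noteq> p" for x
    using fa[OF that(1)] that kn[OF that(1)] by (auto simp: normalized_eval_def)
  have pb: "p \<in> ball 0 1" using p sub by blast
  have "isCont f p"
    using f pb unfolding dirichlet_space_def
    by (metis (no_types, lifting) continuous_on_eq_continuous_at holomorphic_on_imp_continuous_on mem_Collect_eq open_ball)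
  then have "\<forall>\<^sub>F z in at p. f z \<noteq> 0"
    using fp by (intro tendsto_imp_eventually_ne[where c="f p"]) (auto simp: isCont_def)
  moreover have "\<forall>\<^sub>F z in at p. z \<in> ball 0 1" using pb by (intro eventually_at_in_open') auto
  moreover have "\<forall>\<^sub>F z in at p. z \<noteq> p" by (simp add: eventually_at_filter)
  ultimately have "\<forall>\<^sub>F z in at p. f z \<noteq> 0 \<and> z \<in> ball 0 1 \<and> z \<noteq> p" by eventually_elim simp
  from eventually_happens'[OF at_neq_bot this]
  obtain z where "f z \<noteq> 0" "z \<in> ball 0 1" "z \<noteq> p" by blast
  then show ?thesis unfolding zero_sequence_def
    using dirichlet_space_mult_linear[OF \<alpha> f, of p] f0
    by (intro bexI[of _ "\<lambda>z. (z - p) * f z"]) auto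
qed

lemma ell2_dominated:
  assumes "a \<in> ell2 S" "\<And>i. i \<in> S \<Longrightarrow> cmod (b i) \<le> C * cmod (a i)"
  shows "b \<in> ell2 S"
proof -
  obtain N where "l2_bounded N a S" using assms(1) unfolding ell2_iff by blast
  then have "l2_bounded (cmod (of_real C) * N) (\<lambda>i. of_real C * a i) S" by (rule l2_bounded_scale)
  then have "l2_bounded (cmod (of_real C) * N) b S"
    by (rule l2_bounded_dominated)
      (auto simp: norm_mult intro!: order_trans[OF assms(2) mult_right_mono[OF abs_ge_self]])
  then show ?thesis unfolding ell2_iff by blast
qed

text \<open>The constant function 1 belongs to the space, so \<open>\<Sum> (1 - |x|\<^sup>2) powr (1 - \<alpha>)\<close> is finite over the
  old points. They accumulate only at the circle and keep a positive distance from \<open>p\<close>, so dividing by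
  \<open>x - p\<close> preserves square summability. The ansatz \<open>c + (z - p) * g\<close> then prescribes the value at \<open>p\<close>
  by \<open>c\<close> and leaves to \<open>g\<close> an interpolation problem at the old points.\<close>

theorem universal_interpolating_insert:
  assumes \<alpha>: "0 \<le> \<alpha>" "\<alpha> < 1" and ui: "universal_interpolating \<alpha> \<Lambda>" and p: "p \<in> ball 0 1"
  shows "universal_interpolating \<alpha> (insert p \<Lambda>)"
proof (cases "p \<in> \<Lambda>")
  case True
  then show ?thesis using ui by (simp add: insert_absorb)
next
  case False
  have sub: "\<Lambda> \<subseteq> ball 0 1" using ui by (simp add: universal_interpolating_def)
  have kn: "dirichlet_kernel_norm \<alpha> x > 0" if "x \<in> \<Lambda>" for x
    using that sub by (intro dirichlet_kernel_norm_pos) auto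
  have one: "(\<lambda>x. 1 / of_real (dirichlet_kernel_norm \<alpha> x)) \<in> ell2 \<Lambda>"
  proof -
    have "normalized_eval \<alpha> (\<lambda>_. 1) \<in> ell2 \<Lambda>"
      using ui dirichlet_space_const[OF \<alpha>, of 1] unfolding universal_interpolating_def by blast
    then show ?thesis by (simp add: normalized_eval_def[abs_def])
  qed
  obtain e where e: "e > 0" "\<And>x. x \<in> \<Lambda> \<Longrightarrow> e \<le> cmod (x - p)"
  proof -
    define r where "r = (1 + cmod p) / 2"
    have r: "cmod p < r" "r < 1" using p by (auto simp: r_def)
    have r0: "0 \<le> r" using r(1) norm_ge_zero[of p] by linarith
    define m where "m = (1 - r\<^sup>2) powr (1 - \<alpha>)"
    have r2: "r\<^sup>2 < 1" using r r0 by (simp add: power_less_one_iff)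
    have m: "m > 0" using r2 by (simp add: m_def)
    have fin: "finite {x \<in> \<Lambda>. cmod x \<le> r}"
    proof (rule ccontr)
      assume inf: "infinite {x \<in> \<Lambda>. cmod x \<le> r}"
      obtain N where N: "l2_bounded N (\<lambda>x. 1 / of_real (dirichlet_kernel_norm \<alpha> x)) \<Lambda>"
        using one unfolding ell2_iff by blast
      obtain k :: nat where k: "N\<^sup>2 < of_nat k * m" using m by (metis reals_Archimedean3)
      obtain F where F: "finite F" "card F = k" "F \<subseteq> {x \<in> \<Lambda>. cmod x \<le> r}"
        using infinite_arbitrarily_large[OF inf] by blast
      have "of_nat k * m = (\<Sum>x\<in>F. m)" by (simp add: F)
      also have "\<dots> \<le> (\<Sum>x\<in>F. (cmod (1 / of_real (dirichlet_kernel_norm \<alpha> x)))\<^sup>2)"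
      proof (rule sum_mono)
        fix x assume "x \<in> F"
        then have x: "x \<in> \<Lambda>" "cmod x \<le> r" using F by auto
        then have xb: "x \<in> ball 0 1" using sub by blast
        have "(cmod (1 / of_real (dirichlet_kernel_norm \<alpha> x)))\<^sup>2 = 1 / (dirichlet_kernel_norm \<alpha> x)\<^sup>2"
          by (simp add: norm_divide power_divide)
        also have "\<dots> = (1 - (cmod x)\<^sup>2) powr (1 - \<alpha>)"
          unfolding dirichlet_kernel_norm_sq[OF xb] powr_minus by (simp add: divide_inverse)
        finally show "m \<le> (cmod (1 / of_real (dirichlet_kernel_norm \<alpha> x)))\<^sup>2"
          unfolding m_def using x \<alpha> r2 by (auto intro!: powr_mono2 power_mono)
      qed
      also have "\<dots> \<le> N\<^sup>2"
        using N[unfolded l2_bounded_sq[OF l2_bounded_nonneg[OF N]], rule_format, of F] F by blast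
      finally show False using k by simp
    qed
    let ?T = "insert (r - cmod p) ((\<lambda>x. cmod (x - p)) ` {x \<in> \<Lambda>. cmod x \<le> r})"
    have fT: "finite ?T" using fin by simp
    have "Min ?T \<in> ?T" by (rule Min_in[OF fT]) simp
    then have "Min ?T > 0" using r False by (auto simp del: Min_in Min_insert)
    moreover have "Min ?T \<le> cmod (x - p)" if "x \<in> \<Lambda>" for x
    proof (cases "cmod x \<le> r")
      case True
      then show ?thesis using that by (intro Min_le[OF fT]) blast
    next
      case False
      have "Min ?T \<le> r - cmod p" by (intro Min_le[OF fT]) blast
      also have "\<dots> \<le> cmod (x - p)" using False norm_triangle_ineq2[of x p] by linarith
      finally show ?thesis .
    qed
    ultimately show ?thesis using that by blast
  qed
  have ins: "a \<in> ell2 (insert p \<Lambda>) \<longleftrightarrow> a \<in> ell2 \<Lambda>" for a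
    unfolding ell2_def by (simp add: summable_on_insert_iff)
  show ?thesis unfolding universal_interpolating_def
  proof (intro conjI ballI)
    show "insert p \<Lambda> \<subseteq> ball 0 1" using sub p by blast
    show "normalized_eval \<alpha> f \<in> ell2 (insert p \<Lambda>)" if "f \<in> dirichlet_space \<alpha>" for f
      using that ui unfolding ins universal_interpolating_def by blast
  next
    fix a assume "a \<in> ell2 (insert p \<Lambda>)"
    then have a: "a \<in> ell2 \<Lambda>" by (simp add: ins)
    define c where "c = a p * of_real (dirichlet_kernel_norm \<alpha> p)"
    define h where "h x = a x + (- c) * (1 / of_real (dirichlet_kernel_norm \<alpha> x))" for x
    obtain N M where "l2_bounded N a \<Lambda>" "l2_bounded M (\<lambda>x. 1 / of_real (dirichlet_kernel_norm \<alpha> x)) \<Lambda>"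
      using a one unfolding ell2_iff by blast
    then have "l2_bounded (N + cmod (- c) * M) h \<Lambda>"
      unfolding h_def by (intro l2_bounded_add l2_bounded_scale)
    then have h: "h \<in> ell2 \<Lambda>" unfolding ell2_iff by blast
    have "(\<lambda>x. h x / (x - p)) \<in> ell2 \<Lambda>"
    proof (rule ell2_dominated[OF h])
      fix x assume "x \<in> \<Lambda>"
      then show "cmod (h x / (x - p)) \<le> (1 / e) * cmod (h x)"
        using e(1) e(2)[of x] by (simp add: norm_divide frac_le)
    qed
    from ui[unfolded universal_interpolating_def, THEN conjunct2, THEN conjunct2, rule_format, OF this]
    obtain g where g: "g \<in> dirichlet_space \<alpha>" "\<And>x. x \<in> \<Lambda> \<Longrightarrow> normalized_eval \<alpha> g x = h x / (x - p)"
      by blast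
    show "\<exists>f\<in>dirichlet_space \<alpha>. \<forall>x\<in>insert p \<Lambda>. normalized_eval \<alpha> f x = a x"
    proof (intro bexI[of _ "\<lambda>z. c + (z - p) * g z"] ballI)
      show "(\<lambda>z. c + (z - p) * g z) \<in> dirichlet_space \<alpha>"
        by (intro dirichlet_space_add[OF \<alpha>] dirichlet_space_const[OF \<alpha>] dirichlet_space_mult_linear[OF \<alpha>] g)
      fix x assume "x \<in> insert p \<Lambda>"
      then show "normalized_eval \<alpha> (\<lambda>z. c + (z - p) * g z) x = a x"
      proof
        assume "x = p"
        then show ?thesis using dirichlet_kernel_norm_pos[OF p, of \<alpha>] by (simp add: normalized_eval_def c_def)
      next
        assume x: "x \<in> \<Lambda>"
        then have xp: "x - p \<noteq> 0" using False by auto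
        have "normalized_eval \<alpha> (\<lambda>z. c + (z - p) * g z) x
          = c / of_real (dirichlet_kernel_norm \<alpha> x) + (x - p) * normalized_eval \<alpha> g x"
          by (simp add: normalized_eval_def add_divide_distrib)
        also have "\<dots> = a x" unfolding g(2)[OF x] using xp by (simp add: h_def)
        finally show ?thesis .
      qed
    qed
  qed
qed

section \<open>Interpolation from a small off-diagonal Gram matrix\<close>

definition offdiag :: "real \<Rightarrow> complex \<Rightarrow> complex \<Rightarrow> real" where
  "offdiag \<beta> x y = (if x = y then 0 else gram_abs \<beta> x y)"

text \<open>The trace of the fourth power of the off-diagonal matrix, which is the fourth power of its
  Schatten 4-norm.\<close>

definition cycle_sum :: "real \<Rightarrow> complex set \<Rightarrow> real" where
  "cycle_sum \<beta> F = (\<Sum>x\<in>F. \<Sum>y\<in>F. \<Sum>z\<in>F. \<Sum>w\<in>F. offdiag \<beta> x y * offdiag \<beta> y z * offdiag \<beta> z w * offdiag \<beta> w x)"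

lemma offdiag_sym: "offdiag \<beta> x y = offdiag \<beta> y x"
  by (simp add: offdiag_def gram_abs_sym)

lemma offdiag_nonneg: "0 \<le> offdiag \<beta> x y"
  by (simp add: offdiag_def gram_abs_nonneg)

lemma sum_swap_square:
  fixes A :: "'a \<Rightarrow> 'a \<Rightarrow> real"
  shows "(\<Sum>x\<in>F. (\<Sum>y\<in>F. A x y * u y)\<^sup>2) = (\<Sum>y\<in>F. \<Sum>z\<in>F. (\<Sum>x\<in>F. A x y * A x z) * (u y * u z))"
proof -
  have "(\<Sum>x\<in>F. (\<Sum>y\<in>F. A x y * u y)\<^sup>2) = (\<Sum>x\<in>F. \<Sum>y\<in>F. \<Sum>z\<in>F. (A x y * A x z) * (u y * u z))"
    by (simp add: power2_eq_square sum_product mult_ac)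
  also have "\<dots> = (\<Sum>y\<in>F. \<Sum>x\<in>F. \<Sum>z\<in>F. (A x y * A x z) * (u y * u z))" by (rule sum.swap)
  also have "\<dots> = (\<Sum>y\<in>F. \<Sum>z\<in>F. \<Sum>x\<in>F. (A x y * A x z) * (u y * u z))"
    by (intro sum.cong refl sum.swap)
  finally show ?thesis by (simp add: sum_distrib_right)
qed

text \<open>The operator norm of \<open>A\<close> is the square root of that of \<open>A\<^sup>2\<close>, which is at most the
  Hilbert--Schmidt norm of \<open>A\<^sup>2\<close>; the square of the latter is the cycle sum. So the bound
  \<open>1 / 256 = (1 / 4) ^ 4\<close> yields the operator norm \<open>1 / 4\<close>.\<close>

lemma offdiag_operator_bound:
  fixes u :: "complex \<Rightarrow> real"
  assumes F: "finite F" and T: "cycle_sum \<beta> F \<le> 1 / 256"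
  shows "L2_set (\<lambda>x. \<Sum>y\<in>F. offdiag \<beta> x y * u y) F \<le> 1 / 4 * L2_set u F"
proof -
  let ?A = "offdiag \<beta>"
  define B where "B y z = (\<Sum>x\<in>F. ?A x y * ?A x z)" for y z
  define s where "s = (\<Sum>y\<in>F. (u y)\<^sup>2)"
  have s0: "0 \<le> s" by (simp add: s_def sum_nonneg)
  have "(\<Sum>y\<in>F. \<Sum>z\<in>F. (B y z)\<^sup>2) = (\<Sum>y\<in>F. \<Sum>z\<in>F. \<Sum>x\<in>F. \<Sum>w\<in>F. ?A y x * ?A x z * ?A z w * ?A w y)"
    unfolding B_def power2_eq_square sum_product
    by (intro sum.cong refl) (simp add: offdiag_sym mult_ac)
  also have "\<dots> = cycle_sum \<beta> F"
    unfolding cycle_sum_def by (intro sum.cong refl sum.swap)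
  finally have B2: "(\<Sum>y\<in>F. \<Sum>z\<in>F. (B y z)\<^sup>2) \<le> 1 / 256" using T by simp
  have s2: "(\<Sum>y\<in>F. \<Sum>z\<in>F. (u y * u z)\<^sup>2) = s\<^sup>2"
    unfolding s_def power2_eq_square[of "sum _ _"] sum_product by (simp add: power_mult_distrib)
  have "(\<Sum>y\<in>F. \<Sum>z\<in>F. B y z * (u y * u z))\<^sup>2 = (\<Sum>p\<in>F \<times> F. B (fst p) (snd p) * (u (fst p) * u (snd p)))\<^sup>2"
    by (simp add: sum.cartesian_product case_prod_beta)
  also have "\<dots> \<le> (\<Sum>p\<in>F \<times> F. (B (fst p) (snd p))\<^sup>2) * (\<Sum>p\<in>F \<times> F. (u (fst p) * u (snd p))\<^sup>2)"
    by (rule Cauchy_Schwarz_ineq_sum)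
  also have "\<dots> = (\<Sum>y\<in>F. \<Sum>z\<in>F. (B y z)\<^sup>2) * (\<Sum>y\<in>F. \<Sum>z\<in>F. (u y * u z)\<^sup>2)"
    by (simp add: sum.cartesian_product case_prod_beta)
  also have "\<dots> \<le> 1 / 256 * s\<^sup>2" unfolding s2 by (intro mult_right_mono B2) simp
  also have "\<dots> = (1 / 16 * s)\<^sup>2" by (simp add: power2_eq_square)
  finally have "(\<Sum>y\<in>F. \<Sum>z\<in>F. B y z * (u y * u z)) \<le> 1 / 16 * s"
    by (rule power2_le_imp_le) (use s0 in simp)
  then have "(\<Sum>x\<in>F. (\<Sum>y\<in>F. ?A x y * u y)\<^sup>2) \<le> 1 / 16 * s"
    unfolding sum_swap_square B_def .
  then have "L2_set (\<lambda>x. \<Sum>y\<in>F. ?A x y * u y) F \<le> sqrt (1 / 16 * s)"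
    unfolding L2_set_def by (rule real_sqrt_le_mono)
  also have "\<dots> = 1 / 4 * L2_set u F"
    unfolding L2_set_def s_def real_sqrt_mult by (simp add: real_sqrt_divide)
  finally show ?thesis .
qed

text \<open>Cycles inside \<open>F\<close> and cycles inside \<open>G\<close> are different cycles of the union. A finite set whose
  cycle sum is nearly maximal therefore leaves little to the sets that are disjoint from it.\<close>

lemma cycle_sum_Un:
  assumes "finite F" "finite G" "F \<inter> G = {}"
  shows "cycle_sum \<beta> F + cycle_sum \<beta> G \<le> cycle_sum \<beta> (F \<union> G)"
proof -
  let ?h = "\<lambda>p. case p of (x, y, z, w) \<Rightarrow> offdiag \<beta> x y * offdiag \<beta> y z * offdiag \<beta> z w * offdiag \<beta> w x"
  let ?Q = "\<lambda>F :: complex set. F \<times> F \<times> F \<times> F"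
  have e: "cycle_sum \<beta> F = sum ?h (?Q F)" for F
    unfolding cycle_sum_def by (simp add: sum.cartesian_product)
  have "sum ?h (?Q F) + sum ?h (?Q G) = sum ?h (?Q F \<union> ?Q G)"
    using assms by (intro sum.union_disjoint[symmetric] finite_cartesian_product) auto
  also have "\<dots> \<le> sum ?h (?Q (F \<union> G))"
    using assms by (intro sum_mono2) (auto intro!: mult_nonneg_nonneg offdiag_nonneg)
  finally show ?thesis unfolding e .
qed

locale small_offdiag =
  fixes \<beta> :: real and \<Lambda> :: "complex set"
  assumes \<beta>: "0 < \<beta>" "\<beta> \<le> 1" and sub: "\<Lambda> \<subseteq> ball 0 1"
    and small: "\<And>F. finite F \<Longrightarrow> F \<subseteq> \<Lambda> \<Longrightarrow> cycle_sum \<beta> F \<le> 1 / 256"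
begin

lemma gram_sums:
  assumes "x \<in> \<Lambda>" "y \<in> \<Lambda>"
  shows "(\<lambda>n. kernel_vec \<beta> x n * cnj (kernel_vec \<beta> y n)) sums (\<Sum>n. kernel_vec \<beta> x n * cnj (kernel_vec \<beta> y n))"
  using kernel_vec_gram[OF \<beta>(1) subsetD[OF sub assms(1)] subsetD[OF sub assms(2)]]
  by (simp only: summable_sums sums_summable)

lemma gram_le:
  assumes "x \<in> \<Lambda>" "y \<in> \<Lambda>"
  shows "cmod (\<Sum>n. kernel_vec \<beta> x n * cnj (kernel_vec \<beta> y n)) \<le> (if x = y then 1 else 0) + offdiag \<beta> x y"
proof (cases "x = y")
  case True
  have "(\<lambda>n. complex_of_real ((cmod (kernel_vec \<beta> x n))\<^sup>2)) sums of_real 1"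
    using kernel_vec_norm[OF \<beta>(1), of x] assms sub by (simp only: sums_of_real_iff) blast
  then have "(\<Sum>n. kernel_vec \<beta> x n * cnj (kernel_vec \<beta> x n)) = 1"
    unfolding complex_norm_square by (simp add: sums_iff)
  then show ?thesis using True by (simp add: offdiag_def)
next
  case False
  then show ?thesis
    using kernel_vec_gram_abs[OF \<beta>(1), of x y] subsetD[OF sub assms(1)] subsetD[OF sub assms(2)] by (simp add: offdiag_def)
qed

text \<open>The squared norm of the combination is the quadratic form of the Gram matrix, which differs from the
  identity by an operator of norm at most \<open>1 / 4\<close>.\<close>

lemma synthesis_bounded:
  assumes F: "finite F" "F \<subseteq> \<Lambda>"
  shows "l2_bounded (2 * L2_set (\<lambda>x. cmod (c x)) F) (\<lambda>n. \<Sum>x\<in>F. c x * cnj (kernel_vec \<beta> x n)) UNIV"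
proof -
  let ?v = "kernel_vec \<beta>" and ?L = "L2_set (\<lambda>x. cmod (c x)) F"
  define s where "s n = (\<Sum>x\<in>F. c x * cnj (?v x n))" for n
  define G where "G x y = (\<Sum>n. ?v x n * cnj (?v y n))" for x y
  define S where "S = (\<Sum>x\<in>F. \<Sum>y\<in>F. c x * cnj (c y) * G y x)"
  have Gs: "(\<lambda>n. ?v x n * cnj (?v y n)) sums G x y" if "x \<in> F" "y \<in> F" for x y
    unfolding G_def using that F(2) by (intro gram_sums) blast+
  have "(\<lambda>n. complex_of_real ((cmod (s n))\<^sup>2)) sums S"
  proof -
    have "complex_of_real ((cmod (s n))\<^sup>2) = (\<Sum>x\<in>F. \<Sum>y\<in>F. c x * cnj (c y) * (?v y n * cnj (?v x n)))" for n
      unfolding complex_norm_square s_def cnj_sum sum_product by (simp add: mult_ac)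
    then show ?thesis
      unfolding S_def by (simp only:) (intro sums_sum sums_mult Gs)
  qed
  then have "(\<lambda>n. Re (complex_of_real ((cmod (s n))\<^sup>2))) sums Re S" by (rule sums_Re)
  then have "(\<lambda>n. (cmod (s n))\<^sup>2) sums Re S" by (simp only: Re_complex_of_real)
  then have "l2_bounded (sqrt (Re S)) s UNIV" by (rule l2_bounded_UNIV_sums)
  moreover have "Re S \<le> (2 * ?L)\<^sup>2"
  proof -
    have "Re S \<le> cmod S" by (rule complex_Re_le_cmod)
    also have "\<dots> \<le> (\<Sum>x\<in>F. \<Sum>y\<in>F. cmod (c x) * cmod (c y) * ((if y = x then 1 else 0) + offdiag \<beta> y x))"
      unfolding S_def
    proof (intro order_trans[OF norm_sum] sum_mono)
      fix x y assume "x \<in> F" "y \<in> F"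
      then have "cmod (G y x) \<le> (if y = x then 1 else 0) + offdiag \<beta> y x"
        unfolding G_def using F(2) by (intro gram_le) blast+
      then show "cmod (c x * cnj (c y) * G y x) \<le> cmod (c x) * cmod (c y) * ((if y = x then 1 else 0) + offdiag \<beta> y x)"
        unfolding norm_mult complex_mod_cnj by (intro mult_left_mono) auto
    qed
    also have "\<dots> = (\<Sum>x\<in>F. (cmod (c x))\<^sup>2) + (\<Sum>x\<in>F. cmod (c x) * (\<Sum>y\<in>F. offdiag \<beta> x y * cmod (c y)))"
    proof -
      have "(\<Sum>y\<in>F. cmod (c x) * cmod (c y) * ((if y = x then 1 else 0) + offdiag \<beta> y x))
          = (cmod (c x))\<^sup>2 + cmod (c x) * (\<Sum>y\<in>F. offdiag \<beta> x y * cmod (c y))" if "x \<in> F" for x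
      proof -
        have "(\<Sum>y\<in>F. cmod (c x) * cmod (c y) * ((if y = x then 1 else 0) + offdiag \<beta> y x))
            = (\<Sum>y\<in>F. (if y = x then (cmod (c x))\<^sup>2 else 0) + cmod (c x) * (offdiag \<beta> x y * cmod (c y)))"
          by (intro sum.cong refl) (simp add: offdiag_sym[of \<beta> x] algebra_simps power2_eq_square)
        then show ?thesis using that F(1) by (simp add: sum.distrib sum_distrib_left)
      qed
      then show ?thesis by (simp add: sum.distrib)
    qed
    also have "(\<Sum>x\<in>F. (cmod (c x))\<^sup>2) = ?L\<^sup>2" by (simp add: L2_set_def sum_nonneg)
    also have "(\<Sum>x\<in>F. cmod (c x) * (\<Sum>y\<in>F. offdiag \<beta> x y * cmod (c y))) \<le> ?L * (1 / 4 * ?L)"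
    proof -
      have nn: "0 \<le> (\<Sum>y\<in>F. offdiag \<beta> x y * cmod (c y))" for x
        by (intro sum_nonneg mult_nonneg_nonneg offdiag_nonneg) auto
      have "(\<Sum>x\<in>F. cmod (c x) * (\<Sum>y\<in>F. offdiag \<beta> x y * cmod (c y)))
          \<le> ?L * L2_set (\<lambda>x. \<Sum>y\<in>F. offdiag \<beta> x y * cmod (c y)) F"
        using L2_set_mult_ineq[of "\<lambda>x. cmod (c x)" "\<lambda>x. \<Sum>y\<in>F. offdiag \<beta> x y * cmod (c y)" F] nn by simp
      also have "\<dots> \<le> ?L * (1 / 4 * ?L)"
        by (intro mult_left_mono offdiag_operator_bound small F) simp
      finally show ?thesis .
    qed
    also have "?L\<^sup>2 + ?L * (1 / 4 * ?L) \<le> (2 * ?L)\<^sup>2"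
      using zero_le_power2[of ?L] by (simp add: power2_eq_square)
    finally show ?thesis by simp
  qed
  then have "sqrt (Re S) \<le> 2 * ?L" by (intro real_le_lsqrt) auto
  with calculation show ?thesis unfolding s_def using l2_bounded_mono[OF _ _ order_refl] by blast
qed

text \<open>Dual to \<open>synthesis_bounded\<close>: pair \<open>b\<close> with the combination whose coefficients are the values of
  \<open>b\<close> themselves.\<close>

lemma analysis_bounded:
  assumes b: "l2_bounded N b UNIV"
  shows "l2_bounded (2 * N) (kernel_eval \<beta> b) \<Lambda>"
  unfolding l2_bounded_def
proof (intro allI impI)
  fix F assume F: "finite F" "F \<subseteq> \<Lambda>"
  let ?v = "kernel_vec \<beta>" and ?y = "kernel_eval \<beta> b"
  let ?L = "L2_set (\<lambda>x. cmod (?y x)) F"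
  define s where "s n = (\<Sum>x\<in>F. ?y x * cnj (?v x n))" for n
  have "l2_bounded (2 * ?L) s UNIV" unfolding s_def by (rule synthesis_bounded[OF F])
  then have s: "l2_bounded (2 * ?L) (\<lambda>n. cnj (s n)) UNIV" by (rule l2_bounded_dominated) simp
  have "(\<lambda>n. \<Sum>x\<in>F. cnj (?y x) * (b n * ?v x n)) sums (\<Sum>x\<in>F. cnj (?y x) * ?y x)"
    by (intro sums_sum sums_mult kernel_eval_sums[OF \<beta>(1) _ b]) (use F sub in blast)+
  moreover have "(\<Sum>x\<in>F. cnj (?y x) * (b n * ?v x n)) = b n * cnj (s n)" for n
    by (simp add: s_def cnj_sum sum_distrib_left mult_ac)
  ultimately have "(\<Sum>x\<in>F. cnj (?y x) * ?y x) = (\<Sum>n. b n * cnj (s n))" by (simp add: sums_iff)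
  moreover have "(\<Sum>x\<in>F. cnj (?y x) * ?y x) = of_real (?L\<^sup>2)"
  proof -
    have "?L\<^sup>2 = (\<Sum>x\<in>F. (cmod (?y x))\<^sup>2)" by (simp add: L2_set_def sum_nonneg)
    then show ?thesis by (simp only: of_real_sum complex_norm_square mult.commute)
  qed
  ultimately have "of_real (?L\<^sup>2) = (\<Sum>n. b n * cnj (s n))" by simp
  then have "\<bar>?L\<^sup>2\<bar> \<le> N * (2 * ?L)"
    using l2_pairing(2)[OF b s] by (metis norm_of_real)
  then have "?L * ?L \<le> (2 * N) * ?L" by (simp add: power2_eq_square mult_ac)
  moreover have "?L = 0 \<or> 0 < ?L" using L2_set_nonneg[of "\<lambda>x. cmod (?y x)" F] by linarith
  ultimately show "?L \<le> 2 * N"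
    using l2_bounded_nonneg[OF b] mult_right_le_imp_le[of ?L ?L "2 * N"] by linarith
qed

text \<open>The data themselves, cut off to a finite set \<open>F\<close>, serve as coefficients of the kernel vectors. The
  diagonal of the Gram matrix reproduces the data on \<open>F\<close>. The error consists of the data outside \<open>F\<close> and
  of the off-diagonal part applied to the data on \<open>F\<close>, each of norm at most \<open>N / 4\<close>. As \<open>F\<close> is finite,
  no infinite sums over points occur.\<close>

lemma approximate_interpolation:
  assumes a: "l2_bounded N a \<Lambda>"
  obtains b where "l2_bounded (2 * N) b UNIV" "l2_bounded (N / 2) (\<lambda>x. a x - kernel_eval \<beta> b x) \<Lambda>"
proof -
  let ?v = "kernel_vec \<beta>"
  have N: "0 \<le> N" by (rule l2_bounded_nonneg[OF a])
  have a2: "(\<Sum>x\<in>E. (cmod (a x))\<^sup>2) \<le> N\<^sup>2" if "finite E" "E \<subseteq> \<Lambda>" for E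
    using a that unfolding l2_bounded_sq[OF N] by blast
  obtain F where F: "finite F" "F \<subseteq> \<Lambda>"
    and tail: "\<And>E. finite E \<Longrightarrow> E \<subseteq> \<Lambda> - F \<Longrightarrow> (\<Sum>x\<in>E. (cmod (a x))\<^sup>2) \<le> (N / 4)\<^sup>2"
  proof (cases "N = 0")
    case True
    then show ?thesis using a2 by (intro that[of "{}"]) auto
  next
    case False
    let ?P = "(\<lambda>E. \<Sum>x\<in>E. (cmod (a x))\<^sup>2) ` {E. finite E \<and> E \<subseteq> \<Lambda>}"
    have bdd: "bdd_above ?P" by (rule bdd_aboveI2[where M="N\<^sup>2"]) (use a2 in blast)
    have "Sup ?P - (N / 4)\<^sup>2 < Sup ?P" using False by simp
    moreover have ne: "?P \<noteq> {}" by blast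
    ultimately have "\<exists>r\<in>?P. Sup ?P - (N / 4)\<^sup>2 < r" by (intro less_cSup_iff[OF ne bdd, THEN iffD1])
    then obtain F where F: "finite F" "F \<subseteq> \<Lambda>" "Sup ?P - (N / 4)\<^sup>2 < (\<Sum>x\<in>F. (cmod (a x))\<^sup>2)" by blast
    have "(\<Sum>x\<in>E. (cmod (a x))\<^sup>2) \<le> (N / 4)\<^sup>2" if E: "finite E" "E \<subseteq> \<Lambda> - F" for E
    proof -
      have "(\<Sum>x\<in>E. (cmod (a x))\<^sup>2) + (\<Sum>x\<in>F. (cmod (a x))\<^sup>2) = (\<Sum>x\<in>E \<union> F. (cmod (a x))\<^sup>2)"
        using E F by (intro sum.union_disjoint[symmetric]) auto
      also have "\<dots> \<le> Sup ?P" using E F by (intro cSup_upper bdd) blast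
      finally show ?thesis using F(3) by linarith
    qed
    then show ?thesis using that F by blast
  qed
  define b where "b n = (\<Sum>x\<in>F. a x * cnj (?v x n))" for n
  have L: "L2_set (\<lambda>x. cmod (a x)) F \<le> N" by (rule l2_boundedD[OF a F])
  have b: "l2_bounded (2 * N) b UNIV"
    unfolding b_def by (rule l2_bounded_mono[OF synthesis_bounded[OF F]]) (use L in auto)
  have err: "cmod (a y - kernel_eval \<beta> b y)
      \<le> (if y \<in> F then 0 else cmod (a y)) + (\<Sum>x\<in>F. offdiag \<beta> y x * cmod (a x))" if y: "y \<in> \<Lambda>" for y
  proof -
    define G where "G x = (\<Sum>n. ?v y n * cnj (?v x n))" for x
    have Gs: "(\<lambda>n. ?v y n * cnj (?v x n)) sums G x" if "x \<in> F" for x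
      unfolding G_def using that y F(2) by (intro gram_sums) blast+
    have "(\<lambda>n. \<Sum>x\<in>F. a x * (?v y n * cnj (?v x n))) sums (\<Sum>x\<in>F. a x * G x)"
      by (intro sums_sum sums_mult Gs)
    moreover have "(\<Sum>x\<in>F. a x * (?v y n * cnj (?v x n))) = b n * ?v y n" for n
      by (simp add: b_def sum_distrib_left sum_distrib_right mult_ac)
    ultimately have ev: "kernel_eval \<beta> b y = (\<Sum>x\<in>F. a x * G x)" by (simp add: kernel_eval_def sums_iff)
    have Gyy: "G y = 1"
    proof -
      have "(\<lambda>n. complex_of_real ((cmod (?v y n))\<^sup>2)) sums of_real 1"
        using kernel_vec_norm[OF \<beta>(1), of y] y sub by (simp only: sums_of_real_iff) blast
      then show ?thesis unfolding G_def complex_norm_square by (simp add: sums_iff)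
    qed
    have G: "cmod (G x) \<le> offdiag \<beta> y x" if "x \<in> F" "x \<noteq> y" for x
      using gram_le[of y x] that y F by (auto simp: G_def)
    have ev2: "(\<Sum>x\<in>F. a x * G x) = (if y \<in> F then a y else 0) + (\<Sum>x\<in>F. if x = y then 0 else a x * G x)"
    proof (cases "y \<in> F")
      case True
      have "(\<Sum>x\<in>F - {y}. if x = y then 0 else a x * G x) = (\<Sum>x\<in>F - {y}. a x * G x)"
        by (intro sum.cong) auto
      then show ?thesis using F(1) Gyy True
        by (simp add: sum.remove[of F y])
    next
      case False
      then have "(\<Sum>x\<in>F. a x * G x) = (\<Sum>x\<in>F. if x = y then 0 else a x * G x)" by (intro sum.cong) auto
      then show ?thesis using False by simp
    qed
    have "cmod (\<Sum>x\<in>F. if x = y then 0 else a x * G x) \<le> (\<Sum>x\<in>F. offdiag \<beta> y x * cmod (a x))"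
    proof (rule order_trans[OF norm_sum], rule sum_mono)
      fix x assume "x \<in> F"
      then show "cmod (if x = y then 0 else a x * G x) \<le> offdiag \<beta> y x * cmod (a x)"
        using G[of x] by (auto simp: norm_mult offdiag_nonneg mult.commute[of _ "cmod (a x)"] intro!: mult_left_mono)
    qed
    then show ?thesis
      unfolding ev ev2
      using norm_triangle_ineq4[of "a y - (if y \<in> F then a y else 0)" "\<Sum>x\<in>F. if x = y then 0 else a x * G x"]
      by (auto simp: algebra_simps)
  qed
  have "l2_bounded (N / 2) (\<lambda>x. a x - kernel_eval \<beta> b x) \<Lambda>"
    unfolding l2_bounded_def
  proof (intro allI impI)
    fix E assume E: "finite E" "E \<subseteq> \<Lambda>"
    let ?u = "\<lambda>x. if x \<in> F then 0 else cmod (a x)" and ?w = "\<lambda>x. if x \<in> F then cmod (a x) else 0"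
    let ?H = "\<lambda>y. \<Sum>x\<in>F. offdiag \<beta> y x * cmod (a x)"
    have EF: "finite (E \<union> F)" "E \<union> F \<subseteq> \<Lambda>" using E F by auto
    have "L2_set (\<lambda>x. cmod (a x - kernel_eval \<beta> b x)) E \<le> L2_set (\<lambda>x. ?u x + ?H x) E"
    proof (rule L2_set_mono)
      show "cmod (a x - kernel_eval \<beta> b x) \<le> ?u x + ?H x" if "x \<in> E" for x
        by (rule err) (use that E in blast)
    qed simp
    also have "\<dots> \<le> L2_set ?u E + L2_set ?H E" by (rule L2_set_triangle_ineq)
    also have "L2_set ?u E \<le> N / 4"
    proof -
      have "(\<Sum>x\<in>E. (?u x)\<^sup>2) = (\<Sum>x\<in>E - F. (cmod (a x))\<^sup>2)"
        using E(1) by (intro sum.mono_neutral_cong_right) auto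
      also have "\<dots> \<le> (N / 4)\<^sup>2" using E by (intro tail) auto
      finally show ?thesis unfolding L2_set_def using N by (intro real_le_lsqrt) auto
    qed
    also have "L2_set ?H E \<le> L2_set ?H (E \<union> F)"
      unfolding L2_set_def using EF by (intro real_sqrt_le_mono sum_mono2) auto
    also have "\<dots> = L2_set (\<lambda>y. \<Sum>x\<in>E \<union> F. offdiag \<beta> y x * ?w x) (E \<union> F)"
      using EF by (intro L2_set_cong refl sum.mono_neutral_cong_left) auto
    also have "\<dots> \<le> 1 / 4 * L2_set ?w (E \<union> F)" by (intro offdiag_operator_bound small EF)
    also have "L2_set ?w (E \<union> F) = L2_set (\<lambda>x. cmod (a x)) F"
      unfolding L2_set_def using EF(1) by (intro arg_cong[where f=sqrt] sum.mono_neutral_cong_right) auto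
    finally show "L2_set (\<lambda>x. cmod (a x - kernel_eval \<beta> b x)) E \<le> N / 2" using L by simp
  qed
  then show ?thesis using that b by blast
qed

text \<open>Interpolating the residual again and again halves it each time, and the corrections form a
  geometrically convergent series.\<close>

lemma exact_interpolation:
  assumes a: "l2_bounded N a \<Lambda>"
  shows "\<exists>b M. l2_bounded M b UNIV \<and> (\<forall>x\<in>\<Lambda>. kernel_eval \<beta> b x = a x)"
proof -
  have N: "0 \<le> N" by (rule l2_bounded_nonneg[OF a])
  define P where "P N a b \<longleftrightarrow> l2_bounded (2 * N) b UNIV \<and> l2_bounded (N / 2) (\<lambda>x. a x - kernel_eval \<beta> b x) \<Lambda>" for N a b
  define B where "B N a = (SOME b. P N a b)" for N a
  have B: "P N a (B N a)" if h: "l2_bounded N a \<Lambda>" for N a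
  proof -
    obtain b where "P N a b" unfolding P_def using approximate_interpolation[OF h] by blast
    then show ?thesis unfolding B_def by (rule someI[of "P N a" b])
  qed
  \<comment> \<open>The residuals \<open>r k\<close> and the corrections \<open>b k\<close>.\<close>
  define r where "r = rec_nat a (\<lambda>k r x. r x - kernel_eval \<beta> (B (N / 2 ^ k) r) x)"
  define b where "b k = B (N / 2 ^ k) (r k)" for k
  have r0: "r 0 = a" and rS: "r (Suc k) = (\<lambda>x. r k x - kernel_eval \<beta> (b k) x)" for k
    by (simp_all add: r_def b_def)
  have rb: "l2_bounded (N / 2 ^ k) (r k) \<Lambda>" for k
  proof (induction k)
    case (Suc k)
    then show ?case using B[OF Suc] unfolding rS P_def b_def by (simp add: mult.commute)
  qed (simp add: r0 a)
  have bb: "l2_bounded (2 * (N / 2 ^ k)) (b k) UNIV" for k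
    using B[OF rb[of k]] unfolding P_def b_def by blast
  define S where "S K n = (\<Sum>k<K. b k n)" for K n
  have geo: "(\<Sum>k<J. 2 * (N / 2 ^ (K + k))) \<le> 4 * N / 2 ^ K" for J K
  proof -
    have "(\<Sum>k<J. 2 * (N / 2 ^ (K + k))) + 4 * N / 2 ^ (K + J) = 4 * N / 2 ^ K"
      by (induction J) simp_all
    moreover have "0 \<le> 4 * N / 2 ^ (K + J)" using N by simp
    ultimately show ?thesis by linarith
  qed
  have conv: "summable (\<lambda>k. b k n)" for n
  proof (rule summable_comparison_test'[of "\<lambda>k. 2 * N * (1/2) ^ k" 0])
    show "summable (\<lambda>k. 2 * N * (1/2) ^ k)" by (intro summable_mult summable_geometric) simp
    show "norm (b k n) \<le> 2 * N * (1/2) ^ k" for k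
      using l2_bounded_mem[OF bb, of n k] by (simp add: power_one_over)
  qed
  define c where "c n = (\<Sum>k. b k n)" for n
  have Sc: "(\<lambda>K. S K n) \<longlonglongrightarrow> c n" for n
    unfolding S_def c_def by (rule summable_LIMSEQ[OF conv])
  have tail: "l2_bounded (4 * N / 2 ^ K) (\<lambda>n. c n - S K n) UNIV" for K
  proof (rule l2_bounded_lim)
    fix J
    have "l2_bounded (\<Sum>k<J. 2 * (N / 2 ^ (K + k))) (\<lambda>n. \<Sum>k<J. b (K + k) n) UNIV"
      by (rule l2_bounded_sum[OF _ bb]) simp
    moreover have "(\<Sum>k<J. b (K + k) n) = S (K + J) n - S K n" for n
      by (induction J) (simp_all add: S_def)
    ultimately show "l2_bounded (4 * N / 2 ^ K) (\<lambda>n. S (K + J) n - S K n) UNIV"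
      using l2_bounded_mono[OF _ geo order_refl] by simp
  next
    fix n
    have "(\<lambda>J. S (K + J) n) \<longlonglongrightarrow> c n"
      using LIMSEQ_ignore_initial_segment[OF Sc[of n], of K] by (simp add: add.commute)
    then show "(\<lambda>J. S (K + J) n - S K n) \<longlonglongrightarrow> c n - S K n" by (intro tendsto_intros)
  qed
  have c: "l2_bounded (4 * N) c UNIV" using tail[of 0] by (simp add: S_def)
  have Sb: "l2_bounded (\<Sum>k<K. 2 * (N / 2 ^ k)) (S K) UNIV" for K
    unfolding S_def by (rule l2_bounded_sum[OF _ bb]) simp
  have "kernel_eval \<beta> c x = a x" if x: "x \<in> \<Lambda>" for x
  proof -
    have xb: "x \<in> ball 0 1" using x sub by blast
    have evS: "kernel_eval \<beta> (S K) x = a x - r K x" for K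
    proof (induction K)
      case 0
      then show ?case by (simp add: kernel_eval_def S_def r0)
    next
      case (Suc K)
      have "(\<lambda>n. S K n * kernel_vec \<beta> x n + b K n * kernel_vec \<beta> x n) sums (kernel_eval \<beta> (S K) x + kernel_eval \<beta> (b K) x)"
        by (intro sums_add kernel_eval_sums[OF \<beta>(1) xb Sb] kernel_eval_sums[OF \<beta>(1) xb bb])
      moreover have "S (Suc K) n * kernel_vec \<beta> x n = S K n * kernel_vec \<beta> x n + b K n * kernel_vec \<beta> x n" for n
        by (simp add: S_def algebra_simps)
      ultimately have "kernel_eval \<beta> (S (Suc K)) x = kernel_eval \<beta> (S K) x + kernel_eval \<beta> (b K) x"
        by (simp add: kernel_eval_def[of \<beta> "S (Suc K)"] sums_iff)
      then show ?case by (simp add: Suc rS)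
    qed
    have le: "cmod (kernel_eval \<beta> c x - a x) \<le> 5 * N * (1/2) ^ K" for K
    proof -
      have "(\<lambda>n. c n * kernel_vec \<beta> x n - S K n * kernel_vec \<beta> x n) sums (kernel_eval \<beta> c x - kernel_eval \<beta> (S K) x)"
        by (intro sums_diff kernel_eval_sums[OF \<beta>(1) xb c] kernel_eval_sums[OF \<beta>(1) xb Sb])
      then have "kernel_eval \<beta> c x - kernel_eval \<beta> (S K) x = kernel_eval \<beta> (\<lambda>n. c n - S K n) x"
        by (simp add: kernel_eval_def[of \<beta> "\<lambda>n. c n - S K n"] sums_iff left_diff_distrib)
      then have "cmod (kernel_eval \<beta> c x - (a x - r K x)) \<le> 4 * N / 2 ^ K"
        using kernel_eval_le[OF \<beta>(1) xb tail[of K]] by (simp add: evS)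
      moreover have "cmod (r K x) \<le> N / 2 ^ K" by (rule l2_bounded_mem[OF rb x])
      moreover have "cmod (kernel_eval \<beta> c x - a x) \<le> cmod (kernel_eval \<beta> c x - (a x - r K x)) + cmod (r K x)"
        using norm_triangle_ineq4[of "kernel_eval \<beta> c x - (a x - r K x)" "r K x"] by simp
      ultimately show ?thesis by (simp add: power_one_over)
    qed
    have "(\<lambda>K. 5 * N * (1/2) ^ K) \<longlonglongrightarrow> 5 * N * 0"
      by (intro tendsto_intros LIMSEQ_power_zero) simp
    then have "cmod (kernel_eval \<beta> c x - a x) \<le> 5 * N * 0"
      by (rule LIMSEQ_le_const) (use le in blast)
    then show ?thesis by simp
  qed
  then show ?thesis using c by blast
qed

end

lemma universal_interpolating_small_offdiag:
  assumes \<alpha>: "0 \<le> \<alpha>" "\<alpha> < 1" and s: "small_offdiag (1 - \<alpha>) \<Lambda>"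
  shows "universal_interpolating \<alpha> \<Lambda>"
proof -
  interpret small_offdiag "1 - \<alpha>" \<Lambda> by (rule s)
  show ?thesis
    unfolding universal_interpolating_iff[OF \<alpha>]
  proof (intro conjI allI impI ballI)
    show "kernel_eval (1 - \<alpha>) b \<in> ell2 \<Lambda>" if "l2_bounded N b UNIV" for b :: "nat \<Rightarrow> complex" and N
      using analysis_bounded[OF that] unfolding ell2_iff by blast
    show "\<exists>b N. l2_bounded N b UNIV \<and> (\<forall>x\<in>\<Lambda>. kernel_eval (1 - \<alpha>) b x = a x)" if "a \<in> ell2 \<Lambda>" for a
    proof -
      obtain N where "l2_bounded N a \<Lambda>" using \<open>a \<in> ell2 \<Lambda>\<close> unfolding ell2_iff by blast
      then show ?thesis by (rule exact_interpolation)
    qed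
  qed (rule sub)
qed

theorem universal_interpolating_cycle_sum:
  assumes \<alpha>: "0 \<le> \<alpha>" "\<alpha> < 1" and sub: "\<Lambda> \<subseteq> ball 0 1"
    and C: "\<And>F. finite F \<Longrightarrow> F \<subseteq> \<Lambda> \<Longrightarrow> cycle_sum (1 - \<alpha>) F \<le> C"
  shows "universal_interpolating \<alpha> \<Lambda>"
proof -
  let ?P = "cycle_sum (1 - \<alpha>) ` {F. finite F \<and> F \<subseteq> \<Lambda>}"
  have bdd: "bdd_above ?P" by (rule bdd_aboveI2[where M=C]) (use C in blast)
  have ne: "?P \<noteq> {}" by blast
  have "\<exists>r\<in>?P. Sup ?P - 1 / 256 < r" by (rule less_cSup_iff[OF ne bdd, THEN iffD1]) simp
  then obtain F where F: "finite F" "F \<subseteq> \<Lambda>" "Sup ?P - 1 / 256 < cycle_sum (1 - \<alpha>) F" by blast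
  have "small_offdiag (1 - \<alpha>) (\<Lambda> - F)"
  proof
    fix E assume E: "finite E" "E \<subseteq> \<Lambda> - F"
    have "cycle_sum (1 - \<alpha>) E + cycle_sum (1 - \<alpha>) F \<le> cycle_sum (1 - \<alpha>) (E \<union> F)"
      using E F by (intro cycle_sum_Un) auto
    also have "\<dots> \<le> Sup ?P" using E F by (intro cSup_upper bdd) blast
    finally show "cycle_sum (1 - \<alpha>) E \<le> 1 / 256" using F(3) by linarith
  qed (use \<alpha> sub in auto)
  then have 0: "universal_interpolating \<alpha> (\<Lambda> - F)" by (rule universal_interpolating_small_offdiag[OF \<alpha>])
  have "universal_interpolating \<alpha> (\<Lambda> - F \<union> G)" if "finite G" "G \<subseteq> F" for G
    using that
  proof (induction G rule: finite_induct)
    case (insert p G)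
    then have "p \<in> ball 0 1" using F sub by blast
    then have "universal_interpolating \<alpha> (insert p (\<Lambda> - F \<union> G))"
      using insert by (intro universal_interpolating_insert[OF \<alpha>]) auto
    then show ?case by simp
  qed (simp add: 0)
  from this[OF F(1) order_refl] have "universal_interpolating \<alpha> (\<Lambda> - F \<union> F)" .
  moreover have "\<Lambda> - F \<union> F = \<Lambda>" using F(2) by blast
  ultimately show ?thesis by simp
qed

section \<open>Circle averages of powers of the kernel\<close>

text \<open>A weak form of Jordan's inequality, from \<open>sin z \<ge> z * cos z\<close> at \<open>z = y / 2\<close> and
  \<open>(cos z)\<^sup>2 \<ge> 1 / 2\<close>.\<close>

lemma sin_ge_half:
  assumes "0 \<le> y" "y \<le> pi / 2"
  shows "y / 2 \<le> sin (y :: real)"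
proof -
  let ?z = "y / 2"
  have "sin 0 - 0 * cos 0 \<le> sin ?z - ?z * cos (?z :: real)"
  proof (rule DERIV_nonneg_imp_nondecreasing[where f="\<lambda>z. sin z - z * cos z"])
    fix z assume z: "0 \<le> z" "z \<le> ?z"
    have "((\<lambda>z. sin z - z * cos z) has_real_derivative z * sin z) (at z)"
      by (auto intro!: derivative_eq_intros)
    moreover have "0 \<le> z * sin z" using z assms by (intro mult_nonneg_nonneg sin_ge_zero) auto
    ultimately show "\<exists>d. ((\<lambda>z. sin z - z * cos z) has_real_derivative d) (at z) \<and> 0 \<le> d" by blast
  qed (use assms in simp)
  then have 1: "?z * cos ?z \<le> sin ?z" by simp
  have c: "0 \<le> cos ?z" by (rule cos_ge_zero) (use assms in auto)
  have "0 \<le> cos y" by (rule cos_ge_zero) (use assms in auto)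
  then have "1 / 2 \<le> (cos ?z)\<^sup>2" using cos_double_cos[of ?z] by simp
  then have "y * (1 / 2) \<le> y * (cos ?z)\<^sup>2" using assms by (intro mult_left_mono) auto
  also have "\<dots> = 2 * ((?z * cos ?z) * cos ?z)" by (simp add: power2_eq_square)
  also have "\<dots> \<le> 2 * (sin ?z * cos ?z)" using 1 c by (intro mult_left_mono mult_right_mono) auto
  also have "\<dots> = sin y" using sin_double[of ?z] by simp
  finally show ?thesis by simp
qed

lemma cmod_one_minus_cis: "cmod (1 - cis v) = 2 * \<bar>sin (v / 2)\<bar>"
proof -
  have "(cmod (1 - cis v))\<^sup>2 = (2 * \<bar>sin (v / 2)\<bar>)\<^sup>2"
  proof -
    have "(cmod (1 - cis v))\<^sup>2 = (1 - cos v)\<^sup>2 + (sin v)\<^sup>2" by (simp add: cmod_power2)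
    also have "\<dots> = 2 - 2 * cos v" using sin_cos_squared_add[of v] by (simp add: power2_eq_square algebra_simps)
    also have "cos v = 1 - 2 * (sin (v / 2))\<^sup>2" using cos_double_sin[of "v / 2"] by simp
    finally show ?thesis by (simp add: power_mult_distrib)
  qed
  then show ?thesis by (subst (asm) power2_eq_iff_nonneg) auto
qed

lemma cmod_one_minus_rcis_ge:
  assumes r: "0 \<le> r" "r < 1" and v: "\<bar>v\<bar> \<le> pi"
  shows "((1 - r) + \<bar>v\<bar>) / 8 \<le> cmod (1 - rcis r v)"
proof -
  have 1: "1 - r \<le> cmod (1 - rcis r v)"
    using norm_triangle_ineq2[of 1 "rcis r v"] r by simp
  have "cmod (1 - cis v) \<le> cmod (1 - rcis r v) + cmod (rcis r v - cis v)"
    using norm_triangle_ineq[of "1 - rcis r v" "rcis r v - cis v"] by simp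
  also have "cmod (rcis r v - cis v) = 1 - r"
  proof -
    have "rcis r v - cis v = of_real (r - 1) * cis v" by (simp add: rcis_def algebra_simps)
    then show ?thesis using r by (simp only: norm_mult norm_of_real norm_cis) simp
  qed
  finally have "\<bar>sin (v / 2)\<bar> \<le> cmod (1 - rcis r v)" using 1 by (simp add: cmod_one_minus_cis)
  moreover have "\<bar>v\<bar> / 4 \<le> \<bar>sin (v / 2)\<bar>"
    using sin_ge_half[of "\<bar>v\<bar> / 2"] v by (cases "0 \<le> v") auto
  ultimately have "\<bar>v\<bar> / 4 \<le> cmod (1 - rcis r v)" by (rule order_trans[rotated])
  then show ?thesis using 1 r by (simp add: field_simps)
qed

definition disk_gap :: "complex \<Rightarrow> complex \<Rightarrow> real" where
  "disk_gap x y = cmod (1 - cnj x * y)"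

lemma disk_gap_sym: "disk_gap x y = disk_gap y x"
proof -
  have "cmod (1 - cnj x * y) = cmod (cnj (1 - cnj x * y))" by (simp only: complex_mod_cnj)
  then show ?thesis by (simp add: disk_gap_def mult.commute)
qed

lemma disk_gap_pos: "x \<in> ball 0 1 \<Longrightarrow> y \<in> ball 0 1 \<Longrightarrow> 0 < disk_gap x y"
  unfolding disk_gap_def by (rule one_minus_cnj_mult_nz)

lemma disk_gap_ge: "1 - cmod x * cmod y \<le> disk_gap x y"
  unfolding disk_gap_def using norm_triangle_ineq2[of 1 "cnj x * y"] by (simp add: norm_mult)

text \<open>Split \<open>1 - cnj x * z = (1 - cnj x * y) + cnj x * (y - z)\<close>. As pseudohyperbolic distances are at most
  1, the last difference is at most \<open>disk_gap y z\<close>.\<close>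

lemma disk_gap_triangle:
  assumes "x \<in> ball 0 1" "y \<in> ball 0 1" "z \<in> ball 0 1"
  shows "disk_gap x z \<le> disk_gap x y + disk_gap y z"
proof -
  have "(cmod (y - z) / cmod (1 - cnj y * z))\<^sup>2 \<le> 1"
    using pseudohyperbolic_identity[OF assms(2,3)] ball_norm_sq[OF assms(2)] ball_norm_sq[OF assms(3)]
      one_minus_cnj_mult_nz[OF assms(2,3)]
    by (smt (verit) divide_nonneg_nonneg mult_nonneg_nonneg zero_le_power2)
  then have "cmod (y - z) \<le> disk_gap y z"
    using one_minus_cnj_mult_nz[OF assms(2,3)] by (simp add: disk_gap_def power_le_one_iff abs_le_square_iff)
  have "1 - cnj x * z = (1 - cnj x * y) + cnj x * (y - z)" by (simp add: algebra_simps)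
  then have "disk_gap x z \<le> disk_gap x y + cmod (cnj x * (y - z))"
    unfolding disk_gap_def using norm_triangle_ineq by metis
  also have "cmod (cnj x * (y - z)) \<le> 1 * cmod (y - z)"
    unfolding norm_mult using assms(1) by (intro mult_right_mono) auto
  finally show ?thesis using \<open>cmod (y - z) \<le> disk_gap y z\<close> by simp
qed

text \<open>One of the two gaps is at least half of \<open>disk_gap x z\<close>. A quarter power of that gap produces the
  first factor on the right, and the remaining powers are separated by \<open>P * Q\<^sup>2 \<le> P ^ 3 + Q ^ 3\<close>. The
  exponents \<open>3/4\<close> stay below 1, so the right-hand side is integrable in \<open>y\<close> uniformly in the radii.\<close>

lemma disk_gap_product:
  assumes "x \<in> ball 0 1" "y \<in> ball 0 1" "z \<in> ball 0 1"
  shows "disk_gap x y powr (- 1/2) * disk_gap y z powr (- 1/2)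
    \<le> 2 * disk_gap x z powr (- 1/4) * (disk_gap x y powr (- 3/4) + disk_gap y z powr (- 3/4))"
proof -
  note p = disk_gap_pos[OF assms(1,2)] disk_gap_pos[OF assms(2,3)] disk_gap_pos[OF assms(1,3)]
  define P Q W where "P = disk_gap x y powr (- 1/4)" and "Q = disk_gap y z powr (- 1/4)" and "W = disk_gap x z powr (- 1/4)"
  have nn: "0 \<le> P" "0 \<le> Q" "0 \<le> W" by (simp_all add: P_def Q_def W_def)
  have pw: "t powr (- 1/2) = (t powr (- 1/4))^2" "t powr (- 3/4) = (t powr (- 1/4))^3" if "0 < t" for t :: real
    using that by (simp_all add: powr_numeral[symmetric] powr_powr)
  have half: "t powr (- 1/4) \<le> 2 * W" if "disk_gap x z / 2 \<le> t" for t
  proof -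
    have "t powr (- 1/4) \<le> (disk_gap x z / 2) powr (- 1/4)"
      using that p by (intro powr_mono2') auto
    also have "\<dots> = W * 2 powr (1/4)" using p by (simp add: powr_divide W_def powr_minus field_simps)
    also have "\<dots> \<le> W * 2 powr 1" using nn(3) by (intro mult_left_mono powr_mono) auto
    finally show ?thesis by (simp add: mult.commute)
  qed
  have cube: "P * Q^2 \<le> P^3 + Q^3" "Q * P^2 \<le> P^3 + Q^3"
  proof -
    have "P * Q^2 \<le> P^3 + Q^3 \<and> Q * P^2 \<le> P^3 + Q^3"
    proof (cases "P \<le> Q")
      case True
      have "P * Q^2 \<le> Q * Q^2" "Q * P^2 \<le> Q * Q^2" using True nn by (auto intro!: mult_mono power_mono)
      moreover have "Q * Q^2 = Q^3" by (simp add: power2_eq_square power3_eq_cube)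
      ultimately show ?thesis using nn by (auto intro: order_trans simp: add_increasing)
    next
      case False
      have "P * Q^2 \<le> P * P^2" "Q * P^2 \<le> P * P^2" using False nn by (auto intro!: mult_mono power_mono)
      moreover have "P * P^2 = P^3" by (simp add: power2_eq_square power3_eq_cube)
      ultimately show ?thesis using nn by (auto intro: order_trans simp: add_increasing2)
    qed
    then show "P * Q^2 \<le> P^3 + Q^3" "Q * P^2 \<le> P^3 + Q^3" by auto
  qed
  have "P^2 * Q^2 \<le> 2 * W * (P^3 + Q^3)"
  proof (cases "disk_gap x z / 2 \<le> disk_gap x y")
    case True
    then have "P \<le> 2 * W" using half unfolding P_def by blast
    then have "P * (P * Q^2) \<le> 2 * W * (P^3 + Q^3)" using nn cube by (intro mult_mono) auto
    then show ?thesis by (simp add: power2_eq_square mult_ac)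
  next
    case False
    then have "disk_gap x z / 2 \<le> disk_gap y z" using disk_gap_triangle[OF assms] by linarith
    then have "Q \<le> 2 * W" using half unfolding Q_def by blast
    then have "Q * (Q * P^2) \<le> 2 * W * (P^3 + Q^3)" using nn cube by (intro mult_mono) auto
    then show ?thesis by (simp add: power2_eq_square mult_ac)
  qed
  then show ?thesis unfolding pw(1)[OF p(1)] pw(1)[OF p(2)] pw(2)[OF p(1)] pw(2)[OF p(2)]
    unfolding P_def Q_def W_def .
qed

lemma rcis_gap: "disk_gap (rcis r a) (rcis s b) = cmod (1 - rcis (r * s) (b - a))"
proof -
  have "cnj (rcis r a) * rcis s b = rcis (r * s) (b - a)"
    by (simp add: rcis_def cis_cnj cis_mult mult_ac)
  then show ?thesis by (simp add: disk_gap_def)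
qed

lemma nn_integral_gap_power:
  fixes c \<delta> s :: real
  assumes \<delta>: "0 < \<delta>" and s: "s \<noteq> 1"
  shows "(\<integral>\<^sup>+b. ennreal ((\<delta> + \<bar>b - c\<bar>) powr (- s)) * indicator {c - 4 * pi..c + 4 * pi} b \<partial>lborel)
    = 2 * ennreal (((\<delta> + 4 * pi) powr (1 - s) - \<delta> powr (1 - s)) / (1 - s))"
proof -
  let ?I = "((\<delta> + 4 * pi) powr (1 - s) - \<delta> powr (1 - s)) / (1 - s)"
  let ?f = "\<lambda>v. ennreal ((\<delta> + v) powr (- s)) * indicator {0..4 * pi} v"
  have FTC: "(\<integral>\<^sup>+v. ?f v \<partial>lborel) = ennreal ?I"
  proof -
    have "(\<integral>\<^sup>+v. ?f v \<partial>lborel) = ennreal ((\<delta> + 4 * pi) powr (1 - s) / (1 - s) - (\<delta> + 0) powr (1 - s) / (1 - s))"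
    proof (rule nn_integral_FTC_Icc)
      show "DERIV (\<lambda>v. (\<delta> + v) powr (1 - s) / (1 - s)) v :> (\<delta> + v) powr (- s)"
        if "v \<in> {0..4 * pi}" for v
      proof -
        have "((\<lambda>v. (\<delta> + v) powr (1 - s) / (1 - s)) has_real_derivative (\<delta> + v) powr (- s)) (at v)"
          using that \<delta> s by (auto intro!: derivative_eq_intros)
        then show ?thesis .
      qed
    qed auto
    then show ?thesis by (simp add: diff_divide_distrib)
  qed
  have "(\<integral>\<^sup>+b. ennreal ((\<delta> + \<bar>b - c\<bar>) powr (- s)) * indicator {c - 4 * pi..c + 4 * pi} b \<partial>lborel)
     = (\<integral>\<^sup>+v. ennreal ((\<delta> + \<bar>v\<bar>) powr (- s)) * indicator {- 4 * pi..4 * pi} v \<partial>lborel)"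
    by (subst nn_integral_lborel_translate[of _ c, symmetric]) (auto intro!: nn_integral_cong simp: indicator_def)
  also have "\<dots> = (\<integral>\<^sup>+v. ?f v + ?f (0 - v) \<partial>lborel)"
  proof (rule nn_integral_cong_AE)
    have "AE v in lborel. v \<noteq> (0::real)" by (rule AE_lborel_singleton)
    then show "AE v in lborel. ennreal ((\<delta> + \<bar>v\<bar>) powr (- s)) * indicator {- 4 * pi..4 * pi} v = ?f v + ?f (0 - v)"
      by eventually_elim (auto simp: indicator_def)
  qed
  also have "\<dots> = (\<integral>\<^sup>+v. ?f v \<partial>lborel) + (\<integral>\<^sup>+v. ?f (0 - v) \<partial>lborel)"
    by (rule nn_integral_add) auto
  also have "(\<integral>\<^sup>+v. ?f (0 - v) \<partial>lborel) = (\<integral>\<^sup>+v. ?f v \<partial>lborel)"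
    by (rule nn_integral_lborel_reflect) auto
  finally show ?thesis unfolding FTC by (simp add: mult_2)
qed

lemma nn_integral_circle_measure:
  assumes [measurable]: "f \<in> borel_measurable borel"
  shows "(\<integral>\<^sup>+b. f b \<partial>circle_measure) = ennreal (1 / (2 * pi)) * (\<integral>\<^sup>+b. f b * indicator {0..2 * pi} b \<partial>lborel)"
proof -
  have "(\<integral>\<^sup>+b. f b \<partial>circle_measure) = (\<integral>\<^sup>+b. f b * indicator {0..2 * pi} b \<partial>lborel) / ennreal (2 * pi)"
    by (subst nn_integral_uniform_measure) auto
  also have "\<dots> = ennreal (1 / (2 * pi)) * (\<integral>\<^sup>+b. f b * indicator {0..2 * pi} b \<partial>lborel)"
    unfolding divide_ennreal_def by (simp add: inverse_ennreal inverse_eq_divide mult.commute)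
  finally show ?thesis .
qed

lemma exists_reduced_angle:
  obtains a' :: real where "0 \<le> a'" "a' < 2 * pi" "cis a' = cis a"
proof -
  define k where "k = \<lfloor>a / (2 * pi)\<rfloor>"
  have "of_int k \<le> a / (2 * pi)" "a / (2 * pi) < of_int k + 1" unfolding k_def by linarith+
  then have "0 \<le> a - 2 * pi * of_int k" "a - 2 * pi * of_int k < 2 * pi"
    by (simp_all add: field_simps)
  moreover have "cis (a - 2 * pi * of_int k) = cis a"
    using cis_multiple_2pi[of "of_int k"] by (simp add: cis_divide[symmetric])
  ultimately show ?thesis using that by blast
qed

text \<open>The integral \<open>\<integral> (\<delta> + |v|) powr (- s)\<close> over \<open>|v| \<le> 4 * pi\<close>, with the constants of
  \<open>circle_gap_integral\<close>.\<close>

definition gap_bound :: "real \<Rightarrow> real \<Rightarrow> real" where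
  "gap_bound s \<delta> = 3 * 8 powr s * (1 / pi) * (((\<delta> + 4 * pi) powr (1 - s) - \<delta> powr (1 - s)) / (1 - s))"

text \<open>The kernel at angle \<open>v\<close> is comparable with \<open>\<delta> + |v|\<close>, where \<open>v\<close> is measured from the nearest
  multiple of \<open>2 * pi\<close>. After reduction of \<open>a\<close> to one period, only the three translates by \<open>- 2 * pi\<close>, 0 and
  \<open>2 * pi\<close> can be nearest; their contributions are simply added.\<close>

lemma circle_gap_integral:
  assumes r: "0 \<le> r" "r < 1" and t: "0 \<le> t" "t < 1" and s: "0 < s" "s \<noteq> 1"
  shows "(\<integral>\<^sup>+b. ennreal (disk_gap (rcis r a) (rcis t b) powr (- s)) \<partial>circle_measure) \<le> ennreal (gap_bound s (1 - r * t))"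
proof -
  obtain a' where a': "0 \<le> a'" "a' < 2 * pi" "cis a' = cis a" by (rule exists_reduced_angle)
  have rt: "0 \<le> r * t" "r * t < 1" using r t mult_strict_mono'[of r 1 t 1] by auto
  define \<delta> where "\<delta> = 1 - r * t"
  have \<delta>: "0 < \<delta>" using rt by (simp add: \<delta>_def)
  define h where "h c b = ennreal ((\<delta> + \<bar>b - c\<bar>) powr (- s)) * indicator {c - 4 * pi..c + 4 * pi} b" for c b :: real
  have [measurable]: "h c \<in> borel_measurable borel" for c unfolding h_def by measurable
  define H where "H b = h (a' - 2 * pi) b + h a' b + h (a' + 2 * pi) b" for b
  have [measurable]: "H \<in> borel_measurable borel" unfolding H_def by measurable
  have gm: "(\<lambda>b. ennreal (disk_gap (rcis r a) (rcis t b) powr (- s))) \<in> borel_measurable borel"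
    unfolding disk_gap_def rcis_def by measurable
  have "ennreal (disk_gap (rcis r a) (rcis t b) powr (- s)) * indicator {0..2 * pi} b \<le> ennreal (8 powr s) * H b" for b
  proof (cases "b \<in> {0..2 * pi}")
    case True
    have "disk_gap (rcis r a) (rcis t b) = disk_gap (rcis r a') (rcis t b)" by (simp add: rcis_def a')
    also have "\<dots> = cmod (1 - rcis (r * t) (b - a'))" by (rule rcis_gap)
    finally have g: "disk_gap (rcis r a) (rcis t b) = cmod (1 - rcis (r * t) (b - a'))" .
    have per: "cmod (1 - rcis (r * t) (b - c)) = cmod (1 - rcis (r * t) (b - a'))" if "c = a' - 2 * pi \<or> c = a' \<or> c = a' + 2 * pi" for c
    proof -
      have "cis (b - c) = cis (b - a')" using that by (auto simp: cis_divide[symmetric] cis_mult[symmetric])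
      then show ?thesis by (simp add: rcis_def)
    qed
    obtain c where c: "c = a' - 2 * pi \<or> c = a' \<or> c = a' + 2 * pi" "\<bar>b - c\<bar> \<le> pi"
    proof -
      consider "b - a' > pi" | "b - a' < - pi" | "\<bar>b - a'\<bar> \<le> pi" by linarith
      then show ?thesis
      proof cases
        case 1 then show ?thesis using that[of "a' + 2 * pi"] a' True by auto
      next
        case 2 then show ?thesis using that[of "a' - 2 * pi"] a' True by auto
      next
        case 3 then show ?thesis using that[of a'] by auto
      qed
    qed
    have "(\<delta> + \<bar>b - c\<bar>) / 8 \<le> disk_gap (rcis r a) (rcis t b)"
      unfolding g per[OF c(1), symmetric] \<delta>_def by (rule cmod_one_minus_rcis_ge[OF rt c(2)])
    then have "disk_gap (rcis r a) (rcis t b) powr (- s) \<le> ((\<delta> + \<bar>b - c\<bar>) / 8) powr (- s)"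
      using \<delta> s by (intro powr_mono2') auto
    also have "\<dots> = 8 powr s * (\<delta> + \<bar>b - c\<bar>) powr (- s)"
      using \<delta> by (simp add: powr_divide powr_minus field_simps)
    finally have "ennreal (disk_gap (rcis r a) (rcis t b) powr (- s)) \<le> ennreal (8 powr s) * h c b"
      using c(2) by (simp add: h_def ennreal_mult[symmetric] indicator_def abs_le_iff)
    also have "h c b \<le> H b" unfolding H_def using c(1) by (auto intro: add_increasing add_increasing2)
    finally show ?thesis using True by (simp add: mult_left_mono)
  qed simp
  then have "(\<integral>\<^sup>+b. ennreal (disk_gap (rcis r a) (rcis t b) powr (- s)) \<partial>circle_measure)
     \<le> ennreal (1 / (2 * pi)) * (\<integral>\<^sup>+b. ennreal (8 powr s) * H b \<partial>lborel)"
    unfolding nn_integral_circle_measure[OF gm] by (intro mult_left_mono nn_integral_mono) auto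
  also have "(\<integral>\<^sup>+b. ennreal (8 powr s) * H b \<partial>lborel) = ennreal (8 powr s) * (6 * ennreal (((\<delta> + 4 * pi) powr (1 - s) - \<delta> powr (1 - s)) / (1 - s)))"
  proof -
    have "(\<integral>\<^sup>+b. H b \<partial>lborel) = (\<integral>\<^sup>+b. h (a' - 2 * pi) b \<partial>lborel) + (\<integral>\<^sup>+b. h a' b \<partial>lborel) + (\<integral>\<^sup>+b. h (a' + 2 * pi) b \<partial>lborel)"
      unfolding H_def by (simp add: nn_integral_add)
    also have "\<dots> = 6 * ennreal (((\<delta> + 4 * pi) powr (1 - s) - \<delta> powr (1 - s)) / (1 - s))"
      unfolding h_def nn_integral_gap_power[OF \<delta> s(2)] by (simp add: distrib_right[symmetric])
    finally show ?thesis by (simp add: nn_integral_cmult)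
  qed
  also have "ennreal (1 / (2 * pi)) * (ennreal (8 powr s) * (6 * ennreal (((\<delta> + 4 * pi) powr (1 - s) - \<delta> powr (1 - s)) / (1 - s))))
     = ennreal (gap_bound s (1 - r * t))"
  proof -
    have e6: "(6::ennreal) = ennreal 6" by simp
    have "ennreal (1 / (2 * pi)) * (ennreal (8 powr s) * (6 * ennreal X)) = ennreal (3 * 8 powr s * (1 / pi) * X)" for X
      unfolding e6
      by (subst ennreal_mult'[symmetric], simp, subst ennreal_mult'[symmetric], simp, subst ennreal_mult'[symmetric], simp)
        (simp add: field_simps)
    then show ?thesis unfolding gap_bound_def \<delta>_def[symmetric] by blast
  qed
  finally show ?thesis .
qed

lemma gap_bound_small_exponent:
  assumes "0 < s" "s < 1" "0 < \<delta>" "\<delta> \<le> 1"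
  shows "gap_bound s \<delta> \<le> 3 * 8 powr s * (1 / pi) * ((1 + 4 * pi) powr (1 - s) / (1 - s))"
proof -
  have "(\<delta> + 4 * pi) powr (1 - s) - \<delta> powr (1 - s) \<le> (1 + 4 * pi) powr (1 - s)"
    using assms powr_mono2[of "1 - s" "\<delta> + 4 * pi" "1 + 4 * pi"] powr_ge_zero[of \<delta> "1 - s"] by (smt (verit) pi_ge_zero)
  then show ?thesis
    unfolding gap_bound_def using assms by (intro mult_left_mono divide_right_mono) auto
qed

lemma gap_bound_large_exponent:
  assumes "1 < s" "0 < \<delta>"
  shows "gap_bound s \<delta> \<le> 3 * 8 powr s * (1 / pi) * (1 / (s - 1)) * \<delta> powr (1 - s)"
proof -
  have "((\<delta> + 4 * pi) powr (1 - s) - \<delta> powr (1 - s)) / (1 - s) = (\<delta> powr (1 - s) - (\<delta> + 4 * pi) powr (1 - s)) / (s - 1)"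
    using assms by (simp add: field_simps)
  also have "\<dots> \<le> \<delta> powr (1 - s) / (s - 1)" using assms by (intro divide_right_mono) auto
  finally have "3 * 8 powr s * (1 / pi) * (((\<delta> + 4 * pi) powr (1 - s) - \<delta> powr (1 - s)) / (1 - s))
     \<le> 3 * 8 powr s * (1 / pi) * (\<delta> powr (1 - s) / (s - 1))"
    by (intro mult_left_mono) auto
  then show ?thesis unfolding gap_bound_def by simp
qed

section \<open>Independent angles\<close>

locale random_angles = prob_space M for M :: "'a measure" +
  fixes \<rho> :: "nat \<Rightarrow> real" and \<theta> :: "nat \<Rightarrow> 'a \<Rightarrow> real"
  assumes radii: "\<And>n. 0 \<le> \<rho> n \<and> \<rho> n < 1"
    and indep: "indep_vars (\<lambda>_. borel) \<theta> UNIV"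
    and uniform: "\<And>n. distr M borel (\<theta> n) = circle_measure"
begin

lemma angle_measurable [measurable]: "\<theta> n \<in> borel_measurable M"
  using indep by (auto simp: indep_vars_def)

definition point :: "nat \<Rightarrow> 'a \<Rightarrow> complex" where
  "point n \<omega> = rcis (\<rho> n) (\<theta> n \<omega>)"

lemma point_ball: "point n \<omega> \<in> ball 0 1"
  using radii[of n] by (simp add: point_def)

lemma point_measurable [measurable]: "point n \<in> borel_measurable M"
  unfolding point_def rcis_def by measurable

text \<open>The angles of four distinct points are independent, so expectations are iterated circle averages.
  The versions for three and for two angles follow by adding a further index.\<close>

lemma nn_integral_four_angles:
  fixes F :: "real \<Rightarrow> real \<Rightarrow> real \<Rightarrow> real \<Rightarrow> ennreal"
  assumes d: "distinct [i, j, k, l]"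
    and F: "(\<lambda>(a, b, c, d). F a b c d) \<in> borel_measurable (borel \<Otimes>\<^sub>M borel \<Otimes>\<^sub>M borel \<Otimes>\<^sub>M borel)"
  shows "(\<integral>\<^sup>+\<omega>. F (\<theta> i \<omega>) (\<theta> j \<omega>) (\<theta> k \<omega>) (\<theta> l \<omega>) \<partial>M)
    = (\<integral>\<^sup>+a. \<integral>\<^sup>+b. \<integral>\<^sup>+c. \<integral>\<^sup>+d. F a b c d \<partial>circle_measure \<partial>circle_measure \<partial>circle_measure \<partial>circle_measure)"
proof -
  interpret C: prob_space circle_measure by (rule prob_space_circle_measure)
  interpret P: product_sigma_finite "\<lambda>_::nat. circle_measure" ..
  have Fm: "(\<lambda>x. F (h1 x) (h2 x) (h3 x) (h4 x)) \<in> borel_measurable N"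
    if "h1 \<in> borel_measurable N" "h2 \<in> borel_measurable N" "h3 \<in> borel_measurable N" "h4 \<in> borel_measurable N"
    for N :: "'b measure" and h1 h2 h3 h4 :: "'b \<Rightarrow> real"
  proof -
    have "(\<lambda>x. (h1 x, h2 x, h3 x, h4 x)) \<in> N \<rightarrow>\<^sub>M borel \<Otimes>\<^sub>M borel \<Otimes>\<^sub>M borel \<Otimes>\<^sub>M borel"
      using that by (intro measurable_Pair)
    from measurable_compose[OF this F] show ?thesis by simp
  qed
  let ?J = "{i, j, k, l}" and ?U = "circle_measure"
  let ?X = "\<lambda>\<omega>. \<lambda>n\<in>?J. \<theta> n \<omega>"
  let ?g = "\<lambda>x. F (x i) (x j) (x k) (x l)"
  have comp: "(\<lambda>x. x n) \<in> borel_measurable (PiM I (\<lambda>_. ?U))" if "n \<in> I" for n I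
  proof -
    have "borel_measurable (PiM I (\<lambda>_. ?U)) = measurable (PiM I (\<lambda>_. ?U)) ?U"
      by (rule measurable_cong_sets) auto
    then show ?thesis using measurable_component_singleton[OF that, of "\<lambda>_. ?U"] by simp
  qed
  have "indep_vars (\<lambda>_. borel) \<theta> ?J" by (rule indep_vars_subset[OF indep]) simp
  then have D: "distr M (PiM ?J (\<lambda>_. borel)) ?X = PiM ?J (\<lambda>n. distr M borel (\<theta> n))"
    by (subst (asm) indep_vars_iff_distr_eq_PiM') auto
  have "(\<integral>\<^sup>+\<omega>. F (\<theta> i \<omega>) (\<theta> j \<omega>) (\<theta> k \<omega>) (\<theta> l \<omega>) \<partial>M) = (\<integral>\<^sup>+\<omega>. ?g (?X \<omega>) \<partial>M)"
    by simp
  also have "\<dots> = (\<integral>\<^sup>+x. ?g x \<partial>distr M (PiM ?J (\<lambda>_. borel)) ?X)"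
  proof (rule nn_integral_distr[symmetric])
    show "?X \<in> M \<rightarrow>\<^sub>M PiM ?J (\<lambda>_. borel)" by (rule measurable_restrict) simp
    have "?g \<in> borel_measurable (PiM ?J (\<lambda>_. borel))" by (intro Fm measurable_component_singleton) auto
    then show "?g \<in> borel_measurable (distr M (PiM ?J (\<lambda>_. borel)) ?X)" by simp
  qed
  also have "\<dots> = (\<integral>\<^sup>+x. ?g x \<partial>PiM ?J (\<lambda>_. ?U))" unfolding D uniform ..
  also have "\<dots> = (\<integral>\<^sup>+a. (\<integral>\<^sup>+x. ?g (x(i := a)) \<partial>PiM {j, k, l} (\<lambda>_. ?U)) \<partial>?U)"
    using d by (intro P.product_nn_integral_insert_rev) (auto intro!: Fm comp)
  also have "\<dots> = (\<integral>\<^sup>+a. \<integral>\<^sup>+b. (\<integral>\<^sup>+x. ?g (x(i := a, j := b)) \<partial>PiM {k, l} (\<lambda>_. ?U)) \<partial>?U \<partial>?U)"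
    using d by (intro nn_integral_cong, subst P.product_nn_integral_insert_rev) (auto intro!: Fm comp nn_integral_cong simp: fun_upd_twist)
  also have "\<dots> = (\<integral>\<^sup>+a. \<integral>\<^sup>+b. \<integral>\<^sup>+c. (\<integral>\<^sup>+x. ?g (x(i := a, j := b, k := c)) \<partial>PiM {l} (\<lambda>_. ?U)) \<partial>?U \<partial>?U \<partial>?U)"
    using d by (intro nn_integral_cong, subst P.product_nn_integral_insert_rev) (auto intro!: Fm comp nn_integral_cong simp: fun_upd_twist)
  also have "\<dots> = (\<integral>\<^sup>+a. \<integral>\<^sup>+b. \<integral>\<^sup>+c. \<integral>\<^sup>+d. F a b c d \<partial>?U \<partial>?U \<partial>?U \<partial>?U)"
  proof (rule nn_integral_cong, rule nn_integral_cong, rule nn_integral_cong)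
    fix a b c
    have "(\<integral>\<^sup>+x. F a b c (x l) \<partial>PiM {l} (\<lambda>_. ?U)) = (\<integral>\<^sup>+d. F a b c d \<partial>?U)"
      by (rule P.product_nn_integral_singleton) (auto intro!: Fm)
    then show "(\<integral>\<^sup>+x. ?g (x(i := a, j := b, k := c)) \<partial>PiM {l} (\<lambda>_. ?U)) = (\<integral>\<^sup>+d. F a b c d \<partial>?U)"
      using d by simp
  qed
  finally show ?thesis .
qed

lemma nn_integral_three_angles:
  fixes F :: "real \<Rightarrow> real \<Rightarrow> real \<Rightarrow> ennreal"
  assumes d: "distinct [i, j, k]"
    and F: "(\<lambda>(a, b, c). F a b c) \<in> borel_measurable (borel \<Otimes>\<^sub>M borel \<Otimes>\<^sub>M borel)"
  shows "(\<integral>\<^sup>+\<omega>. F (\<theta> i \<omega>) (\<theta> j \<omega>) (\<theta> k \<omega>) \<partial>M)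
    = (\<integral>\<^sup>+a. \<integral>\<^sup>+b. \<integral>\<^sup>+c. F a b c \<partial>circle_measure \<partial>circle_measure \<partial>circle_measure)"
proof -
  interpret C: prob_space circle_measure by (rule prob_space_circle_measure)
  obtain l where "l \<notin> {i, j, k}" using ex_new_if_finite[of "{i, j, k}"] by auto
  then have "distinct [i, j, k, l]" using d by auto
  moreover have "(\<lambda>(a, b, c, d :: real). F a b c) \<in> borel_measurable (borel \<Otimes>\<^sub>M borel \<Otimes>\<^sub>M borel \<Otimes>\<^sub>M borel)"
  proof -
    have "(\<lambda>x. (fst x, fst (snd x), fst (snd (snd x)))) \<in>
      borel \<Otimes>\<^sub>M borel \<Otimes>\<^sub>M borel \<Otimes>\<^sub>M (borel :: real measure) \<rightarrow>\<^sub>M (borel :: real measure) \<Otimes>\<^sub>M (borel :: real measure) \<Otimes>\<^sub>M (borel :: real measure)"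
      by measurable
    from measurable_compose[OF this F] show ?thesis by (simp add: case_prod_beta)
  qed
  ultimately show ?thesis
    using nn_integral_four_angles[of i j k l "\<lambda>a b c d. F a b c"] by (simp add: C.emeasure_space_1)
qed

lemma nn_integral_two_angles:
  fixes F :: "real \<Rightarrow> real \<Rightarrow> ennreal"
  assumes d: "i \<noteq> j"
    and F: "(\<lambda>(a, b). F a b) \<in> borel_measurable (borel \<Otimes>\<^sub>M borel)"
  shows "(\<integral>\<^sup>+\<omega>. F (\<theta> i \<omega>) (\<theta> j \<omega>) \<partial>M) = (\<integral>\<^sup>+a. \<integral>\<^sup>+b. F a b \<partial>circle_measure \<partial>circle_measure)"
proof -
  interpret C: prob_space circle_measure by (rule prob_space_circle_measure)
  obtain l where "l \<notin> {i, j}" using ex_new_if_finite[of "{i, j}"] by auto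
  then have "distinct [i, j, l]" using d by auto
  moreover have "(\<lambda>(a, b, c :: real). F a b) \<in> borel_measurable (borel \<Otimes>\<^sub>M borel \<Otimes>\<^sub>M borel)"
  proof -
    have "(\<lambda>x. (fst x, fst (snd x))) \<in>
      borel \<Otimes>\<^sub>M borel \<Otimes>\<^sub>M (borel :: real measure) \<rightarrow>\<^sub>M (borel :: real measure) \<Otimes>\<^sub>M (borel :: real measure)"
      by measurable
    from measurable_compose[OF this F] show ?thesis by (simp add: case_prod_beta)
  qed
  ultimately show ?thesis
    using nn_integral_three_angles[of i j l "\<lambda>a b c. F a b"] by (simp add: C.emeasure_space_1)
qed

text \<open>Bounded sums of expectations bound the expectation of the whole series, which is therefore finite
  almost surely.\<close>

lemma AE_bounded_finite_sums:
  fixes X :: "'i::countable \<Rightarrow> 'a \<Rightarrow> real"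
  assumes X[measurable]: "\<And>p. X p \<in> borel_measurable M" and nn: "\<And>p \<omega>. 0 \<le> X p \<omega>"
    and C: "\<And>Q. finite Q \<Longrightarrow> (\<Sum>p\<in>Q. \<integral>\<^sup>+\<omega>. ennreal (X p \<omega>) \<partial>M) \<le> ennreal C"
  shows "AE \<omega> in M. \<exists>K. \<forall>Q. finite Q \<longrightarrow> (\<Sum>p\<in>Q. X p \<omega>) \<le> K"
proof -
  let ?R = "range (to_nat :: 'i \<Rightarrow> nat)"
  define X' where "X' n \<omega> = (if n \<in> ?R then ennreal (X (from_nat n) \<omega>) else 0)" for n \<omega>
  have [measurable]: "X' n \<in> borel_measurable M" for n unfolding X'_def by measurable
  define Y where "Y \<omega> = (\<Sum>n. X' n \<omega>)" for \<omega>
  have sum_X': "(\<Sum>n<N. f n) = (\<Sum>p\<in>{p. (to_nat :: 'i \<Rightarrow> nat) p < N}. f (to_nat p))" "finite {p. (to_nat :: 'i \<Rightarrow> nat) p < N}"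
    if "\<And>n. n \<notin> ?R \<Longrightarrow> f n = 0" for f :: "nat \<Rightarrow> ennreal" and N
  proof -
    have im: "to_nat ` {p. (to_nat :: 'i \<Rightarrow> nat) p < N} = {..<N} \<inter> ?R" by auto
    show "finite {p. (to_nat :: 'i \<Rightarrow> nat) p < N}"
      by (rule finite_imageD[of to_nat]) (simp_all add: im inj_on_def)
    have "(\<Sum>n<N. f n) = (\<Sum>n\<in>{..<N} \<inter> ?R. f n)"
      using that by (intro sum.mono_neutral_right) auto
    also have "\<dots> = (\<Sum>p\<in>{p. (to_nat :: 'i \<Rightarrow> nat) p < N}. f (to_nat p))"
      unfolding im[symmetric] by (subst sum.reindex) (auto simp: inj_on_def)
    finally show "(\<Sum>n<N. f n) = (\<Sum>p\<in>{p. (to_nat :: 'i \<Rightarrow> nat) p < N}. f (to_nat p))" .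
  qed
  have "(\<integral>\<^sup>+\<omega>. Y \<omega> \<partial>M) = (\<Sum>n. \<integral>\<^sup>+\<omega>. X' n \<omega> \<partial>M)"
    unfolding Y_def by (rule nn_integral_suminf) measurable
  also have "\<dots> \<le> ennreal C"
  proof (rule suminf_le_const[OF summableI])
    fix N
    have "(\<Sum>n<N. \<integral>\<^sup>+\<omega>. X' n \<omega> \<partial>M)
        = (\<Sum>p\<in>{p. (to_nat :: 'i \<Rightarrow> nat) p < N}. \<integral>\<^sup>+\<omega>. X' (to_nat p) \<omega> \<partial>M)"
      by (rule sum_X') (simp add: X'_def)
    also have "\<dots> = (\<Sum>p\<in>{p. (to_nat :: 'i \<Rightarrow> nat) p < N}. \<integral>\<^sup>+\<omega>. ennreal (X p \<omega>) \<partial>M)"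
      by (simp add: X'_def)
    also have "\<dots> \<le> ennreal C" by (rule C, rule sum_X'(2)[of "\<lambda>_. 0"]) simp
    finally show "(\<Sum>n<N. \<integral>\<^sup>+\<omega>. X' n \<omega> \<partial>M) \<le> ennreal C" .
  qed
  finally have fin: "(\<integral>\<^sup>+\<omega>. Y \<omega> \<partial>M) \<noteq> \<infinity>" using neq_top_trans[of "ennreal C"] by auto
  have "Y \<in> borel_measurable M" unfolding Y_def by measurable
  then have "AE \<omega> in M. Y \<omega> \<noteq> \<infinity>" using fin by (rule nn_integral_PInf_AE)
  then show ?thesis
  proof eventually_elim
    fix \<omega> assume Y: "Y \<omega> \<noteq> \<infinity>"
    have "(\<Sum>p\<in>Q. X p \<omega>) \<le> enn2real (Y \<omega>)" if "finite Q" for Q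
    proof -
      have "ennreal (\<Sum>p\<in>Q. X p \<omega>) = (\<Sum>p\<in>Q. X' (to_nat p) \<omega>)"
        using nn by (simp add: X'_def)
      also have "\<dots> = (\<Sum>n\<in>to_nat ` Q. X' n \<omega>)"
        by (subst sum.reindex) (auto simp: inj_on_def)
      also have "\<dots> \<le> Y \<omega>" unfolding Y_def using that by (intro sum_le_suminf summableI) auto
      finally show ?thesis using Y nn by (metis enn2real_ennreal enn2real_mono infinity_ennreal_def less_top sum_nonneg)
    qed
    then show "\<exists>K. \<forall>Q. finite Q \<longrightarrow> (\<Sum>p\<in>Q. X p \<omega>) \<le> K" by blast
  qed
qed

end

section \<open>Almost sure interpolation from expectations of Gram entries\<close>

text \<open>The Schatten 4-norm is at most the Hilbert--Schmidt norm.\<close>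

lemma cycle_sum_le_square:
  "cycle_sum \<beta> F \<le> (\<Sum>x\<in>F. \<Sum>y\<in>F. (offdiag \<beta> x y)\<^sup>2)\<^sup>2"
proof -
  let ?A = "offdiag \<beta>"
  have "cycle_sum \<beta> F = (\<Sum>x\<in>F. \<Sum>z\<in>F. (\<Sum>y\<in>F. ?A x y * ?A y z)\<^sup>2)"
  proof -
    have "(\<Sum>y\<in>F. \<Sum>z\<in>F. \<Sum>w\<in>F. ?A x y * ?A y z * ?A z w * ?A w x)
        = (\<Sum>z\<in>F. (\<Sum>y\<in>F. ?A x y * ?A y z)\<^sup>2)" for x
      unfolding power2_eq_square sum_product
      by (subst sum.swap, intro sum.cong refl) (simp add: offdiag_sym mult_ac)
    then show ?thesis unfolding cycle_sum_def by simp
  qed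
  also have "\<dots> \<le> (\<Sum>x\<in>F. \<Sum>z\<in>F. (\<Sum>y\<in>F. (?A x y)\<^sup>2) * (\<Sum>y\<in>F. (?A y z)\<^sup>2))"
    by (intro sum_mono Cauchy_Schwarz_ineq_sum)
  also have "\<dots> = (\<Sum>x\<in>F. \<Sum>y\<in>F. (?A x y)\<^sup>2) * (\<Sum>z\<in>F. \<Sum>y\<in>F. (?A y z)\<^sup>2)"
    by (simp add: sum_product)
  also have "(\<Sum>z\<in>F. \<Sum>y\<in>F. (?A y z)\<^sup>2) = (\<Sum>x\<in>F. \<Sum>y\<in>F. (?A x y)\<^sup>2)" by (rule sum.swap)
  finally show ?thesis by (simp add: power2_eq_square)
qed

definition gap_const :: "real \<Rightarrow> real" where
  "gap_const s = 3 * 8 powr s * (1 / pi) * ((1 + 4 * pi) powr (1 - s) / (1 - s))"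

lemma gap_const_nonneg: "s < 1 \<Longrightarrow> 0 \<le> gap_const s"
  by (simp add: gap_const_def)

lemma circle_gap_integral_const:
  assumes "0 \<le> r" "r < 1" "0 \<le> t" "t < 1" "0 < s" "s < 1"
  shows "(\<integral>\<^sup>+b. ennreal (disk_gap (rcis r a) (rcis t b) powr (- s)) \<partial>circle_measure) \<le> ennreal (gap_const s)"
proof -
  have "r * t < 1" "0 \<le> r * t" using assms mult_strict_mono'[of r 1 t 1] by auto
  then have "gap_bound s (1 - r * t) \<le> gap_const s"
    unfolding gap_const_def using assms by (intro gap_bound_small_exponent) auto
  then show ?thesis using circle_gap_integral[of r t s a] assms by (auto intro: order_trans ennreal_leI)
qed

lemma disk_gap_measurable [measurable (raw)]:
  assumes "f \<in> borel_measurable N" "g \<in> borel_measurable N"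
  shows "(\<lambda>x. disk_gap (f x) (g x)) \<in> borel_measurable N"
proof -
  note [measurable] = assms
  show ?thesis unfolding disk_gap_def by measurable
qed

lemma rcis_measurable [measurable (raw)]:
  assumes "f \<in> borel_measurable N"
  shows "(\<lambda>x. rcis r (f x)) \<in> borel_measurable N"
  unfolding rcis_def using assms by measurable

text \<open>The mean over the middle point of a path of length two keeps only a quarter power of the gap
  between its ends, instead of the logarithm that the mean of a squared entry has.\<close>

lemma circle_two_gaps_integral:
  assumes r: "0 \<le> r" "r < 1" and s: "0 \<le> s" "s < 1" and t: "0 \<le> t" "t < 1"
  shows "(\<integral>\<^sup>+c. ennreal (disk_gap (rcis r a) (rcis s c) powr (- 1/2) * disk_gap (rcis s c) (rcis t b) powr (- 1/2)) \<partial>circle_measure)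
     \<le> ennreal (4 * gap_const (3/4) * disk_gap (rcis r a) (rcis t b) powr (- 1/4))"
proof -
  let ?x = "rcis r a" and ?z = "rcis t b"
  let ?w = "2 * disk_gap ?x ?z powr (- 1/4)"
  have "(\<integral>\<^sup>+c. ennreal (disk_gap ?x (rcis s c) powr (- 1/2) * disk_gap (rcis s c) ?z powr (- 1/2)) \<partial>circle_measure)
     \<le> (\<integral>\<^sup>+c. ennreal ?w * (ennreal (disk_gap ?x (rcis s c) powr (- (3/4))) + ennreal (disk_gap ?z (rcis s c) powr (- (3/4)))) \<partial>circle_measure)"
  proof (rule nn_integral_mono)
    fix c
    have "disk_gap ?x (rcis s c) powr (- 1/2) * disk_gap (rcis s c) ?z powr (- 1/2)
        \<le> ?w * (disk_gap ?x (rcis s c) powr (- (3/4)) + disk_gap ?z (rcis s c) powr (- (3/4)))"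
      using disk_gap_product[of ?x "rcis s c" ?z] r s t by (simp add: disk_gap_sym[of ?z])
    then show "ennreal (disk_gap ?x (rcis s c) powr (- 1/2) * disk_gap (rcis s c) ?z powr (- 1/2))
        \<le> ennreal ?w * (ennreal (disk_gap ?x (rcis s c) powr (- (3/4))) + ennreal (disk_gap ?z (rcis s c) powr (- (3/4))))"
      by (simp add: ennreal_mult'[symmetric] ennreal_plus[symmetric] del: ennreal_plus)
  qed
  also have "\<dots> = ennreal ?w * ((\<integral>\<^sup>+c. ennreal (disk_gap ?x (rcis s c) powr (- (3/4))) \<partial>circle_measure)
      + (\<integral>\<^sup>+c. ennreal (disk_gap ?z (rcis s c) powr (- (3/4))) \<partial>circle_measure))"
    by (subst nn_integral_cmult, measurable, subst nn_integral_add) auto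
  also have "\<dots> \<le> ennreal ?w * (ennreal (gap_const (3/4)) + ennreal (gap_const (3/4)))"
    using r s t by (intro mult_left_mono add_mono circle_gap_integral_const) auto
  also have "\<dots> = ennreal (4 * gap_const (3/4) * disk_gap ?x ?z powr (- 1/4))"
    using gap_const_nonneg[of "3/4"]
    by (simp add: ennreal_mult'[symmetric] ennreal_plus[symmetric] mult_ac del: ennreal_plus)
  finally show ?thesis .
qed

context random_angles
begin

definition defect :: "nat \<Rightarrow> real" where
  "defect n = 1 - (\<rho> n)\<^sup>2"

lemma defect_pos: "0 < defect n" and defect_le_1: "defect n \<le> 1"
  using radii[of n] by (auto simp: defect_def power_less_one_iff)

lemma radii_mult: "0 < 1 - \<rho> i * \<rho> j" "1 - \<rho> i * \<rho> j \<le> 1"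
  using radii[of i] radii[of j] mult_strict_mono'[of "\<rho> i" 1 "\<rho> j" 1] by auto

lemma gram_abs_point:
  "gram_abs \<beta> (point i \<omega>) (point j \<omega>)
    = (defect i * defect j) powr (\<beta> / 2) * disk_gap (point i \<omega>) (point j \<omega>) powr (- \<beta>)"
  using radii[of i] radii[of j] by (simp add: gram_abs_def disk_gap_def defect_def point_def)

lemma offdiag_point_le:
  "offdiag \<beta> (point i \<omega>) (point j \<omega>)
    \<le> (defect i * defect j) powr (\<beta> / 2) * disk_gap (point i \<omega>) (point j \<omega>) powr (- \<beta>)"
  unfolding gram_abs_point[symmetric] by (simp add: offdiag_def gram_abs_nonneg)

lemma offdiag_point_measurable [measurable]:
  "(\<lambda>\<omega>. offdiag \<beta> (point i \<omega>) (point j \<omega>)) \<in> borel_measurable M"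
  unfolding offdiag_def gram_abs_point by measurable

lemma expectation_gap:
  assumes "i \<noteq> j" "0 < s" "s \<noteq> 1"
  shows "(\<integral>\<^sup>+\<omega>. ennreal (disk_gap (point i \<omega>) (point j \<omega>) powr (- s)) \<partial>M) \<le> ennreal (gap_bound s (1 - \<rho> i * \<rho> j))"
proof -
  interpret C: prob_space circle_measure by (rule prob_space_circle_measure)
  have "(\<integral>\<^sup>+\<omega>. ennreal (disk_gap (point i \<omega>) (point j \<omega>) powr (- s)) \<partial>M)
     = (\<integral>\<^sup>+a. \<integral>\<^sup>+b. ennreal (disk_gap (rcis (\<rho> i) a) (rcis (\<rho> j) b) powr (- s)) \<partial>circle_measure \<partial>circle_measure)"
    unfolding point_def by (rule nn_integral_two_angles[OF assms(1)]) measurable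
  also have "\<dots> \<le> (\<integral>\<^sup>+a. ennreal (gap_bound s (1 - \<rho> i * \<rho> j)) \<partial>circle_measure)"
    using radii assms by (intro nn_integral_mono circle_gap_integral) auto
  finally show ?thesis by (simp add: C.emeasure_space_1)
qed

lemma expectation_offdiag_sq:
  assumes "i \<noteq> j" "0 < \<beta>" "\<beta> \<noteq> 1/2"
  shows "(\<integral>\<^sup>+\<omega>. ennreal ((offdiag \<beta> (point i \<omega>) (point j \<omega>))\<^sup>2) \<partial>M)
     \<le> ennreal ((defect i * defect j) powr \<beta> * gap_bound (2 * \<beta>) (1 - \<rho> i * \<rho> j))"
proof -
  have "(\<integral>\<^sup>+\<omega>. ennreal ((offdiag \<beta> (point i \<omega>) (point j \<omega>))\<^sup>2) \<partial>M)
     \<le> (\<integral>\<^sup>+\<omega>. ennreal ((defect i * defect j) powr \<beta>) * ennreal (disk_gap (point i \<omega>) (point j \<omega>) powr (- (2 * \<beta>))) \<partial>M)"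
  proof (rule nn_integral_mono)
    fix \<omega>
    have g: "0 < disk_gap (point i \<omega>) (point j \<omega>)" by (intro disk_gap_pos point_ball)
    have "(offdiag \<beta> (point i \<omega>) (point j \<omega>))\<^sup>2 \<le> ((defect i * defect j) powr (\<beta> / 2) * disk_gap (point i \<omega>) (point j \<omega>) powr (- \<beta>))\<^sup>2"
      by (intro power_mono offdiag_point_le offdiag_nonneg)
    also have "\<dots> = (defect i * defect j) powr \<beta> * disk_gap (point i \<omega>) (point j \<omega>) powr (- (2 * \<beta>))"
    proof -
      have sq: "(t powr a)\<^sup>2 = t powr (2 * a)" for t a :: real
        by (simp add: power2_eq_square powr_add[symmetric])
      show ?thesis unfolding power_mult_distrib sq by simp
    qed
    finally show "ennreal ((offdiag \<beta> (point i \<omega>) (point j \<omega>))\<^sup>2)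
      \<le> ennreal ((defect i * defect j) powr \<beta>) * ennreal (disk_gap (point i \<omega>) (point j \<omega>) powr (- (2 * \<beta>)))"
      by (simp add: ennreal_mult'[symmetric])
  qed
  also have "\<dots> = ennreal ((defect i * defect j) powr \<beta>) * (\<integral>\<^sup>+\<omega>. ennreal (disk_gap (point i \<omega>) (point j \<omega>) powr (- (2 * \<beta>))) \<partial>M)"
    by (rule nn_integral_cmult) measurable
  also have "\<dots> \<le> ennreal ((defect i * defect j) powr \<beta>) * ennreal (gap_bound (2 * \<beta>) (1 - \<rho> i * \<rho> j))"
    using assms by (intro mult_left_mono expectation_gap) auto
  finally show ?thesis by (simp add: ennreal_mult'[symmetric])
qed

abbreviation "active \<equiv> {n. 0 < \<rho> n}"

text \<open>All indices of radius 0 give the same point 0, which is added to the others at the end. This is why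
  only positive radii enter the sums below.\<close>

lemma random_points_interpolating:
  assumes \<alpha>: "0 \<le> \<alpha>" "\<alpha> < 1" and "universal_interpolating \<alpha> ((\<lambda>n. point n \<omega>) ` active)"
  shows "universal_interpolating \<alpha> (random_points \<rho> \<theta> \<omega>)"
proof -
  have "random_points \<rho> \<theta> \<omega> = (\<lambda>n. point n \<omega>) ` UNIV" by (simp add: random_points_def point_def)
  also have "UNIV = active \<union> {n. \<rho> n = 0}" using radii by (auto simp: le_less)
  finally have e: "random_points \<rho> \<theta> \<omega> = (\<lambda>n. point n \<omega>) ` active \<union> (\<lambda>n. point n \<omega>) ` {n. \<rho> n = 0}"
    by (simp add: image_Un)
  have z: "(\<lambda>n. point n \<omega>) ` {n. \<rho> n = 0} \<subseteq> {0}" by (auto simp: point_def)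
  then consider "(\<lambda>n. point n \<omega>) ` {n. \<rho> n = 0} = {}" | "(\<lambda>n. point n \<omega>) ` {n. \<rho> n = 0} = {0}"
    by (meson subset_singletonD)
  then show ?thesis
  proof cases
    case 1
    then show ?thesis using assms e by simp
  next
    case 2
    then have "random_points \<rho> \<theta> \<omega> = insert 0 ((\<lambda>n. point n \<omega>) ` active)" using e by simp
    then show ?thesis using universal_interpolating_insert[OF \<alpha> assms(3), of 0] by simp
  qed
qed

text \<open>A set of random points is indexed injectively by choosing one index per point, so sums over points
  are sums over some of the indices even if points coincide.\<close>

lemma selection:
  assumes "F \<subseteq> (\<lambda>n. point n \<omega>) ` active"
  obtains g where "\<And>x. x \<in> F \<Longrightarrow> g x \<in> active" "\<And>x. x \<in> F \<Longrightarrow> point (g x) \<omega> = x" "inj_on g F"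
proof -
  have "\<forall>x\<in>F. \<exists>n. n \<in> active \<and> point n \<omega> = x" using assms by blast
  then obtain g where g: "\<And>x. x \<in> F \<Longrightarrow> g x \<in> active \<and> point (g x) \<omega> = x" by metis
  then have "inj_on g F" by (metis inj_onI)
  then show ?thesis using that g by blast
qed

theorem AE_interpolating_square:
  assumes \<alpha>: "0 \<le> \<alpha>" "\<alpha> < 1"
    and C: "\<And>J. finite J \<Longrightarrow> J \<subseteq> active \<Longrightarrow>
      (\<Sum>i\<in>J. \<Sum>j\<in>J. \<integral>\<^sup>+\<omega>. ennreal ((offdiag (1 - \<alpha>) (point i \<omega>) (point j \<omega>))\<^sup>2) \<partial>M) \<le> ennreal C"
  shows "AE \<omega> in M. universal_interpolating \<alpha> (random_points \<rho> \<theta> \<omega>)"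
proof -
  let ?A = "\<lambda>i j \<omega>. offdiag (1 - \<alpha>) (point i \<omega>) (point j \<omega>)"
  define X where "X p \<omega> = (if fst p \<in> active \<and> snd p \<in> active then (?A (fst p) (snd p) \<omega>)\<^sup>2 else 0)" for p \<omega>
  have "AE \<omega> in M. \<exists>K. \<forall>Q. finite Q \<longrightarrow> (\<Sum>p\<in>Q. X p \<omega>) \<le> K"
  proof (rule AE_bounded_finite_sums[where C=C])
    fix Q :: "(nat \<times> nat) set" assume Q: "finite Q"
    define J where "J = (fst ` Q \<union> snd ` Q) \<inter> active"
    have J: "finite J" "J \<subseteq> active" using Q by (auto simp: J_def)
    have "(\<Sum>p\<in>Q. \<integral>\<^sup>+\<omega>. ennreal (X p \<omega>) \<partial>M) = (\<Sum>p\<in>Q \<inter> J \<times> J. \<integral>\<^sup>+\<omega>. ennreal (X p \<omega>) \<partial>M)"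
    proof (intro sum.mono_neutral_right ballI)
      fix p assume p: "p \<in> Q - Q \<inter> J \<times> J"
      then have "fst p \<in> fst ` Q" "snd p \<in> snd ` Q" "p \<notin> J \<times> J" by auto
      then have "X p \<omega> = 0" for \<omega> by (auto simp: X_def J_def mem_Times_iff)
      then show "(\<integral>\<^sup>+\<omega>. ennreal (X p \<omega>) \<partial>M) = 0" by simp
    qed (use Q in auto)
    also have "\<dots> \<le> (\<Sum>p\<in>J \<times> J. \<integral>\<^sup>+\<omega>. ennreal (X p \<omega>) \<partial>M)"
      using J by (intro sum_mono2) auto
    also have "\<dots> = (\<Sum>i\<in>J. \<Sum>j\<in>J. \<integral>\<^sup>+\<omega>. ennreal ((?A i j \<omega>)\<^sup>2) \<partial>M)"
      unfolding sum.cartesian_product using J by (intro sum.cong refl) (auto simp: X_def subset_iff)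
    also have "\<dots> \<le> ennreal C" by (rule C[OF J])
    finally show "(\<Sum>p\<in>Q. \<integral>\<^sup>+\<omega>. ennreal (X p \<omega>) \<partial>M) \<le> ennreal C" .
  qed (auto simp: X_def)
  then show ?thesis
  proof eventually_elim
    fix \<omega> assume "\<exists>K. \<forall>Q. finite Q \<longrightarrow> (\<Sum>p\<in>Q. X p \<omega>) \<le> K"
    then obtain K where K: "\<And>Q. finite Q \<Longrightarrow> (\<Sum>p\<in>Q. X p \<omega>) \<le> K" by blast
    show "universal_interpolating \<alpha> (random_points \<rho> \<theta> \<omega>)"
    proof (intro random_points_interpolating[OF \<alpha>] universal_interpolating_cycle_sum[OF \<alpha>, where C="K\<^sup>2"])
      fix F assume F: "finite F" "F \<subseteq> (\<lambda>n. point n \<omega>) ` active"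
      obtain g where g: "\<And>x. x \<in> F \<Longrightarrow> g x \<in> active" "\<And>x. x \<in> F \<Longrightarrow> point (g x) \<omega> = x" "inj_on g F"
        using selection[OF F(2)] by blast
      have "(\<Sum>x\<in>F. \<Sum>y\<in>F. (offdiag (1 - \<alpha>) x y)\<^sup>2) = (\<Sum>x\<in>F. \<Sum>y\<in>F. X (g x, g y) \<omega>)"
        using g by (intro sum.cong refl) (auto simp: X_def)
      also have "\<dots> = (\<Sum>a\<in>g ` F. \<Sum>b\<in>g ` F. X (a, b) \<omega>)"
        unfolding sum.reindex[OF g(3)] o_def ..
      also have "\<dots> = (\<Sum>p\<in>g ` F \<times> g ` F. X p \<omega>)"
        by (simp add: sum.cartesian_product case_prod_beta)
      also have "\<dots> \<le> K" using F by (intro K) auto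
      finally have "(\<Sum>x\<in>F. \<Sum>y\<in>F. (offdiag (1 - \<alpha>) x y)\<^sup>2)\<^sup>2 \<le> K\<^sup>2"
        by (intro power_mono sum_nonneg) auto
      then show "cycle_sum (1 - \<alpha>) F \<le> K\<^sup>2" using cycle_sum_le_square order_trans by blast
    qed (use point_ball in auto)
  qed
qed

theorem AE_interpolating_cycle:
  assumes \<alpha>: "0 \<le> \<alpha>" "\<alpha> < 1"
    and C: "\<And>J. finite J \<Longrightarrow> J \<subseteq> active \<Longrightarrow>
      (\<Sum>i\<in>J. \<Sum>j\<in>J. \<Sum>k\<in>J. \<Sum>l\<in>J. \<integral>\<^sup>+\<omega>. ennreal (offdiag (1 - \<alpha>) (point i \<omega>) (point j \<omega>) * offdiag (1 - \<alpha>) (point j \<omega>) (point k \<omega>)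
        * offdiag (1 - \<alpha>) (point k \<omega>) (point l \<omega>) * offdiag (1 - \<alpha>) (point l \<omega>) (point i \<omega>)) \<partial>M) \<le> ennreal C"
  shows "AE \<omega> in M. universal_interpolating \<alpha> (random_points \<rho> \<theta> \<omega>)"
proof -
  let ?A = "\<lambda>i j \<omega>. offdiag (1 - \<alpha>) (point i \<omega>) (point j \<omega>)"
  define X where "X = (\<lambda>(i, j, k, l) \<omega>. if i \<in> active \<and> j \<in> active \<and> k \<in> active \<and> l \<in> active
    then ?A i j \<omega> * ?A j k \<omega> * ?A k l \<omega> * ?A l i \<omega> else 0)"
  have "AE \<omega> in M. \<exists>K. \<forall>Q. finite Q \<longrightarrow> (\<Sum>p\<in>Q. X p \<omega>) \<le> K"
  proof (rule AE_bounded_finite_sums[where C=C])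
    show "X p \<in> borel_measurable M" for p unfolding X_def by (cases p) auto
    show "0 \<le> X p \<omega>" for p \<omega> unfolding X_def by (cases p) (auto intro!: mult_nonneg_nonneg offdiag_nonneg)
    fix Q :: "(nat \<times> nat \<times> nat \<times> nat) set" assume Q: "finite Q"
    define J where "J = (\<Union>(i, j, k, l)\<in>Q. {i, j, k, l}) \<inter> active"
    have J: "finite J" "J \<subseteq> active" using Q by (auto simp: J_def)
    have "(\<Sum>p\<in>Q. \<integral>\<^sup>+\<omega>. ennreal (X p \<omega>) \<partial>M) = (\<Sum>p\<in>Q \<inter> J \<times> J \<times> J \<times> J. \<integral>\<^sup>+\<omega>. ennreal (X p \<omega>) \<partial>M)"
    proof (intro sum.mono_neutral_right ballI)
      fix p assume p: "p \<in> Q - Q \<inter> J \<times> J \<times> J \<times> J"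
      obtain i j k l where ijkl: "p = (i, j, k, l)" by (metis prod.collapse)
      then have "{i, j, k, l} \<subseteq> (\<Union>(i, j, k, l)\<in>Q. {i, j, k, l})" using p by blast
      then have "X p \<omega> = 0" for \<omega> using p ijkl by (auto simp: X_def J_def)
      then show "(\<integral>\<^sup>+\<omega>. ennreal (X p \<omega>) \<partial>M) = 0" by simp
    qed (use Q in auto)
    also have "\<dots> \<le> (\<Sum>p\<in>J \<times> J \<times> J \<times> J. \<integral>\<^sup>+\<omega>. ennreal (X p \<omega>) \<partial>M)"
      using J by (intro sum_mono2) auto
    also have "\<dots> = (\<Sum>i\<in>J. \<Sum>j\<in>J. \<Sum>k\<in>J. \<Sum>l\<in>J. \<integral>\<^sup>+\<omega>. ennreal (?A i j \<omega> * ?A j k \<omega> * ?A k l \<omega> * ?A l i \<omega>) \<partial>M)"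
      unfolding sum.cartesian_product using J by (intro sum.cong refl) (auto simp: X_def subset_iff)
    also have "\<dots> \<le> ennreal C" by (rule C[OF J])
    finally show "(\<Sum>p\<in>Q. \<integral>\<^sup>+\<omega>. ennreal (X p \<omega>) \<partial>M) \<le> ennreal C" .
  qed
  then show ?thesis
  proof eventually_elim
    fix \<omega> assume "\<exists>K. \<forall>Q. finite Q \<longrightarrow> (\<Sum>p\<in>Q. X p \<omega>) \<le> K"
    then obtain K where K: "\<And>Q. finite Q \<Longrightarrow> (\<Sum>p\<in>Q. X p \<omega>) \<le> K" by blast
    show "universal_interpolating \<alpha> (random_points \<rho> \<theta> \<omega>)"
    proof (intro random_points_interpolating[OF \<alpha>] universal_interpolating_cycle_sum[OF \<alpha>, where C=K])
      fix F assume F: "finite F" "F \<subseteq> (\<lambda>n. point n \<omega>) ` active"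
      obtain g where g: "\<And>x. x \<in> F \<Longrightarrow> g x \<in> active" "\<And>x. x \<in> F \<Longrightarrow> point (g x) \<omega> = x" "inj_on g F"
        using selection[OF F(2)] by blast
      have "cycle_sum (1 - \<alpha>) F = (\<Sum>x\<in>F. \<Sum>y\<in>F. \<Sum>z\<in>F. \<Sum>w\<in>F. X (g x, g y, g z, g w) \<omega>)"
        unfolding cycle_sum_def using g by (intro sum.cong refl) (auto simp: X_def)
      also have "\<dots> = (\<Sum>a\<in>g ` F. \<Sum>b\<in>g ` F. \<Sum>c\<in>g ` F. \<Sum>d\<in>g ` F. X (a, b, c, d) \<omega>)"
        unfolding sum.reindex[OF g(3)] o_def ..
      also have "\<dots> = (\<Sum>p\<in>g ` F \<times> g ` F \<times> g ` F \<times> g ` F. X p \<omega>)"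
        by (simp add: sum.cartesian_product case_prod_beta)
      also have "\<dots> \<le> K" using F by (intro K) auto
      finally show "cycle_sum (1 - \<alpha>) F \<le> K" .
    qed (use point_ball in auto)
  qed
qed

end

section \<open>Summable radii\<close>

context random_angles
begin

text \<open>Here \<open>2 * (1 - \<alpha>) < 1\<close>, so the mean of \<open>disk_gap powr (- 2 * (1 - \<alpha>))\<close> is bounded uniformly in
  the radii, and the expected squared Gram entries are dominated by a product.\<close>

lemma AE_interpolating_summable_supercritical:
  assumes \<alpha>: "1/2 < \<alpha>" "\<alpha> < 1"
    and S: "\<And>J. finite J \<Longrightarrow> J \<subseteq> active \<Longrightarrow> (\<Sum>i\<in>J. defect i powr (1 - \<alpha>)) \<le> S"
  shows "AE \<omega> in M. universal_interpolating \<alpha> (random_points \<rho> \<theta> \<omega>)"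
proof (rule AE_interpolating_square[where C="gap_const (2 * (1 - \<alpha>)) * S\<^sup>2"])
  fix J assume J: "finite J" "J \<subseteq> active"
  let ?\<beta> = "1 - \<alpha>" and ?K = "gap_const (2 * (1 - \<alpha>))"
  have K: "0 \<le> ?K" using \<alpha> by (intro gap_const_nonneg) auto
  have "(\<integral>\<^sup>+\<omega>. ennreal ((offdiag ?\<beta> (point i \<omega>) (point j \<omega>))\<^sup>2) \<partial>M) \<le> ennreal (?K * (defect i powr ?\<beta> * defect j powr ?\<beta>))" for i j
  proof (cases "i = j")
    case False
    have "gap_bound (2 * ?\<beta>) (1 - \<rho> i * \<rho> j) \<le> ?K"
      unfolding gap_const_def using \<alpha> radii_mult by (intro gap_bound_small_exponent) auto
    then have "(defect i * defect j) powr ?\<beta> * gap_bound (2 * ?\<beta>) (1 - \<rho> i * \<rho> j) \<le> (defect i * defect j) powr ?\<beta> * ?K"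
      by (intro mult_left_mono) auto
    also have "\<dots> = ?K * (defect i powr ?\<beta> * defect j powr ?\<beta>)"
      using defect_pos by (simp add: powr_mult less_imp_le)
    finally show ?thesis
      using expectation_offdiag_sq[OF False, of ?\<beta>] \<alpha> by (auto intro: order_trans ennreal_leI)
  qed (simp add: offdiag_def)
  then have "(\<Sum>i\<in>J. \<Sum>j\<in>J. \<integral>\<^sup>+\<omega>. ennreal ((offdiag ?\<beta> (point i \<omega>) (point j \<omega>))\<^sup>2) \<partial>M)
     \<le> (\<Sum>i\<in>J. \<Sum>j\<in>J. ennreal (?K * (defect i powr ?\<beta> * defect j powr ?\<beta>)))"
    by (intro sum_mono)
  also have "\<dots> = ennreal (\<Sum>i\<in>J. \<Sum>j\<in>J. ?K * (defect i powr ?\<beta> * defect j powr ?\<beta>))"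
    using K by (simp add: sum_ennreal sum_nonneg)
  also have "(\<Sum>i\<in>J. \<Sum>j\<in>J. ?K * (defect i powr ?\<beta> * defect j powr ?\<beta>)) = ?K * (\<Sum>i\<in>J. defect i powr ?\<beta>)\<^sup>2"
    unfolding power2_eq_square sum_product by (simp only: sum_distrib_left)
  also have "ennreal \<dots> \<le> ennreal (?K * S\<^sup>2)"
    using K by (intro ennreal_leI mult_left_mono power_mono S J sum_nonneg) auto
  finally show "(\<Sum>i\<in>J. \<Sum>j\<in>J. \<integral>\<^sup>+\<omega>. ennreal ((offdiag ?\<beta> (point i \<omega>) (point j \<omega>))\<^sup>2) \<partial>M) \<le> ennreal (?K * S\<^sup>2)" .
qed (use \<alpha> in auto)

lemma half_offdiag_le:
  "offdiag (1/2) (point i \<omega>) (point j \<omega>) \<le> (defect i * defect j) powr (1/4) * disk_gap (point i \<omega>) (point j \<omega>) powr (- 1/2)"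
  using offdiag_point_le[of "1/2" i \<omega> j] by simp

text \<open>Given the angles of \<open>i\<close> and \<open>k\<close>, the two paths from \<open>i\<close> to \<open>k\<close> through \<open>j\<close> and \<open>l\<close> are independent.
  Each contributes a quarter power of the gap between \<open>i\<close> and \<open>k\<close>, and the resulting half power is
  integrable.\<close>

lemma expectation_cycle_distinct:
  assumes d: "distinct [i, k, j, l]"
  shows "(\<integral>\<^sup>+\<omega>. ennreal (offdiag (1/2) (point i \<omega>) (point j \<omega>) * offdiag (1/2) (point j \<omega>) (point k \<omega>)
        * offdiag (1/2) (point k \<omega>) (point l \<omega>) * offdiag (1/2) (point l \<omega>) (point i \<omega>)) \<partial>M)
    \<le> ennreal (16 * (gap_const (3/4))\<^sup>2 * gap_const (1/2) * (sqrt (defect i) * sqrt (defect j) * sqrt (defect k) * sqrt (defect l)))"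
proof -
  interpret C: prob_space circle_measure by (rule prob_space_circle_measure)
  let ?U = circle_measure
  let ?g = "\<lambda>x y. disk_gap x y powr (- 1/2)" and ?r = "\<lambda>n a. rcis (\<rho> n) a"
  let ?P = "sqrt (defect i) * sqrt (defect j) * sqrt (defect k) * sqrt (defect l)"
  let ?K = "4 * gap_const (3/4)"
  have K: "0 \<le> ?K" using gap_const_nonneg[of "3/4"] by simp
  have P: "(defect i * defect j) powr (1/4) * (defect j * defect k) powr (1/4) * (defect k * defect l) powr (1/4) * (defect l * defect i) powr (1/4) = ?P"
  proof -
    have q: "sqrt t = t powr (1/4) * t powr (1/4)" if "0 < t" for t :: real
      using that by (simp add: powr_add[symmetric] powr_half_sqrt)
    show ?thesis using defect_pos[of i] defect_pos[of j] defect_pos[of k] defect_pos[of l]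
      by (simp add: q powr_mult mult_ac)
  qed
  have le: "offdiag (1/2) (point i \<omega>) (point j \<omega>) * offdiag (1/2) (point j \<omega>) (point k \<omega>)
        * offdiag (1/2) (point k \<omega>) (point l \<omega>) * offdiag (1/2) (point l \<omega>) (point i \<omega>)
     \<le> ?P * ((?g (point i \<omega>) (point j \<omega>) * ?g (point j \<omega>) (point k \<omega>)) * (?g (point i \<omega>) (point l \<omega>) * ?g (point l \<omega>) (point k \<omega>)))" for \<omega>
  proof -
    have "offdiag (1/2) (point i \<omega>) (point j \<omega>) * offdiag (1/2) (point j \<omega>) (point k \<omega>)
        * offdiag (1/2) (point k \<omega>) (point l \<omega>) * offdiag (1/2) (point l \<omega>) (point i \<omega>)
      \<le> ((defect i * defect j) powr (1/4) * ?g (point i \<omega>) (point j \<omega>)) * ((defect j * defect k) powr (1/4) * ?g (point j \<omega>) (point k \<omega>))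
       * ((defect k * defect l) powr (1/4) * ?g (point k \<omega>) (point l \<omega>)) * ((defect l * defect i) powr (1/4) * ?g (point l \<omega>) (point i \<omega>))"
      by (intro mult_mono half_offdiag_le mult_nonneg_nonneg offdiag_nonneg) auto
    also have "\<dots> = ?P * ((?g (point i \<omega>) (point j \<omega>) * ?g (point j \<omega>) (point k \<omega>)) * (?g (point i \<omega>) (point l \<omega>) * ?g (point l \<omega>) (point k \<omega>)))"
      unfolding P[symmetric] by (simp add: disk_gap_sym[of "point k \<omega>" "point l \<omega>"] disk_gap_sym[of "point l \<omega>" "point i \<omega>"] mult_ac)
    finally show ?thesis .
  qed
  have "(\<integral>\<^sup>+\<omega>. ennreal (offdiag (1/2) (point i \<omega>) (point j \<omega>) * offdiag (1/2) (point j \<omega>) (point k \<omega>)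
        * offdiag (1/2) (point k \<omega>) (point l \<omega>) * offdiag (1/2) (point l \<omega>) (point i \<omega>)) \<partial>M)
     \<le> (\<integral>\<^sup>+\<omega>. ennreal (?P * ((?g (point i \<omega>) (point j \<omega>) * ?g (point j \<omega>) (point k \<omega>)) * (?g (point i \<omega>) (point l \<omega>) * ?g (point l \<omega>) (point k \<omega>)))) \<partial>M)"
    by (intro nn_integral_mono ennreal_leI le)
  also have "\<dots> = (\<integral>\<^sup>+a. \<integral>\<^sup>+b. \<integral>\<^sup>+c. \<integral>\<^sup>+d. ennreal (?P * ((?g (?r i a) (?r j c) * ?g (?r j c) (?r k b)) * (?g (?r i a) (?r l d) * ?g (?r l d) (?r k b)))) \<partial>?U \<partial>?U \<partial>?U \<partial>?U)"
    unfolding point_def by (rule nn_integral_four_angles[OF d]) measurable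
  also have "\<dots> \<le> (\<integral>\<^sup>+a. \<integral>\<^sup>+b. ennreal (?P * ?K\<^sup>2) * ennreal (disk_gap (?r i a) (?r k b) powr (- (1/2))) \<partial>?U \<partial>?U)"
  proof (rule nn_integral_mono, rule nn_integral_mono)
    fix a b
    let ?w = "?K * disk_gap (?r i a) (?r k b) powr (- 1/4)"
    have w: "0 \<le> ?w" using K by simp
    have J: "(\<integral>\<^sup>+c. ennreal (?g (?r i a) (?r n c) * ?g (?r n c) (?r k b)) \<partial>?U) \<le> ennreal ?w" for n
      by (rule circle_two_gaps_integral) (use radii in auto)
    have "(\<integral>\<^sup>+c. \<integral>\<^sup>+d. ennreal (?P * ((?g (?r i a) (?r j c) * ?g (?r j c) (?r k b)) * (?g (?r i a) (?r l d) * ?g (?r l d) (?r k b)))) \<partial>?U \<partial>?U)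
       = (\<integral>\<^sup>+c. \<integral>\<^sup>+d. ennreal ?P * ennreal (?g (?r i a) (?r j c) * ?g (?r j c) (?r k b)) * ennreal (?g (?r i a) (?r l d) * ?g (?r l d) (?r k b)) \<partial>?U \<partial>?U)"
      using defect_pos by (simp add: ennreal_mult'[symmetric] mult.assoc less_imp_le)
    also have "\<dots> = (\<integral>\<^sup>+c. ennreal ?P * ennreal (?g (?r i a) (?r j c) * ?g (?r j c) (?r k b)) * (\<integral>\<^sup>+d. ennreal (?g (?r i a) (?r l d) * ?g (?r l d) (?r k b)) \<partial>?U) \<partial>?U)"
      by (intro nn_integral_cong nn_integral_cmult) measurable
    also have "\<dots> = ennreal ?P * ((\<integral>\<^sup>+c. ennreal (?g (?r i a) (?r j c) * ?g (?r j c) (?r k b)) \<partial>?U) * (\<integral>\<^sup>+d. ennreal (?g (?r i a) (?r l d) * ?g (?r l d) (?r k b)) \<partial>?U))"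
      by (subst nn_integral_multc, measurable, subst nn_integral_cmult) (measurable, simp add: mult.assoc)
    also have "\<dots> \<le> ennreal ?P * (ennreal ?w * ennreal ?w)"
      by (intro mult_left_mono mult_mono J) auto
    also have "\<dots> = ennreal (?P * ?K\<^sup>2) * ennreal (disk_gap (?r i a) (?r k b) powr (- (1/2)))"
    proof -
      have "?w * ?w = ?K\<^sup>2 * disk_gap (?r i a) (?r k b) powr (- (1/2))"
        by (simp add: power2_eq_square powr_add[symmetric])
      then show ?thesis using w K defect_pos by (simp add: ennreal_mult'[symmetric] less_imp_le mult.assoc)
    qed
    finally show "(\<integral>\<^sup>+c. \<integral>\<^sup>+d. ennreal (?P * ((?g (?r i a) (?r j c) * ?g (?r j c) (?r k b)) * (?g (?r i a) (?r l d) * ?g (?r l d) (?r k b)))) \<partial>?U \<partial>?U)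
      \<le> ennreal (?P * ?K\<^sup>2) * ennreal (disk_gap (?r i a) (?r k b) powr (- (1/2)))" .
  qed
  also have "\<dots> \<le> (\<integral>\<^sup>+a. ennreal (?P * ?K\<^sup>2) * ennreal (gap_const (1/2)) \<partial>?U)"
  proof (rule nn_integral_mono)
    fix a
    have "(\<integral>\<^sup>+b. ennreal (?P * ?K\<^sup>2) * ennreal (disk_gap (?r i a) (?r k b) powr (- (1/2))) \<partial>?U)
       = ennreal (?P * ?K\<^sup>2) * (\<integral>\<^sup>+b. ennreal (disk_gap (?r i a) (?r k b) powr (- (1/2))) \<partial>?U)"
      by (rule nn_integral_cmult) measurable
    also have "\<dots> \<le> ennreal (?P * ?K\<^sup>2) * ennreal (gap_const (1/2))"
      by (intro mult_left_mono circle_gap_integral_const) (use radii in auto)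
    finally show "(\<integral>\<^sup>+b. ennreal (?P * ?K\<^sup>2) * ennreal (disk_gap (?r i a) (?r k b) powr (- (1/2))) \<partial>?U)
       \<le> ennreal (?P * ?K\<^sup>2) * ennreal (gap_const (1/2))" .
  qed
  also have "\<dots> = ennreal (?P * ?K\<^sup>2) * ennreal (gap_const (1/2))"
    by (simp add: C.emeasure_space_1)
  also have "\<dots> = ennreal (16 * (gap_const (3/4))\<^sup>2 * gap_const (1/2) * ?P)"
    using gap_const_nonneg[of "1/2"]
    by (subst ennreal_mult''[symmetric]) (simp_all add: power_mult_distrib mult_ac)
  finally show ?thesis .
qed

text \<open>A degenerate cycle that passes twice through \<open>i\<close>. Of the full power of each gap, a quarter is
  estimated by \<open>disk_gap \<ge> defect i / 2\<close> and three quarters are integrated.\<close>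

lemma expectation_cycle_star:
  assumes d: "distinct [i, j, l]"
  shows "(\<integral>\<^sup>+\<omega>. ennreal ((offdiag (1/2) (point i \<omega>) (point j \<omega>))\<^sup>2 * (offdiag (1/2) (point i \<omega>) (point l \<omega>))\<^sup>2) \<partial>M)
    \<le> ennreal (4 * (gap_const (3/4))\<^sup>2 * (sqrt (defect i) * sqrt (defect j) * sqrt (defect l)))"
proof -
  interpret C: prob_space circle_measure by (rule prob_space_circle_measure)
  let ?U = circle_measure
  let ?g = "\<lambda>x y. disk_gap x y powr (- (3/4))" and ?r = "\<lambda>n a. rcis (\<rho> n) a"
  let ?P = "4 * (sqrt (defect i) * sqrt (defect j) * sqrt (defect l))"
  have one: "(offdiag (1/2) (point i \<omega>) (point n \<omega>))\<^sup>2 \<le> 2 * (defect i powr (1/4) * sqrt (defect n)) * ?g (point i \<omega>) (point n \<omega>)" for n \<omega>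
  proof -
    let ?D = "disk_gap (point i \<omega>) (point n \<omega>)"
    have D: "0 < ?D" by (intro disk_gap_pos point_ball)
    have "(offdiag (1/2) (point i \<omega>) (point n \<omega>))\<^sup>2 \<le> ((defect i * defect n) powr (1/4) * ?D powr (- 1/2))\<^sup>2"
      by (intro power_mono half_offdiag_le offdiag_nonneg)
    also have "\<dots> = sqrt (defect i) * sqrt (defect n) * (?D powr (- (1/4)) * ?g (point i \<omega>) (point n \<omega>))"
    proof -
      have sq: "(t powr a)\<^sup>2 = t powr (2 * a)" for t a :: real
        by (simp add: power2_eq_square powr_add[symmetric])
      show ?thesis unfolding power_mult_distrib sq using defect_pos[of i] defect_pos[of n] D
        by (simp add: powr_mult powr_half_sqrt powr_add[symmetric])
    qed
    also have "?D powr (- (1/4)) \<le> 2 * defect i powr (- (1/4))"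
    proof -
      have "\<rho> i * \<rho> n \<le> \<rho> i" using radii[of i] radii[of n] by (simp add: mult_left_le)
      moreover have "defect i / 2 \<le> 1 - \<rho> i"
      proof -
        have "defect i = (1 - \<rho> i) * (1 + \<rho> i)" by (simp add: defect_def power2_eq_square algebra_simps)
        also have "\<dots> \<le> (1 - \<rho> i) * 2" using radii[of i] by (intro mult_left_mono) auto
        finally show ?thesis by simp
      qed
      ultimately have "defect i / 2 \<le> ?D"
        using disk_gap_ge[of "point i \<omega>" "point n \<omega>"] radii[of i] radii[of n] by (simp add: point_def)
      then have "?D powr (- (1/4)) \<le> (defect i / 2) powr (- (1/4))"
        using defect_pos[of i] by (intro powr_mono2') auto
      also have "\<dots> = defect i powr (- (1/4)) * 2 powr (1/4)"
        using defect_pos[of i] by (simp add: powr_divide powr_minus field_simps)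
      also have "\<dots> \<le> defect i powr (- (1/4)) * 2 powr 1"
        by (intro mult_left_mono powr_mono) auto
      finally show ?thesis by (simp add: mult.commute)
    qed
    also have "sqrt (defect i) * sqrt (defect n) * (2 * defect i powr (- (1/4)) * ?g (point i \<omega>) (point n \<omega>))
       = 2 * (defect i powr (1/4) * sqrt (defect n)) * ?g (point i \<omega>) (point n \<omega>)"
    proof -
      have "sqrt (defect i) * defect i powr (- (1/4)) = defect i powr (1/4)"
        using defect_pos[of i] by (simp add: powr_half_sqrt[symmetric] powr_add[symmetric])
      then show ?thesis by (simp add: mult_ac)
    qed
    finally show ?thesis using defect_pos[of i] defect_pos[of n]
      by (simp add: mult_left_mono mult_right_mono less_imp_le)
  qed
  have le: "(offdiag (1/2) (point i \<omega>) (point j \<omega>))\<^sup>2 * (offdiag (1/2) (point i \<omega>) (point l \<omega>))\<^sup>2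
     \<le> ?P * (?g (point i \<omega>) (point j \<omega>) * ?g (point i \<omega>) (point l \<omega>))" for \<omega>
  proof -
    have "(offdiag (1/2) (point i \<omega>) (point j \<omega>))\<^sup>2 * (offdiag (1/2) (point i \<omega>) (point l \<omega>))\<^sup>2
      \<le> (2 * (defect i powr (1/4) * sqrt (defect j)) * ?g (point i \<omega>) (point j \<omega>)) * (2 * (defect i powr (1/4) * sqrt (defect l)) * ?g (point i \<omega>) (point l \<omega>))"
      using defect_pos by (intro mult_mono one) (auto simp: less_imp_le)
    also have "\<dots> = 4 * ((defect i powr (1/4) * defect i powr (1/4)) * sqrt (defect j) * sqrt (defect l)) * (?g (point i \<omega>) (point j \<omega>) * ?g (point i \<omega>) (point l \<omega>))"
      by (simp add: mult_ac)
    also have "defect i powr (1/4) * defect i powr (1/4) = sqrt (defect i)"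
      using defect_pos[of i] by (simp add: powr_add[symmetric] powr_half_sqrt)
    finally show ?thesis .
  qed
  have "(\<integral>\<^sup>+\<omega>. ennreal ((offdiag (1/2) (point i \<omega>) (point j \<omega>))\<^sup>2 * (offdiag (1/2) (point i \<omega>) (point l \<omega>))\<^sup>2) \<partial>M)
    \<le> (\<integral>\<^sup>+\<omega>. ennreal (?P * (?g (point i \<omega>) (point j \<omega>) * ?g (point i \<omega>) (point l \<omega>))) \<partial>M)"
    by (intro nn_integral_mono ennreal_leI le)
  also have "\<dots> = (\<integral>\<^sup>+a. \<integral>\<^sup>+b. \<integral>\<^sup>+c. ennreal (?P * (?g (?r i a) (?r j b) * ?g (?r i a) (?r l c))) \<partial>?U \<partial>?U \<partial>?U)"
    unfolding point_def by (rule nn_integral_three_angles[OF d]) measurable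
  also have "\<dots> \<le> (\<integral>\<^sup>+a. ennreal ?P * (ennreal (gap_const (3/4)) * ennreal (gap_const (3/4))) \<partial>?U)"
  proof (rule nn_integral_mono)
    fix a
    have J: "(\<integral>\<^sup>+b. ennreal (?g (?r i a) (?r n b)) \<partial>?U) \<le> ennreal (gap_const (3/4))" for n
      by (rule circle_gap_integral_const) (use radii in auto)
    have "(\<integral>\<^sup>+b. \<integral>\<^sup>+c. ennreal (?P * (?g (?r i a) (?r j b) * ?g (?r i a) (?r l c))) \<partial>?U \<partial>?U)
       = (\<integral>\<^sup>+b. \<integral>\<^sup>+c. ennreal ?P * ennreal (?g (?r i a) (?r j b)) * ennreal (?g (?r i a) (?r l c)) \<partial>?U \<partial>?U)"
      using defect_pos by (simp add: ennreal_mult'[symmetric] mult.assoc less_imp_le)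
    also have "\<dots> = (\<integral>\<^sup>+b. ennreal ?P * ennreal (?g (?r i a) (?r j b)) * (\<integral>\<^sup>+c. ennreal (?g (?r i a) (?r l c)) \<partial>?U) \<partial>?U)"
      by (intro nn_integral_cong nn_integral_cmult) measurable
    also have "\<dots> = ennreal ?P * ((\<integral>\<^sup>+b. ennreal (?g (?r i a) (?r j b)) \<partial>?U) * (\<integral>\<^sup>+c. ennreal (?g (?r i a) (?r l c)) \<partial>?U))"
      by (subst nn_integral_multc, measurable, subst nn_integral_cmult) (measurable, simp add: mult.assoc)
    also have "\<dots> \<le> ennreal ?P * (ennreal (gap_const (3/4)) * ennreal (gap_const (3/4)))"
      by (intro mult_left_mono mult_mono J) auto
    finally show "(\<integral>\<^sup>+b. \<integral>\<^sup>+c. ennreal (?P * (?g (?r i a) (?r j b) * ?g (?r i a) (?r l c))) \<partial>?U \<partial>?U)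
      \<le> ennreal ?P * (ennreal (gap_const (3/4)) * ennreal (gap_const (3/4)))" .
  qed
  also have "\<dots> = ennreal ?P * (ennreal (gap_const (3/4)) * ennreal (gap_const (3/4)))"
    by (simp add: C.emeasure_space_1)
  also have "\<dots> = ennreal (4 * (gap_const (3/4))\<^sup>2 * (sqrt (defect i) * sqrt (defect j) * sqrt (defect l)))"
    using gap_const_nonneg[of "3/4"] by (simp add: ennreal_mult''[symmetric] power2_eq_square mult_ac)
  finally show ?thesis .
qed

text \<open>A degenerate cycle with a single edge. The mean of the inverse squared gap is of order
  \<open>1 / (1 - \<rho> i * \<rho> j)\<close>, and \<open>defect i * defect j \<le> (1 - \<rho> i * \<rho> j)\<^sup>2\<close>.\<close>

lemma expectation_cycle_edge:
  assumes d: "i \<noteq> j"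
  shows "(\<integral>\<^sup>+\<omega>. ennreal ((offdiag (1/2) (point i \<omega>) (point j \<omega>)) ^ 4) \<partial>M)
    \<le> ennreal (3 * 8 powr 2 * (1 / pi) * (sqrt (defect i) * sqrt (defect j)))"
proof -
  let ?c = "3 * 8 powr 2 * (1 / pi) :: real"
  have "(\<integral>\<^sup>+\<omega>. ennreal ((offdiag (1/2) (point i \<omega>) (point j \<omega>)) ^ 4) \<partial>M)
     \<le> (\<integral>\<^sup>+\<omega>. ennreal (defect i * defect j) * ennreal (disk_gap (point i \<omega>) (point j \<omega>) powr (- 2)) \<partial>M)"
  proof (rule nn_integral_mono)
    fix \<omega>
    have "(offdiag (1/2) (point i \<omega>) (point j \<omega>)) ^ 4 \<le> ((defect i * defect j) powr (1/4) * disk_gap (point i \<omega>) (point j \<omega>) powr (- 1/2)) ^ 4"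
      by (intro power_mono half_offdiag_le offdiag_nonneg)
    also have "\<dots> = (defect i * defect j) * disk_gap (point i \<omega>) (point j \<omega>) powr (- 2)"
    proof -
      have "(t powr a) ^ 4 = t powr (4 * a)" for t a :: real
        by (simp add: powr_add[symmetric] power4_eq_xxxx)
      then show ?thesis unfolding power_mult_distrib using defect_pos[of i] defect_pos[of j]
        by simp
    qed
    finally show "ennreal ((offdiag (1/2) (point i \<omega>) (point j \<omega>)) ^ 4)
      \<le> ennreal (defect i * defect j) * ennreal (disk_gap (point i \<omega>) (point j \<omega>) powr (- 2))"
      using defect_pos[of i] defect_pos[of j] by (simp add: ennreal_mult''[symmetric])
  qed
  also have "\<dots> = ennreal (defect i * defect j) * (\<integral>\<^sup>+\<omega>. ennreal (disk_gap (point i \<omega>) (point j \<omega>) powr (- 2)) \<partial>M)"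
    by (rule nn_integral_cmult) measurable
  also have "\<dots> \<le> ennreal (defect i * defect j) * ennreal (gap_bound 2 (1 - \<rho> i * \<rho> j))"
    using d by (intro mult_left_mono expectation_gap) auto
  also have "\<dots> \<le> ennreal (defect i * defect j) * ennreal (?c * (1 / (1 - \<rho> i * \<rho> j)))"
    using gap_bound_large_exponent[of 2 "1 - \<rho> i * \<rho> j"] radii_mult[of i j]
    by (intro mult_left_mono ennreal_leI) (auto simp: powr_minus_divide)
  also have "\<dots> = ennreal (?c * ((sqrt (defect i) * sqrt (defect j)) * ((sqrt (defect i) * sqrt (defect j)) / (1 - \<rho> i * \<rho> j))))"
  proof -
    have "defect i * defect j = (sqrt (defect i) * sqrt (defect j)) * (sqrt (defect i) * sqrt (defect j))"
    proof -
      have "(sqrt (defect i) * sqrt (defect j)) * (sqrt (defect i) * sqrt (defect j))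
          = (sqrt (defect i) * sqrt (defect i)) * (sqrt (defect j) * sqrt (defect j))" by (simp only: mult_ac)
      then show ?thesis using defect_pos[of i] defect_pos[of j] by simp
    qed
    moreover have "0 \<le> defect i * defect j" using defect_pos[of i] defect_pos[of j] by simp
    ultimately show ?thesis by (simp add: ennreal_mult'[symmetric] mult_ac)
  qed
  also have "\<dots> \<le> ennreal (?c * ((sqrt (defect i) * sqrt (defect j)) * 1))"
  proof -
    have "defect i * defect j \<le> (1 - \<rho> i * \<rho> j)\<^sup>2"
      using zero_le_power2[of "\<rho> i - \<rho> j"] by (simp add: defect_def power2_eq_square algebra_simps)
    then have "sqrt (defect i * defect j) \<le> 1 - \<rho> i * \<rho> j"
      using radii_mult[of i j] by (intro real_le_lsqrt) auto
    then have "(sqrt (defect i) * sqrt (defect j)) / (1 - \<rho> i * \<rho> j) \<le> 1"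
      using radii_mult[of i j] by (simp add: real_sqrt_mult)
    then show ?thesis using defect_pos[of i] defect_pos[of j]
      by (intro ennreal_leI mult_left_mono) auto
  qed
  finally show ?thesis by simp
qed

text \<open>Cycles are sorted by coincidences among their vertices. The weight \<open>e i k\<close> equals \<open>u k\<close>, plus 1 if
  \<open>k = i\<close>, so that one product bounds all cases and the sum over cycles factorizes.\<close>

lemma AE_interpolating_summable_critical:
  assumes S: "\<And>J. finite J \<Longrightarrow> J \<subseteq> active \<Longrightarrow> (\<Sum>i\<in>J. sqrt (defect i)) \<le> S"
  shows "AE \<omega> in M. universal_interpolating (1/2) (random_points \<rho> \<theta> \<omega>)"
proof -
  define u where "u n = sqrt (defect n)" for n
  have u: "0 \<le> u n" for n using defect_pos[of n] by (simp add: u_def)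
  define K where "K = 16 * (gap_const (3/4))\<^sup>2 * gap_const (1/2) + 4 * (gap_const (3/4))\<^sup>2 + 3 * 8 powr 2 * (1 / pi)"
  have c: "0 \<le> 16 * (gap_const (3/4))\<^sup>2 * gap_const (1/2)" "0 \<le> 4 * (gap_const (3/4))\<^sup>2" "0 \<le> 3 * 8 powr 2 * (1 / pi)"
    using gap_const_nonneg[of "1/2"] by auto
  have K: "0 \<le> K" "16 * (gap_const (3/4))\<^sup>2 * gap_const (1/2) \<le> K" "4 * (gap_const (3/4))\<^sup>2 \<le> K" "3 * 8 powr 2 * (1 / pi) \<le> K"
    using c unfolding K_def by linarith+
  define e where "e i k = u k + (if k = i then 1 else 0)" for i k :: nat
  have e: "0 \<le> e i k" "u k \<le> e i k" for i k using u by (auto simp: e_def)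
  have e1: "1 \<le> e i i" for i using u by (auto simp: e_def)
  let ?A = "\<lambda>i j \<omega>. offdiag (1/2) (point i \<omega>) (point j \<omega>)"
  have key: "(\<integral>\<^sup>+\<omega>. ennreal (?A i j \<omega> * ?A j k \<omega> * ?A k l \<omega> * ?A l i \<omega>) \<partial>M) \<le> ennreal (K * ((u i * e i k) * (u j * e j l)))" for i j k l
  proof -
    have sym: "?A n m \<omega> = ?A m n \<omega>" for n m :: nat and \<omega> :: 'a by (rule offdiag_sym)
    consider "i = j \<or> j = k \<or> k = l \<or> l = i" | "distinct [i, k, j, l]"
      | "k = i" "distinct [i, j, l]" | "l = j" "distinct [j, i, k]" | "k = i" "l = j" "i \<noteq> j" by auto
    then show ?thesis
    proof cases
      case 1
      then have z: "?A i j \<omega> * ?A j k \<omega> * ?A k l \<omega> * ?A l i \<omega> = 0" for \<omega> by (auto simp: offdiag_def)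
      show ?thesis unfolding z by simp
    next
      case 2
      have "16 * (gap_const (3/4))\<^sup>2 * gap_const (1/2) * (u i * u j * u k * u l) \<le> K * (u i * u j * u k * u l)"
        using K u by (intro mult_right_mono mult_nonneg_nonneg) auto
      also have "K * (u i * u j * u k * u l) = K * ((u i * u k) * (u j * u l))" by simp
      also have "K * ((u i * u k) * (u j * u l)) \<le> K * ((u i * e i k) * (u j * e j l))"
        using K u e by (intro mult_left_mono mult_mono mult_nonneg_nonneg) auto
      finally have *: "16 * (gap_const (3/4))\<^sup>2 * gap_const (1/2) * (u i * u j * u k * u l) \<le> K * ((u i * e i k) * (u j * e j l))" .
      show ?thesis using expectation_cycle_distinct[OF 2] * unfolding u_def[symmetric] by (meson ennreal_leI order_trans)
    next
      case 3
      have "4 * (gap_const (3/4))\<^sup>2 * (u i * u j * u l) \<le> K * (u i * u j * u l)"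
        using K u by (intro mult_right_mono mult_nonneg_nonneg) auto
      also have "K * (u i * u j * u l) = K * ((u i * 1) * (u j * u l))" by simp
      also have "K * ((u i * 1) * (u j * u l)) \<le> K * ((u i * e i i) * (u j * e j l))"
        using K u e e1 by (intro mult_left_mono mult_mono mult_nonneg_nonneg) auto
      finally have *: "4 * (gap_const (3/4))\<^sup>2 * (u i * u j * u l) \<le> K * ((u i * e i i) * (u j * e j l))" .
      have "?A i j \<omega> * ?A j k \<omega> * ?A k l \<omega> * ?A l i \<omega> = (?A i j \<omega>)\<^sup>2 * (?A i l \<omega>)\<^sup>2" for \<omega>
        unfolding \<open>k = i\<close> by (simp add: sym[of j _ i] sym[of l _ i] power2_eq_square)
      then show ?thesis using expectation_cycle_star[OF 3(2)] * unfolding u_def[symmetric] \<open>k = i\<close>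
        by (simp only:) (meson ennreal_leI order_trans)
    next
      case 4
      have "4 * (gap_const (3/4))\<^sup>2 * (u j * u i * u k) \<le> K * (u j * u i * u k)"
        using K u by (intro mult_right_mono mult_nonneg_nonneg) auto
      also have "K * (u j * u i * u k) = K * ((u i * u k) * (u j * 1))" by simp
      also have "K * ((u i * u k) * (u j * 1)) \<le> K * ((u i * e i k) * (u j * e j j))"
        using K u e e1 by (intro mult_left_mono mult_mono mult_nonneg_nonneg) auto
      finally have *: "4 * (gap_const (3/4))\<^sup>2 * (u j * u i * u k) \<le> K * ((u i * e i k) * (u j * e j j))" .
      have "?A i j \<omega> * ?A j k \<omega> * ?A k l \<omega> * ?A l i \<omega> = (?A j i \<omega>)\<^sup>2 * (?A j k \<omega>)\<^sup>2" for \<omega>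
        unfolding \<open>l = j\<close> by (simp add: sym[of i _ j] sym[of k _ j] power2_eq_square)
      then show ?thesis using expectation_cycle_star[OF 4(2)] * unfolding u_def[symmetric] \<open>l = j\<close>
        by (simp only:) (meson ennreal_leI order_trans)
    next
      case 5
      have "3 * 8 powr 2 * (1 / pi) * (u i * u j) \<le> K * (u i * u j)"
        using K u by (intro mult_right_mono mult_nonneg_nonneg) auto
      also have "K * (u i * u j) = K * ((u i * 1) * (u j * 1))" by simp
      also have "K * ((u i * 1) * (u j * 1)) \<le> K * ((u i * e i i) * (u j * e j j))"
        using K u e e1 by (intro mult_left_mono mult_mono mult_nonneg_nonneg) auto
      finally have *: "3 * 8 powr 2 * (1 / pi) * (u i * u j) \<le> K * ((u i * e i i) * (u j * e j j))" .
      have "?A i j \<omega> * ?A j k \<omega> * ?A k l \<omega> * ?A l i \<omega> = (?A i j \<omega>) ^ 4" for \<omega>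
        unfolding \<open>l = j\<close> \<open>k = i\<close> by (simp add: sym[of j _ i] power4_eq_xxxx)
      then show ?thesis using expectation_cycle_edge[OF 5(3)] * unfolding u_def[symmetric] \<open>l = j\<close> \<open>k = i\<close>
        by (simp only:) (meson ennreal_leI order_trans)
    qed
  qed
  show ?thesis
  proof (rule AE_interpolating_cycle[where C="K * (S\<^sup>2 + S)\<^sup>2"])
    fix J assume J: "finite J" "J \<subseteq> active"
    have S': "sum u J \<le> S" "0 \<le> sum u J" using S[OF J] u by (auto simp: u_def intro: sum_nonneg)
    have "(\<Sum>i\<in>J. \<Sum>k\<in>J. u i * e i k) = (sum u J)\<^sup>2 + sum u J"
    proof -
      have "(\<Sum>k\<in>J. u i * e i k) = u i * sum u J + u i" if "i \<in> J" for i
        using that J(1) by (simp add: e_def distrib_left sum.distrib sum_distrib_left[symmetric])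
      then show ?thesis by (simp add: sum.distrib power2_eq_square sum_distrib_right[symmetric])
    qed
    also have "\<dots> \<le> S\<^sup>2 + S" using S' by (intro add_mono power_mono) auto
    finally have eS: "(\<Sum>i\<in>J. \<Sum>k\<in>J. u i * e i k) \<le> S\<^sup>2 + S" .
    have "(\<Sum>i\<in>J. \<Sum>j\<in>J. \<Sum>k\<in>J. \<Sum>l\<in>J. \<integral>\<^sup>+\<omega>. ennreal (?A i j \<omega> * ?A j k \<omega> * ?A k l \<omega> * ?A l i \<omega>) \<partial>M)
      \<le> (\<Sum>i\<in>J. \<Sum>j\<in>J. \<Sum>k\<in>J. \<Sum>l\<in>J. ennreal (K * ((u i * e i k) * (u j * e j l))))"
      by (intro sum_mono key)
    also have "\<dots> = ennreal (\<Sum>i\<in>J. \<Sum>j\<in>J. \<Sum>k\<in>J. \<Sum>l\<in>J. K * ((u i * e i k) * (u j * e j l)))"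
      using K u e by (simp add: sum_ennreal sum_nonneg)
    also have "(\<Sum>i\<in>J. \<Sum>j\<in>J. \<Sum>k\<in>J. \<Sum>l\<in>J. K * ((u i * e i k) * (u j * e j l)))
       = K * (\<Sum>i\<in>J. \<Sum>k\<in>J. u i * e i k)\<^sup>2"
      unfolding power2_eq_square sum_product by (simp only: sum_distrib_left)
    also have "ennreal \<dots> \<le> ennreal (K * (S\<^sup>2 + S)\<^sup>2)"
      using K u e by (intro ennreal_leI mult_left_mono power_mono eS sum_nonneg mult_nonneg_nonneg) auto
    finally show "(\<Sum>i\<in>J. \<Sum>j\<in>J. \<Sum>k\<in>J. \<Sum>l\<in>J. \<integral>\<^sup>+\<omega>. ennreal (offdiag (1 - 1/2) (point i \<omega>) (point j \<omega>) * offdiag (1 - 1/2) (point j \<omega>) (point k \<omega>)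
        * offdiag (1 - 1/2) (point k \<omega>) (point l \<omega>) * offdiag (1 - 1/2) (point l \<omega>) (point i \<omega>)) \<partial>M) \<le> ennreal (K * (S\<^sup>2 + S)\<^sup>2)"
      by simp
  qed auto
qed

end

section \<open>Collisions of random points\<close>

text \<open>Pairwise independence makes the variance of the number of events at most its mean; apply
  Chebyshev's inequality.\<close>

lemma (in prob_space) prob_avoid_pairwise_independent:
  assumes Q: "finite Q" and E: "\<And>p. p \<in> Q \<Longrightarrow> E p \<in> events"
    and pw: "\<And>p q. p \<in> Q \<Longrightarrow> q \<in> Q \<Longrightarrow> p \<noteq> q \<Longrightarrow> prob (E p \<inter> E q) = prob (E p) * prob (E q)"
    and \<mu>: "0 < (\<Sum>p\<in>Q. prob (E p))"
  shows "prob {\<omega> \<in> space M. \<forall>p\<in>Q. \<omega> \<notin> E p} \<le> 1 / (\<Sum>p\<in>Q. prob (E p))"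
proof -
  define \<mu> where "\<mu> = (\<Sum>p\<in>Q. prob (E p))"
  define Z where "Z \<omega> = (\<Sum>p\<in>Q. indicator (E p) \<omega> :: real)" for \<omega>
  have \<mu>0: "0 < \<mu>" using \<mu> by (simp add: \<mu>_def)
  have int: "integrable M (indicator (E p) :: 'a \<Rightarrow> real)" if "p \<in> Q" for p
    using E[OF that] by (simp add: emeasure_eq_measure)
  have Zm[measurable]: "Z \<in> borel_measurable M"
    unfolding Z_def using E by (intro borel_measurable_sum borel_measurable_indicator) auto
  have EZ: "expectation Z = \<mu>"
    unfolding Z_def \<mu>_def by (subst Bochner_Integration.integral_sum) (auto simp: int E)
  have Z2: "(Z \<omega>)\<^sup>2 = (\<Sum>p\<in>Q. \<Sum>q\<in>Q. indicator (E p \<inter> E q) \<omega>)" for \<omega>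
    unfolding Z_def power2_eq_square sum_product by (simp add: indicator_inter_arith)
  have int2: "integrable M (indicator (E p \<inter> E q) :: 'a \<Rightarrow> real)" if "p \<in> Q" "q \<in> Q" for p q
    using E[OF that(1)] E[OF that(2)] by (simp add: emeasure_eq_measure)
  have intZ2: "integrable M (\<lambda>\<omega>. (Z \<omega>)\<^sup>2)"
    unfolding Z2 by (intro Bochner_Integration.integrable_sum int2)
  have intZ: "integrable M Z" unfolding Z_def by (intro Bochner_Integration.integrable_sum int)
  have "expectation (\<lambda>\<omega>. (Z \<omega>)\<^sup>2) = (\<Sum>p\<in>Q. \<Sum>q\<in>Q. prob (E p \<inter> E q))"
    unfolding Z2 using E int2 by (subst Bochner_Integration.integral_sum) (auto intro!: Bochner_Integration.integrable_sum sum.cong)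
  also have "\<dots> \<le> (\<Sum>p\<in>Q. \<Sum>q\<in>Q. (if p = q then prob (E p) else 0) + prob (E p) * prob (E q))"
    using pw by (intro sum_mono) auto
  also have "\<dots> = \<mu> + \<mu>\<^sup>2"
    using Q by (simp add: sum.distrib \<mu>_def power2_eq_square sum_product)
  finally have "expectation (\<lambda>\<omega>. (Z \<omega>)\<^sup>2) \<le> \<mu> + \<mu>\<^sup>2" .
  then have var: "variance Z \<le> \<mu>"
    using variance_eq[OF intZ intZ2] by (simp add: EZ)
  have "prob {\<omega> \<in> space M. \<forall>p\<in>Q. \<omega> \<notin> E p} \<le> prob {\<omega> \<in> space M. \<mu> \<le> \<bar>Z \<omega> - expectation Z\<bar>}"
  proof (rule finite_measure_mono)
    show "{\<omega> \<in> space M. \<forall>p\<in>Q. \<omega> \<notin> E p} \<subseteq> {\<omega> \<in> space M. \<mu> \<le> \<bar>Z \<omega> - expectation Z\<bar>}"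
      by (auto simp: EZ Z_def)
  qed measurable
  also have "\<dots> \<le> variance Z / \<mu>\<^sup>2"
    using \<mu>0 intZ2 by (intro Chebyshev_inequality) auto
  also have "\<dots> \<le> \<mu> / \<mu>\<^sup>2" using var by (intro divide_right_mono) auto
  also have "\<dots> = 1 / \<mu>" using \<mu>0 by (simp add: power2_eq_square)
  finally show ?thesis unfolding \<mu>_def .
qed

lemma emeasure_eq_nn_integral:
  assumes "A \<in> sets N" "\<And>x. x \<in> space N \<Longrightarrow> indicator A x = f x"
  shows "emeasure N A = (\<integral>\<^sup>+x. f x \<partial>N)"
  using assms nn_integral_cong[of N "indicator A" f] by simp

definition angle_bin :: "nat \<Rightarrow> real \<Rightarrow> int" where
  "angle_bin B t = \<lfloor>real B * t / (2 * pi)\<rfloor>"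

lemma angle_bin_measurable [measurable]: "angle_bin B \<in> borel \<rightarrow>\<^sub>M count_space UNIV"
  unfolding angle_bin_def by measurable

lemma AE_circle_measure_range: "AE a in circle_measure. 0 \<le> a \<and> a < 2 * pi"
proof -
  have "AE a in lborel. a \<noteq> 2 * pi" by (rule AE_lborel_singleton)
  then have "AE a in lborel. a \<in> {0..2 * pi} \<longrightarrow> 0 \<le> a \<and> a < 2 * pi" by eventually_elim auto
  then show ?thesis by (subst AE_uniform_measure) auto
qed

lemma circle_measure_same_bin:
  assumes B: "0 < B" and a: "0 \<le> a" "a < 2 * pi"
  shows "(\<integral>\<^sup>+b. indicator {b. angle_bin B a = angle_bin B b} b \<partial>circle_measure) = ennreal (1 / real B)"
proof -
  define m where "m = angle_bin B a"
  have m: "0 \<le> m" using a by (simp add: m_def angle_bin_def)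
  have "real B * a / (2 * pi) < real B" using a B by (simp add: field_simps)
  then have mB: "m < int B" unfolding m_def angle_bin_def by linarith
  then have mB': "of_int m + 1 \<le> real B" by linarith
  have eq: "{b. m = angle_bin B b} = {2 * pi * of_int m / B ..< 2 * pi * (of_int m + 1) / B}"
    unfolding angle_bin_def using B by (auto simp: eq_commute[of m] floor_eq_iff field_simps)
  have le: "2 * pi * (of_int m + 1) / B \<le> 2 * pi"
    using mult_left_mono[OF mB', of "2 * pi"] B by (simp add: divide_le_eq)
  have ge: "0 \<le> 2 * pi * of_int m / B" using m by simp
  have "(\<integral>\<^sup>+b. indicator {b. angle_bin B a = angle_bin B b} b \<partial>circle_measure)
     = ennreal (1 / (2 * pi)) * (\<integral>\<^sup>+b. indicator {2 * pi * of_int m / B ..< 2 * pi * (of_int m + 1) / B} b * indicator {0..2 * pi} b \<partial>lborel)"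
    unfolding m_def[symmetric] eq by (rule nn_integral_circle_measure) measurable
  also have "(\<lambda>b. indicator {2 * pi * of_int m / B ..< 2 * pi * (of_int m + 1) / B} b * indicator {0..2 * pi} b)
     = (indicator {2 * pi * of_int m / B ..< 2 * pi * (of_int m + 1) / B} :: real \<Rightarrow> ennreal)"
    using le ge by (auto simp: indicator_def fun_eq_iff)
  also have "(\<integral>\<^sup>+b. indicator {2 * pi * of_int m / B ..< 2 * pi * (of_int m + 1) / B} b \<partial>lborel) = ennreal (2 * pi / B)"
    using B by (simp add: divide_right_mono diff_divide_distrib[symmetric] algebra_simps)
  also have "ennreal (1 / (2 * pi)) * ennreal (2 * pi / B) = ennreal (1 / B)"
    by (simp add: ennreal_mult'[symmetric])
  finally show ?thesis .
qed

context random_angles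
begin

definition same_bin :: "nat \<Rightarrow> nat \<Rightarrow> nat \<Rightarrow> 'a set" where
  "same_bin B i j = {\<omega> \<in> space M. angle_bin B (\<theta> i \<omega>) = angle_bin B (\<theta> j \<omega>)}"

lemma same_bin_event [measurable]: "same_bin B i j \<in> events"
  unfolding same_bin_def by measurable

lemma same_bin_sym: "same_bin B i j = same_bin B j i"
  by (auto simp: same_bin_def)

lemma prob_same_bin:
  assumes "i \<noteq> j" "0 < B"
  shows "prob (same_bin B i j) = 1 / real B"
proof -
  interpret C: prob_space circle_measure by (rule prob_space_circle_measure)
  have "emeasure M (same_bin B i j) = (\<integral>\<^sup>+\<omega>. indicator {b. angle_bin B (\<theta> i \<omega>) = angle_bin B b} (\<theta> j \<omega>) \<partial>M)"
    by (rule emeasure_eq_nn_integral) (measurable, auto simp: same_bin_def indicator_def)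
  also have "\<dots> = (\<integral>\<^sup>+a. \<integral>\<^sup>+b. indicator {b. angle_bin B a = angle_bin B b} b \<partial>circle_measure \<partial>circle_measure)"
    by (rule nn_integral_two_angles[OF assms(1), of "\<lambda>a b. indicator {b. angle_bin B a = angle_bin B b} b"])
      (simp add: indicator_def case_prod_beta)
  also have "\<dots> = (\<integral>\<^sup>+a. ennreal (1 / real B) \<partial>circle_measure)"
    by (rule nn_integral_cong_AE, rule AE_mp[OF AE_circle_measure_range], rule AE_I2, rule impI,
        rule circle_measure_same_bin) (use assms in auto)
  also have "\<dots> = ennreal (1 / real B)" by (simp add: C.emeasure_space_1)
  finally show ?thesis by (simp add: emeasure_eq_measure)
qed

lemma prob_same_bin_disjoint:
  assumes d: "distinct [i, j, k, l]" and B: "0 < B" "0 < B'"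
  shows "prob (same_bin B i j \<inter> same_bin B' k l) = (1 / real B) * (1 / real B')"
proof -
  interpret C: prob_space circle_measure by (rule prob_space_circle_measure)
  let ?e = "\<lambda>B a b. indicator {b. angle_bin B a = angle_bin B b} b :: ennreal"
  have "emeasure M (same_bin B i j \<inter> same_bin B' k l) = (\<integral>\<^sup>+\<omega>. ?e B (\<theta> i \<omega>) (\<theta> j \<omega>) * ?e B' (\<theta> k \<omega>) (\<theta> l \<omega>) \<partial>M)"
    by (rule emeasure_eq_nn_integral) (measurable, auto simp: same_bin_def indicator_def)
  also have "\<dots> = (\<integral>\<^sup>+a. \<integral>\<^sup>+b. \<integral>\<^sup>+c. \<integral>\<^sup>+d. ?e B a b * ?e B' c d \<partial>circle_measure \<partial>circle_measure \<partial>circle_measure \<partial>circle_measure)"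
    by (rule nn_integral_four_angles[OF d, of "\<lambda>a b c d. ?e B a b * ?e B' c d"])
      (simp add: indicator_def case_prod_beta)
  also have "\<dots> = (\<integral>\<^sup>+a. \<integral>\<^sup>+b. ?e B a b * ennreal (1 / B') \<partial>circle_measure \<partial>circle_measure)"
  proof (rule nn_integral_cong, rule nn_integral_cong)
    fix a b
    have "(\<integral>\<^sup>+c. \<integral>\<^sup>+d. ?e B a b * ?e B' c d \<partial>circle_measure \<partial>circle_measure) = (\<integral>\<^sup>+c. ?e B a b * ennreal (1 / B') \<partial>circle_measure)"
    proof (rule nn_integral_cong_AE, rule AE_mp[OF AE_circle_measure_range], rule AE_I2, rule impI)
      fix c :: real assume c: "0 \<le> c \<and> c < 2 * pi"
      have "(\<integral>\<^sup>+d. ?e B a b * ?e B' c d \<partial>circle_measure) = ?e B a b * (\<integral>\<^sup>+d. ?e B' c d \<partial>circle_measure)"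
        by (rule nn_integral_cmult) (simp add: indicator_def)
      then show "(\<integral>\<^sup>+d. ?e B a b * ?e B' c d \<partial>circle_measure) = ?e B a b * ennreal (1 / B')"
        using circle_measure_same_bin[OF B(2), of c] c by simp
    qed
    then show "(\<integral>\<^sup>+c. \<integral>\<^sup>+d. ?e B a b * ?e B' c d \<partial>circle_measure \<partial>circle_measure) = ?e B a b * ennreal (1 / B')"
      by (simp add: C.emeasure_space_1)
  qed
  also have "\<dots> = (\<integral>\<^sup>+a. ennreal (1 / B) * ennreal (1 / B') \<partial>circle_measure)"
  proof (rule nn_integral_cong_AE, rule AE_mp[OF AE_circle_measure_range], rule AE_I2, rule impI)
    fix a :: real assume a: "0 \<le> a \<and> a < 2 * pi"
    have "(\<integral>\<^sup>+b. ?e B a b * ennreal (1 / B') \<partial>circle_measure) = (\<integral>\<^sup>+b. ?e B a b \<partial>circle_measure) * ennreal (1 / B')"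
      by (rule nn_integral_multc) (simp add: indicator_def)
    then show "(\<integral>\<^sup>+b. ?e B a b * ennreal (1 / B') \<partial>circle_measure) = ennreal (1 / B) * ennreal (1 / B')"
      using circle_measure_same_bin[OF B(1), of a] a by simp
  qed
  also have "\<dots> = ennreal ((1 / B) * (1 / B'))" by (simp add: C.emeasure_space_1 ennreal_mult'[symmetric])
  finally show ?thesis by (simp add: emeasure_eq_measure)
qed

text \<open>Two collisions that share an index are still independent, because each has the same conditional
  probability given the shared angle.\<close>

lemma prob_same_bin_shared:
  assumes d: "distinct [i, j, k]" and B: "0 < B"
  shows "prob (same_bin B i j \<inter> same_bin B i k) = (1 / real B) * (1 / real B)"
proof -
  interpret C: prob_space circle_measure by (rule prob_space_circle_measure)
  let ?e = "\<lambda>B a b. indicator {b. angle_bin B a = angle_bin B b} b :: ennreal"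
  have "emeasure M (same_bin B i j \<inter> same_bin B i k) = (\<integral>\<^sup>+\<omega>. ?e B (\<theta> i \<omega>) (\<theta> j \<omega>) * ?e B (\<theta> i \<omega>) (\<theta> k \<omega>) \<partial>M)"
    by (rule emeasure_eq_nn_integral) (measurable, auto simp: same_bin_def indicator_def)
  also have "\<dots> = (\<integral>\<^sup>+a. \<integral>\<^sup>+b. \<integral>\<^sup>+c. ?e B a b * ?e B a c \<partial>circle_measure \<partial>circle_measure \<partial>circle_measure)"
    by (rule nn_integral_three_angles[OF d, of "\<lambda>a b c. ?e B a b * ?e B a c"])
      (simp add: indicator_def case_prod_beta)
  also have "\<dots> = (\<integral>\<^sup>+a. ennreal (1 / B) * ennreal (1 / B) \<partial>circle_measure)"
  proof (rule nn_integral_cong_AE, rule AE_mp[OF AE_circle_measure_range], rule AE_I2, rule impI)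
    fix a :: real assume a: "0 \<le> a \<and> a < 2 * pi"
    have "(\<integral>\<^sup>+b. \<integral>\<^sup>+c. ?e B a b * ?e B a c \<partial>circle_measure \<partial>circle_measure)
        = (\<integral>\<^sup>+b. ?e B a b * (\<integral>\<^sup>+c. ?e B a c \<partial>circle_measure) \<partial>circle_measure)"
      by (intro nn_integral_cong nn_integral_cmult) (simp add: indicator_def)
    also have "\<dots> = (\<integral>\<^sup>+b. ?e B a b \<partial>circle_measure) * (\<integral>\<^sup>+c. ?e B a c \<partial>circle_measure)"
      by (rule nn_integral_multc) (simp add: indicator_def)
    finally show "(\<integral>\<^sup>+b. \<integral>\<^sup>+c. ?e B a b * ?e B a c \<partial>circle_measure \<partial>circle_measure) = ennreal (1 / B) * ennreal (1 / B)"
      using circle_measure_same_bin[OF B, of a] a by simp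
  qed
  also have "\<dots> = ennreal ((1 / B) * (1 / B))" by (simp add: C.emeasure_space_1 ennreal_mult'[symmetric])
  finally show ?thesis by (simp add: emeasure_eq_measure)
qed

lemma AE_angle_range: "AE \<omega> in M. \<forall>n. 0 \<le> \<theta> n \<omega> \<and> \<theta> n \<omega> < 2 * pi"
proof (subst AE_all_countable, rule allI)
  fix n
  have "AE a in distr M borel (\<theta> n). 0 \<le> a \<and> a < 2 * pi" unfolding uniform by (rule AE_circle_measure_range)
  then show "AE \<omega> in M. 0 \<le> \<theta> n \<omega> \<and> \<theta> n \<omega> < 2 * pi" by (subst (asm) AE_distr_iff) auto
qed

lemma AE_angles_distinct: "AE \<omega> in M. \<forall>i j. i \<noteq> j \<longrightarrow> \<theta> i \<omega> \<noteq> \<theta> j \<omega>"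
proof -
  have "AE \<omega> in M. i \<noteq> j \<longrightarrow> \<theta> i \<omega> \<noteq> \<theta> j \<omega>" for i j
  proof (cases "i = j")
    case False
    have "emeasure M {\<omega> \<in> space M. \<theta> i \<omega> = \<theta> j \<omega>} = (\<integral>\<^sup>+\<omega>. indicator {\<theta> i \<omega>} (\<theta> j \<omega>) \<partial>M)"
      by (rule emeasure_eq_nn_integral) (measurable, auto simp: indicator_def)
    also have "\<dots> = (\<integral>\<^sup>+a. \<integral>\<^sup>+b. indicator {a} b \<partial>circle_measure \<partial>circle_measure)"
      by (rule nn_integral_two_angles[OF False, of "\<lambda>a b. indicator {a} b"])
        (simp add: indicator_def case_prod_beta)
    also have "\<dots> = (\<integral>\<^sup>+a. 0 \<partial>circle_measure)"
      by (intro nn_integral_cong) (simp add: emeasure_uniform_measure Int_insert_right)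
    finally have "{\<omega> \<in> space M. \<theta> i \<omega> = \<theta> j \<omega>} \<in> null_sets M" by (simp add: null_sets_def)
    then have "AE \<omega> in M. \<not> (\<theta> i \<omega> = \<theta> j \<omega>)" by (rule AE_I'[where N="{\<omega> \<in> space M. \<theta> i \<omega> = \<theta> j \<omega>}"]) auto
    then show ?thesis by simp
  qed simp
  then show ?thesis by (simp add: AE_all_countable)
qed

end

section \<open>Random separated sequences\<close>

lemma geometric_generation:
  fixes q t :: real
  assumes "0 < q" "q < 1" "0 < t" "t \<le> 1"
  shows "\<exists>n. q ^ Suc n < t \<and> t \<le> q ^ n"
proof -
  obtain m where "q ^ m < t" using real_arch_pow_inv[OF assms(3,2)] by blast
  moreover have "q ^ Suc m \<le> q ^ m" using assms by (intro power_decreasing) auto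
  ultimately have "q ^ Suc m < t" by linarith
  define n where "n = (LEAST n. q ^ Suc n < t)"
  have n: "q ^ Suc n < t" unfolding n_def by (rule LeastI) (rule \<open>q ^ Suc m < t\<close>)
  have "t \<le> q ^ n"
  proof (cases n)
    case (Suc k)
    then have "\<not> q ^ Suc k < t" using not_less_Least[of k "\<lambda>n. q ^ Suc n < t"] by (simp add: n_def)
    then show ?thesis using Suc by simp
  qed (use assms in simp)
  then show ?thesis using n by blast
qed

lemma cis_diff_le: "cmod (cis a - cis b) \<le> \<bar>a - b\<bar>"
proof -
  have "cis b = cis a * cis (b - a)" by (simp add: cis_mult)
  then have "cis a - cis b = cis a * (1 - cis (b - a))" by (simp add: algebra_simps)
  then have "cmod (cis a - cis b) = 2 * \<bar>sin ((b - a) / 2)\<bar>"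
    by (simp add: norm_mult cmod_one_minus_cis)
  also have "\<dots> \<le> 2 * \<bar>(b - a) / 2\<bar>" by (intro mult_left_mono abs_sin_x_le_abs_x) auto
  finally show ?thesis by simp
qed

text \<open>The radii of one generation contribute at most \<open>(1 - q) / q\<close> to the distance and the angles of one
  bin at most \<open>h / q\<close>, both relative to the lower bound \<open>q ^ Suc g\<close> of the denominator.\<close>

lemma pseudohyperbolic_same_bin:
  fixes q \<delta> :: real
  assumes q: "0 < q" "q < 1" and B: "0 < B" "2 * pi / real B \<le> h * q ^ g"
    and t: "q ^ Suc g < 1 - r" "1 - r \<le> q ^ g" "q ^ Suc g < 1 - s" "1 - s \<le> q ^ g"
    and rs: "0 \<le> r" "0 \<le> s"
    and ab: "angle_bin B a = angle_bin B b"
  shows "cmod (rcis r a - rcis s b) / cmod (1 - cnj (rcis r a) * rcis s b) < (1 - q) / q + h / q"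
proof -
  have rs1: "r < 1" "s < 1" using t q by (meson diff_gt_0_iff_gt less_trans zero_less_power)+
  have "\<bar>real B * a / (2 * pi) - real B * b / (2 * pi)\<bar> < 1"
    using ab unfolding angle_bin_def by linarith
  moreover have "real B * a / (2 * pi) - real B * b / (2 * pi) = real B / (2 * pi) * (a - b)"
    by (simp add: right_diff_distrib diff_divide_distrib)
  ultimately have "real B / (2 * pi) * \<bar>a - b\<bar> < 1" by (simp only: abs_mult) simp
  then have "\<bar>a - b\<bar> < 2 * pi / real B" using B(1) by (simp add: field_simps)
  then have ab: "\<bar>a - b\<bar> < h * q ^ g" using B(2) by linarith
  have "rcis r a - rcis s b = of_real (r - s) * cis a + of_real s * (cis a - cis b)"
    by (simp add: rcis_def algebra_simps)
  then have "cmod (rcis r a - rcis s b) \<le> cmod (of_real (r - s) * cis a) + cmod (of_real s * (cis a - cis b))"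
    by (metis norm_triangle_ineq)
  also have "\<dots> \<le> \<bar>r - s\<bar> + 1 * cmod (cis a - cis b)"
    unfolding norm_mult norm_of_real using rs rs1 by (intro add_mono mult_right_mono) auto
  also have "\<dots> < (q ^ g - q ^ Suc g) + h * q ^ g"
    using t cis_diff_le[of a b] ab by linarith
  finally have num: "cmod (rcis r a - rcis s b) < (1 - q + h) * q ^ g" by (simp add: algebra_simps)
  have "r * s \<le> r" using rs rs1 by (simp add: mult_left_le)
  then have "q ^ Suc g < 1 - cmod (rcis r a) * cmod (rcis s b)" using t rs by simp
  then have den: "q ^ Suc g < cmod (1 - cnj (rcis r a) * rcis s b)"
    using disk_gap_ge[of "rcis r a" "rcis s b"] by (simp add: disk_gap_def)
  have qg: "0 < q ^ Suc g" "0 < q ^ g" using q by auto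
  have "0 \<le> cmod (rcis r a - rcis s b)" by simp
  then have pos: "0 < (1 - q + h) * q ^ g" using num by linarith
  have "cmod (rcis r a - rcis s b) / cmod (1 - cnj (rcis r a) * rcis s b) \<le> cmod (rcis r a - rcis s b) / q ^ Suc g"
    using den qg by (intro divide_left_mono mult_pos_pos) auto
  also have "\<dots> < (1 - q + h) * q ^ g / q ^ Suc g" using num qg by (intro divide_strict_right_mono) auto
  also have "\<dots> = (1 - q) / q + h / q" using q by (simp add: add_divide_distrib)
  finally show ?thesis .
qed

context random_angles
begin

definition generation_pairs :: "(nat \<Rightarrow> nat) \<Rightarrow> (nat \<times> nat) set" where
  "generation_pairs g = {(i, j). i < j \<and> i \<in> active \<and> j \<in> active \<and> g i = g j}"

text \<open>A form of the second Borel--Cantelli lemma for the pairwise independent collisions.\<close>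

lemma AE_same_bin_pair:
  assumes B: "\<And>n. 0 < B n" and unb: "\<And>K. \<exists>Q. finite Q \<and> Q \<subseteq> generation_pairs g \<and> K < (\<Sum>(i, j)\<in>Q. 1 / real (B (g i)))"
  shows "AE \<omega> in M. \<exists>(i, j)\<in>generation_pairs g. \<omega> \<in> same_bin (B (g i)) i j"
proof -
  define E where "E = (\<lambda>(i, j). same_bin (B (g i)) i j)"
  have Em: "E p \<in> events" for p by (cases p) (simp add: E_def)
  have PE: "prob (E p) = 1 / real (B (g (fst p)))" if "p \<in> generation_pairs g" for p
    using that B by (auto simp: E_def generation_pairs_def prob_same_bin)
  have pw: "prob (E p \<inter> E p') = prob (E p) * prob (E p')"
    if "p \<in> generation_pairs g" "p' \<in> generation_pairs g" "p \<noteq> p'" for p p'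
  proof -
    obtain i j k l where p: "p = (i, j)" "p' = (k, l)" by (metis prod.collapse)
    have h: "i < j" "k < l" "g i = g j" "g k = g l" "(i, j) \<noteq> (k, l)" using that p by (auto simp: generation_pairs_def)
    have shared: "prob (same_bin (B (g a)) a x \<inter> same_bin (B (g a)) a y) = 1 / real (B (g a)) * (1 / real (B (g a)))"
      if "distinct [a, x, y]" for a x y using prob_same_bin_shared[OF that B] .
    consider "distinct [i, j, k, l]" | "i = k" "j \<noteq> l" | "j = l" "i \<noteq> k" | "i = l" | "j = k" using h by auto
    then have "prob (E p \<inter> E p') = 1 / real (B (g i)) * (1 / real (B (g k)))"
    proof cases
      case 1
      then show ?thesis using prob_same_bin_disjoint[OF 1 B B] by (simp add: p E_def)
    next
      case 2
      then have "E p = same_bin (B (g i)) i j" "E p' = same_bin (B (g i)) i l" using p by (auto simp: E_def)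
      then show ?thesis using shared[of i j l] h 2 by simp
    next
      case 3
      then have "E p = same_bin (B (g j)) j i" "E p' = same_bin (B (g j)) j k"
        using p h same_bin_sym[of "B (g j)" i j] same_bin_sym[of "B (g j)" k j] by (auto simp: E_def)
      then show ?thesis using shared[of j i k] h 3 by simp
    next
      case 4
      then have "E p = same_bin (B (g i)) i j" "E p' = same_bin (B (g i)) i k"
        using p h same_bin_sym[of "B (g i)" k i] by (auto simp: E_def)
      then show ?thesis using shared[of i j k] h 4 by simp
    next
      case 5
      then have "E p = same_bin (B (g j)) j i" "E p' = same_bin (B (g j)) j l"
        using p h same_bin_sym[of "B (g j)" i j] by (auto simp: E_def)
      then show ?thesis using shared[of j i l] h 5 by simp
    qed
    then show ?thesis using PE that p by simp
  qed
  let ?N = "{\<omega> \<in> space M. \<forall>p\<in>generation_pairs g. \<omega> \<notin> E p}"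
  have Nm: "?N \<in> events"
  proof -
    have "?N = space M - (\<Union>p\<in>generation_pairs g. E p)" by auto
    also have "\<dots> \<in> events" using Em by (intro sets.Diff sets.top sets.countable_UN') auto
    finally show ?thesis .
  qed
  have "prob ?N \<le> e" if e: "0 < e" for e
  proof -
    obtain Q where Q: "finite Q" "Q \<subseteq> generation_pairs g" "1 / e < (\<Sum>(i, j)\<in>Q. 1 / real (B (g i)))" using unb by blast
    have \<mu>: "(\<Sum>p\<in>Q. prob (E p)) = (\<Sum>(i, j)\<in>Q. 1 / real (B (g i)))"
      using Q PE by (intro sum.cong refl) (auto simp: case_prod_beta)
    have pos: "0 < 1 / e" using e by simp
    have "prob ?N \<le> prob {\<omega> \<in> space M. \<forall>p\<in>Q. \<omega> \<notin> E p}"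
    proof (rule finite_measure_mono)
      have "{\<omega> \<in> space M. \<forall>p\<in>Q. \<omega> \<notin> E p} = space M - (\<Union>p\<in>Q. E p)" by auto
      also have "\<dots> \<in> events" using Em Q(1) by (intro sets.Diff sets.top sets.finite_UN) auto
      finally show "{\<omega> \<in> space M. \<forall>p\<in>Q. \<omega> \<notin> E p} \<in> events" .
    qed (use Q in auto)
    also have "\<dots> \<le> 1 / (\<Sum>p\<in>Q. prob (E p))"
    proof (rule prob_avoid_pairwise_independent[OF Q(1) Em])
      show "prob (E p \<inter> E p') = prob (E p) * prob (E p')" if "p \<in> Q" "p' \<in> Q" "p \<noteq> p'" for p p'
        using pw that Q(2) by blast
      show "0 < (\<Sum>p\<in>Q. prob (E p))" unfolding \<mu> by (rule less_trans[OF pos Q(3)])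
    qed
    also have "\<dots> \<le> 1 / (1 / e)" unfolding \<mu>
      using Q(3) less_trans[OF pos Q(3)] e by (intro divide_left_mono mult_pos_pos) auto
    finally show ?thesis by simp
  qed
  then have "prob ?N \<le> 0" by (rule field_le_epsilon) simp
  then have "prob ?N = 0" by (simp add: measure_le_0_iff)
  then have "AE \<omega> in M. \<omega> \<notin> ?N" using Nm by (simp add: prob_eq_0)
  then show ?thesis by (rule AE_mp) (auto simp: E_def intro!: AE_I2)
qed

text \<open>For every \<open>m\<close> the ratio \<open>q m\<close> of the generations and the width \<open>h m\<close> of the bins are chosen such
  that a collision means a distance below \<open>1 / Suc m\<close>. If the expected number of collisions were infinite
  for all \<open>m\<close>, then almost surely there would be arbitrarily close pairs of distinct points. So it is
  finite for some \<open>m\<close>.\<close>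

theorem AE_separated_imp_generation_bound:
  assumes sep: "AE \<omega> in M. separated (random_points \<rho> \<theta> \<omega>)"
  obtains q g C where "0 < q" "q < 1" "\<And>n. q ^ Suc (g n) < 1 - \<rho> n" "\<And>n. 1 - \<rho> n \<le> q ^ g n"
    "\<And>Q. finite Q \<Longrightarrow> Q \<subseteq> generation_pairs g \<Longrightarrow> (\<Sum>(i, j)\<in>Q. q ^ g i) \<le> C"
proof -
  define q where "q m = 1 / (1 + 1 / (2 * real (Suc m)))" for m
  have q: "0 < q m" "q m < 1" for m by (auto simp: q_def field_simps)
  have "\<exists>g. \<forall>n. q m ^ Suc (g n) < 1 - \<rho> n \<and> 1 - \<rho> n \<le> q m ^ g n" for m
    using geometric_generation[OF q[of m]] radii by (intro choice) auto
  then obtain g where g: "\<And>m n. q m ^ Suc (g m n) < 1 - \<rho> n" "\<And>m n. 1 - \<rho> n \<le> q m ^ g m n" by metis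
  have "\<exists>m C. \<forall>Q. finite Q \<longrightarrow> Q \<subseteq> generation_pairs (g m) \<longrightarrow> (\<Sum>(i, j)\<in>Q. q m ^ g m i) \<le> C"
  proof (rule ccontr)
    assume "\<not> ?thesis"
    then have unb: "\<exists>Q. finite Q \<and> Q \<subseteq> generation_pairs (g m) \<and> C < (\<Sum>(i, j)\<in>Q. q m ^ g m i)" for m C
      by (meson not_le)
    \<comment> \<open>Then both \<open>(1 - q m) / q m\<close> and \<open>h m / q m\<close> equal \<open>1 / (2 * Suc m)\<close>.\<close>
    define h where "h m = q m / (2 * real (Suc m))" for m
    have h: "0 < h m" for m using q by (simp add: h_def)
    \<comment> \<open>Rounding up makes the bins at most \<open>h m * q m ^ n\<close> wide and loses only a constant factor in the collision probability.\<close>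
    define B where "B m n = nat \<lceil>2 * pi / (h m * q m ^ n)\<rceil>" for m n
    have B0: "0 < 2 * pi / (h m * q m ^ n)" for m n using h q by simp
    have B: "0 < B m n" "2 * pi / (h m * q m ^ n) \<le> real (B m n)" "real (B m n) \<le> 2 * pi / (h m * q m ^ n) + 1" for m n
      using B0[of m n] unfolding B_def by linarith+
    have B2: "2 * pi / real (B m n) \<le> h m * q m ^ n" for m n
      using B(1,2)[of m n] h[of m] q[of m] by (simp add: field_simps)
    have B3: "q m ^ n \<le> (2 * pi / h m + 1) * (1 / real (B m n))" for m n
    proof -
      have "q m ^ n * real (B m n) \<le> q m ^ n * (2 * pi / (h m * q m ^ n) + 1)"
        using B(3) less_imp_le[OF q(1)] by (intro mult_left_mono) auto
      also have "\<dots> = 2 * pi / h m + q m ^ n" using q h less_imp_neq[OF q(1)[of m]] by (simp add: field_simps)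
      also have "\<dots> \<le> 2 * pi / h m + 1" using q[of m] by (simp add: power_le_one)
      finally show ?thesis using B(1)[of m n] by (simp add: field_simps)
    qed
    have "AE \<omega> in M. \<exists>(i, j)\<in>generation_pairs (g m). \<omega> \<in> same_bin (B m (g m i)) i j" for m
    proof (rule AE_same_bin_pair)
      show "0 < B m n" for n by (rule B(1))
      fix K
      define c where "c = 2 * pi / h m + 1"
      have c: "0 < c" using h[of m] by (simp add: c_def add_pos_pos)
      obtain Q where Q: "finite Q" "Q \<subseteq> generation_pairs (g m)" "c * K < (\<Sum>(i, j)\<in>Q. q m ^ g m i)" using unb by blast
      have "(\<Sum>(i, j)\<in>Q. q m ^ g m i) \<le> (\<Sum>(i, j)\<in>Q. c * (1 / real (B m (g m i))))"
        unfolding c_def by (intro sum_mono) (use B3 in auto)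
      also have "\<dots> = c * (\<Sum>(i, j)\<in>Q. 1 / real (B m (g m i)))"
        by (simp add: sum_distrib_left case_prod_beta)
      finally have "c * K < c * (\<Sum>(i, j)\<in>Q. 1 / real (B m (g m i)))" using Q(3) by linarith
      then show "\<exists>Q. finite Q \<and> Q \<subseteq> generation_pairs (g m) \<and> K < (\<Sum>(i, j)\<in>Q. 1 / real (B m (g m i)))"
        using c Q by (intro exI[of _ Q]) simp
    qed
    then have "AE \<omega> in M. \<forall>m. \<exists>(i, j)\<in>generation_pairs (g m). \<omega> \<in> same_bin (B m (g m i)) i j"
      by (simp add: AE_all_countable)
    with sep AE_angle_range AE_angles_distinct have "AE \<omega> in M. False"
    proof eventually_elim
      fix \<omega>
      assume s: "separated (random_points \<rho> \<theta> \<omega>)" and r: "\<forall>n. 0 \<le> \<theta> n \<omega> \<and> \<theta> n \<omega> < 2 * pi"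
        and d: "\<forall>i j. i \<noteq> j \<longrightarrow> \<theta> i \<omega> \<noteq> \<theta> j \<omega>"
        and p: "\<forall>m. \<exists>(i, j)\<in>generation_pairs (g m). \<omega> \<in> same_bin (B m (g m i)) i j"
      obtain \<delta> where \<delta>: "0 < \<delta>" "\<And>x y. x \<in> random_points \<rho> \<theta> \<omega> \<Longrightarrow> y \<in> random_points \<rho> \<theta> \<omega> \<Longrightarrow> x \<noteq> y \<Longrightarrow>
          \<delta> \<le> cmod (x - y) / cmod (1 - cnj x * y)" using s unfolding separated_def by blast
      obtain m where m: "1 / real (Suc m) < \<delta>" using nat_approx_posE[OF \<delta>(1)] by blast
      obtain i j where ij: "(i, j) \<in> generation_pairs (g m)" "\<omega> \<in> same_bin (B m (g m i)) i j" using p by blast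
      have ij': "i \<noteq> j" "0 < \<rho> i" "0 < \<rho> j" "g m i = g m j" using ij by (auto simp: generation_pairs_def)
      have "cmod (rcis (\<rho> i) (\<theta> i \<omega>) - rcis (\<rho> j) (\<theta> j \<omega>)) / cmod (1 - cnj (rcis (\<rho> i) (\<theta> i \<omega>)) * rcis (\<rho> j) (\<theta> j \<omega>))
         < (1 - q m) / q m + h m / q m"
        by (rule pseudohyperbolic_same_bin[OF q[of m] B(1) B2[of m "g m i"]])
          (use g(1)[of m i] g(1)[of m j] g(2)[of i m] g(2)[of j m] ij' ij(2) in \<open>auto simp: same_bin_def\<close>)
      also have "\<dots> = 1 / real (Suc m)"
      proof -
        have "(1 - q m) / q m = 1 / (2 * real (Suc m))" by (simp add: q_def field_simps)
        moreover have "h m / q m = 1 / (2 * real (Suc m))" using q[of m] by (simp add: h_def)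
        ultimately have "(1 - q m) / q m + h m / q m = 1 / (2 * real (Suc m)) + 1 / (2 * real (Suc m))" by (simp only:)
        also have "\<dots> = 1 / real (Suc m)" by (simp add: field_simps)
        finally show ?thesis .
      qed
      also have "\<dots> < \<delta>" by (rule m)
      finally have lt: "cmod (rcis (\<rho> i) (\<theta> i \<omega>) - rcis (\<rho> j) (\<theta> j \<omega>)) / cmod (1 - cnj (rcis (\<rho> i) (\<theta> i \<omega>)) * rcis (\<rho> j) (\<theta> j \<omega>)) < \<delta>" .
      have "rcis (\<rho> i) (\<theta> i \<omega>) \<noteq> rcis (\<rho> j) (\<theta> j \<omega>)"
      proof
        assume e: "rcis (\<rho> i) (\<theta> i \<omega>) = rcis (\<rho> j) (\<theta> j \<omega>)"
        then have "cmod (rcis (\<rho> i) (\<theta> i \<omega>)) = cmod (rcis (\<rho> j) (\<theta> j \<omega>))" by simp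
        then have "\<rho> i = \<rho> j" using ij' by simp
        then have "cis (\<theta> i \<omega>) = cis (\<theta> j \<omega>)" using e ij' by (simp add: rcis_def)
        then have "cmod (1 - cis (\<theta> i \<omega> - \<theta> j \<omega>)) = 0" by (simp add: cis_divide[symmetric])
        then have "sin ((\<theta> i \<omega> - \<theta> j \<omega>) / 2) = 0" by (simp add: cmod_one_minus_cis)
        moreover have "\<bar>(\<theta> i \<omega> - \<theta> j \<omega>) / 2\<bar> < pi" using r[rule_format, of i] r[rule_format, of j] by (simp add: abs_less_iff)
        ultimately have "(\<theta> i \<omega> - \<theta> j \<omega>) / 2 = 0" 
          using sin_eq_0_pi[of "(\<theta> i \<omega> - \<theta> j \<omega>) / 2"] unfolding abs_less_iff by linarith
        then show False using d ij' by simp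
      qed
      moreover have "rcis (\<rho> n) (\<theta> n \<omega>) \<in> random_points \<rho> \<theta> \<omega>" for n
        unfolding random_points_def by (rule rangeI)
      ultimately show False using \<delta>(2)[of "rcis (\<rho> i) (\<theta> i \<omega>)" "rcis (\<rho> j) (\<theta> j \<omega>)"] lt
        by (meson not_le)
    qed
    then show False by simp
  qed
  then obtain m C where C: "\<forall>Q. finite Q \<longrightarrow> Q \<subseteq> generation_pairs (g m) \<longrightarrow> (\<Sum>(i, j)\<in>Q. q m ^ g m i) \<le> C"
    by (elim exE)
  show ?thesis by (rule that[of "q m" "g m" C]) (rule q g C[rule_format]; assumption?)+
qed

end

section \<open>Second moments of the Gram matrix of a separated random sequence\<close>

lemma sum_by_generation:
  fixes h :: "nat \<Rightarrow> real"
  assumes "finite J" "\<And>i. i \<in> J \<Longrightarrow> g i \<le> L"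
  shows "(\<Sum>i\<in>J. h (g i)) = (\<Sum>m\<le>L. real (card {i \<in> J. g i = m}) * h m)"
proof -
  have "(\<Sum>i\<in>J. h (g i)) = (\<Sum>m\<le>L. \<Sum>i\<in>{i \<in> J. g i = m}. h (g i))"
    using assms by (intro sum.group[symmetric]) auto
  also have "\<dots> = (\<Sum>m\<le>L. real (card {i \<in> J. g i = m}) * h m)"
    by (intro sum.cong refl) simp
  finally show ?thesis .
qed

lemma sum_geometric_distance:
  fixes \<kappa> :: real
  assumes "0 \<le> \<kappa>" "\<kappa> < 1"
  shows "(\<Sum>n\<le>L. \<kappa> ^ (m - n + (n - m))) \<le> 2 / (1 - \<kappa>)"
proof -
  have geo: "(\<Sum>k<N. \<kappa> ^ k) \<le> 1 / (1 - \<kappa>)" for N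
  proof -
    have "summable (\<lambda>k. \<kappa> ^ k)" by (rule summable_geometric) (use assms in simp)
    then have "(\<Sum>k<N. \<kappa> ^ k) \<le> (\<Sum>k. \<kappa> ^ k)" by (rule sum_le_suminf) (use assms in auto)
    then show ?thesis using suminf_geometric[of \<kappa>] assms by simp
  qed
  have "(\<Sum>n\<le>L. \<kappa> ^ (m - n + (n - m))) \<le> (\<Sum>n\<in>{..m} \<union> {m..m + L}. \<kappa> ^ (m - n + (n - m)))"
    using assms by (intro sum_mono2) auto
  also have "\<dots> \<le> (\<Sum>n\<in>{..m}. \<kappa> ^ (m - n + (n - m))) + (\<Sum>n\<in>{m..m + L}. \<kappa> ^ (m - n + (n - m)))"
    using assms by (subst sum.union_inter[symmetric]) (auto intro: sum_nonneg)
  also have "(\<Sum>n\<in>{..m}. \<kappa> ^ (m - n + (n - m))) = (\<Sum>k<Suc m. \<kappa> ^ k)"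
    by (rule sum.reindex_bij_witness[of _ "\<lambda>k. m - k" "\<lambda>n. m - n"]) auto
  also have "(\<Sum>n\<in>{m..m + L}. \<kappa> ^ (m - n + (n - m))) = (\<Sum>k<Suc L. \<kappa> ^ k)"
    by (rule sum.reindex_bij_witness[of _ "\<lambda>k. m + k" "\<lambda>n. n - m"]) auto
  also have "(\<Sum>k<Suc m. \<kappa> ^ k) + (\<Sum>k<Suc L. \<kappa> ^ k) \<le> 1 / (1 - \<kappa>) + 1 / (1 - \<kappa>)"
    by (intro add_mono geo)
  finally show ?thesis by simp
qed

context random_angles
begin

text \<open>Let \<open>N m\<close> count the points of generation \<open>m\<close>. The arithmetic-geometric mean inequality and the bounded
  row sums of \<open>\<kappa> ^ |m - n|\<close> reduce the double sum to \<open>W = \<Sum> (N m)\<^sup>2 * q ^ m\<close>. Collisions control only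
  \<open>N m * (N m - 1)\<close>; the inequality \<open>2 * N m - 1 \<le> (N m)\<^sup>2\<close> trades the difference for a geometric
  series.\<close>

lemma generation_double_sum_bound:
  fixes q \<kappa> C :: real
  assumes q: "0 < q" "q < 1" and \<kappa>: "0 \<le> \<kappa>" "\<kappa> < 1" and J: "finite J" "J \<subseteq> active"
    and C: "\<And>Q. finite Q \<Longrightarrow> Q \<subseteq> generation_pairs g \<Longrightarrow> (\<Sum>(i, j)\<in>Q. q ^ g i) \<le> C"
  shows "(\<Sum>i\<in>J. \<Sum>j\<in>J. sqrt q ^ g i * sqrt q ^ g j * \<kappa> ^ (g i - g j + (g j - g i)))
    \<le> 2 / (1 - \<kappa>) * (1 / (1 - q) + 4 * C)"
proof -
  obtain L where L: "\<And>i. i \<in> J \<Longrightarrow> g i \<le> L" using J(1) finite_nat_set_iff_bounded_le[of "g ` J"] by auto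
  define N where "N m = real (card {i \<in> J. g i = m})" for m
  define W where "W = (\<Sum>m\<le>L. (N m)\<^sup>2 * q ^ m)"
  define e where "e m n = \<kappa> ^ (m - n + (n - m))" for m n :: nat
  have e_sym: "e m n = e n m" for m n by (simp add: e_def add.commute)
  have e0: "0 \<le> e m n" for m n using \<kappa> by (simp add: e_def)
  have N0: "0 \<le> N m" for m by (simp add: N_def)
  have grp: "(\<Sum>i\<in>J. h (g i)) = (\<Sum>m\<le>L. N m * h m)" for h :: "nat \<Rightarrow> real"
    unfolding N_def by (rule sum_by_generation[OF J(1)]) (rule L)
  have sq: "sqrt q ^ m * sqrt q ^ m = q ^ m" for m using q by (simp add: power_mult_distrib[symmetric])
  have "(\<Sum>i\<in>J. \<Sum>j\<in>J. sqrt q ^ g i * sqrt q ^ g j * e (g i) (g j))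
      = (\<Sum>m\<le>L. N m * (\<Sum>n\<le>L. N n * (sqrt q ^ m * sqrt q ^ n * e m n)))"
    using grp[of "\<lambda>m. \<Sum>j\<in>J. sqrt q ^ m * sqrt q ^ g j * e m (g j)"] grp[of "\<lambda>n. sqrt q ^ m * sqrt q ^ n * e m n" for m] by simp
  also have "\<dots> = (\<Sum>m\<le>L. \<Sum>n\<le>L. ((N m * sqrt q ^ m) * (N n * sqrt q ^ n)) * e m n)"
    by (simp add: sum_distrib_left mult_ac)
  also have "\<dots> \<le> (\<Sum>m\<le>L. \<Sum>n\<le>L. ((N m)\<^sup>2 * q ^ m / 2 + (N n)\<^sup>2 * q ^ n / 2) * e m n)"
  proof (intro sum_mono mult_right_mono e0)
    fix m n
    have "(N m * sqrt q ^ m) * (N n * sqrt q ^ n) \<le> (N m * sqrt q ^ m)\<^sup>2 / 2 + (N n * sqrt q ^ n)\<^sup>2 / 2"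
      using zero_le_power2[of "N m * sqrt q ^ m - N n * sqrt q ^ n"] by (simp add: power2_diff)
    also have "\<dots> = (N m)\<^sup>2 * q ^ m / 2 + (N n)\<^sup>2 * q ^ n / 2"
      using sq by (simp add: power_mult_distrib power2_eq_square[of "sqrt q ^ _"])
    finally show "(N m * sqrt q ^ m) * (N n * sqrt q ^ n) \<le> (N m)\<^sup>2 * q ^ m / 2 + (N n)\<^sup>2 * q ^ n / 2" .
  qed
  also have "\<dots> = (\<Sum>m\<le>L. \<Sum>n\<le>L. (N m)\<^sup>2 * q ^ m / 2 * e m n) + (\<Sum>m\<le>L. \<Sum>n\<le>L. (N n)\<^sup>2 * q ^ n / 2 * e m n)"
    by (simp add: distrib_right sum.distrib)
  also have "(\<Sum>m\<le>L. \<Sum>n\<le>L. (N n)\<^sup>2 * q ^ n / 2 * e m n) = (\<Sum>m\<le>L. \<Sum>n\<le>L. (N m)\<^sup>2 * q ^ m / 2 * e m n)"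
    by (subst sum.swap) (simp add: e_sym)
  also have "(\<Sum>m\<le>L. \<Sum>n\<le>L. (N m)\<^sup>2 * q ^ m / 2 * e m n) + (\<Sum>m\<le>L. \<Sum>n\<le>L. (N m)\<^sup>2 * q ^ m / 2 * e m n)
     = (\<Sum>m\<le>L. (N m)\<^sup>2 * q ^ m * (\<Sum>n\<le>L. e m n))"
    unfolding sum.distrib[symmetric] sum_distrib_left by (intro sum.cong refl) simp
  also have "\<dots> \<le> (\<Sum>m\<le>L. (N m)\<^sup>2 * q ^ m * (2 / (1 - \<kappa>)))"
    unfolding e_def using q by (intro sum_mono mult_left_mono sum_geometric_distance \<kappa>) auto
  also have "\<dots> = 2 / (1 - \<kappa>) * W" by (simp add: W_def sum_distrib_left mult_ac)
  also have "\<dots> \<le> 2 / (1 - \<kappa>) * (1 / (1 - q) + 4 * C)"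
  proof (intro mult_left_mono)
    define P where "P = (\<Sum>(i, j)\<in>{(i, j) \<in> J \<times> J. i < j \<and> g i = g j}. q ^ g i)"
    have P: "P \<le> C" unfolding P_def
      by (rule C, rule finite_subset[of _ "J \<times> J"]) (use J in \<open>auto simp: generation_pairs_def\<close>)
    have WJ: "W = (\<Sum>i\<in>J. \<Sum>j\<in>J. if g i = g j then q ^ g i else 0)"
    proof -
      have "(\<Sum>i\<in>J. \<Sum>j\<in>J. if g i = g j then q ^ g i else 0) = (\<Sum>m\<le>L. N m * (\<Sum>n\<le>L. N n * (if m = n then q ^ m else 0)))"
        using grp[of "\<lambda>m. \<Sum>j\<in>J. if m = g j then q ^ m else 0"] grp[of "\<lambda>n. if m = n then q ^ m else 0" for m] by simp
      also have "\<dots> = W" unfolding W_def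
        by (intro sum.cong refl) (simp add: if_distrib power2_eq_square cong: if_cong)
      finally show ?thesis by simp
    qed
    have D: "(\<Sum>m\<le>L. N m * q ^ m) = (\<Sum>i\<in>J. q ^ g i)" using grp[of "\<lambda>m. q ^ m"] by simp
    have split: "W = (\<Sum>i\<in>J. q ^ g i) + 2 * P"
    proof -
      have Pl: "P = (\<Sum>i\<in>J. \<Sum>j\<in>J. if i < j \<and> g i = g j then q ^ g i else 0)"
      proof -
        have "(\<Sum>i\<in>J. \<Sum>j\<in>J. if i < j \<and> g i = g j then q ^ g i else 0)
           = (\<Sum>p\<in>J \<times> J. if fst p < snd p \<and> g (fst p) = g (snd p) then q ^ g (fst p) else 0)"
          by (simp add: sum.cartesian_product case_prod_beta)
        also have "\<dots> = P" unfolding P_def case_prod_beta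
          using J(1) by (intro sum.mono_neutral_cong_right) auto
        finally show ?thesis by simp
      qed
      have Pr: "P = (\<Sum>i\<in>J. \<Sum>j\<in>J. if j < i \<and> g i = g j then q ^ g i else 0)"
        unfolding Pl by (subst sum.swap) (intro sum.cong refl, auto)
      have Dg: "(\<Sum>i\<in>J. q ^ g i) = (\<Sum>i\<in>J. \<Sum>j\<in>J. if i = j then q ^ g i else 0)"
        using J(1) by simp
      have "W = (\<Sum>i\<in>J. \<Sum>j\<in>J. (if i = j then q ^ g i else 0) + (if i < j \<and> g i = g j then q ^ g i else 0)
         + (if j < i \<and> g i = g j then q ^ g i else 0))"
        unfolding WJ by (intro sum.cong refl) auto
      also have "\<dots> = (\<Sum>i\<in>J. q ^ g i) + P + P"
        unfolding sum.distrib Pl[symmetric] Pr[symmetric] Dg[symmetric] ..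
      finally show ?thesis by simp
    qed
    have "(\<Sum>m\<le>L. (2 * N m - 1) * q ^ m) \<le> W"
      unfolding W_def
    proof (intro sum_mono mult_right_mono)
      show "2 * N m - 1 \<le> (N m)\<^sup>2" for m using zero_le_power2[of "N m - 1"] by (simp add: power2_diff)
    qed (use q in auto)
    also have "(\<Sum>m\<le>L. (2 * N m - 1) * q ^ m) = 2 * (\<Sum>i\<in>J. q ^ g i) - (\<Sum>m\<le>L. q ^ m)"
      unfolding D[symmetric] by (simp add: left_diff_distrib sum_subtractf sum_distrib_left mult.assoc)
    finally have "W \<le> (\<Sum>m\<le>L. q ^ m) + 4 * P" using split by linarith
    also have "(\<Sum>m\<le>L. q ^ m) \<le> 1 / (1 - q)"
    proof -
      have "summable (\<lambda>k. q ^ k)" by (rule summable_geometric) (use q in simp)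
      then have "(\<Sum>m\<le>L. q ^ m) \<le> (\<Sum>k. q ^ k)" by (rule sum_le_suminf) (use q in auto)
      then show ?thesis using suminf_geometric[of q] q by simp
    qed
    finally show "W \<le> 1 / (1 - q) + 4 * C" using P by linarith
  qed (use \<kappa> in auto)
  finally show ?thesis unfolding e_def .
qed

text \<open>The expected squared Gram entry of points from the generations \<open>m\<close> and \<open>n\<close> is at most a constant
  times \<open>q powr ((m + n) / 2) * \<kappa> ^ |m - n|\<close> with \<open>\<kappa> = q powr (\<beta> - 1/2)\<close>, and \<open>\<kappa> < 1\<close> is where
  \<open>\<alpha> < 1/2\<close> enters.\<close>

theorem AE_separated_imp_AE_interpolating:
  assumes \<alpha>: "0 \<le> \<alpha>" "\<alpha> < 1/2" and sep: "AE \<omega> in M. separated (random_points \<rho> \<theta> \<omega>)"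
  shows "AE \<omega> in M. universal_interpolating \<alpha> (random_points \<rho> \<theta> \<omega>)"
proof -
  obtain q g C where q: "0 < q" "q < 1" and g: "\<And>n. q ^ Suc (g n) < 1 - \<rho> n" "\<And>n. 1 - \<rho> n \<le> q ^ g n"
    and C: "\<And>Q. finite Q \<Longrightarrow> Q \<subseteq> generation_pairs g \<Longrightarrow> (\<Sum>(i, j)\<in>Q. q ^ g i) \<le> C"
    using AE_separated_imp_generation_bound[OF sep] by blast
  define \<beta> where "\<beta> = 1 - \<alpha>"
  have \<beta>: "1/2 < \<beta>" "\<beta> \<le> 1" using \<alpha> by (auto simp: \<beta>_def)
  define \<kappa> where "\<kappa> = q powr (\<beta> - 1/2)"
  have \<kappa>: "0 \<le> \<kappa>" "\<kappa> < 1" using q \<beta> powr_less_mono2[of "\<beta> - 1/2" q 1] by (auto simp: \<kappa>_def)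
  define c where "c = 3 * 8 powr (2 * \<beta>) * (1 / pi) * (1 / (2 * \<beta> - 1))"
  have c: "0 \<le> c" using \<beta> by (simp add: c_def)
  define c' where "c' = 4 powr \<beta> * c * q powr (1 - 2 * \<beta>)"
  have c': "0 \<le> c'" using c by (simp add: c'_def)
  have key: "(defect i * defect j) powr \<beta> * gap_bound (2 * \<beta>) (1 - \<rho> i * \<rho> j)
      \<le> c' * (sqrt q ^ g i * sqrt q ^ g j * \<kappa> ^ (g i - g j + (g j - g i)))" (is "?l i j \<le> ?r i j") for i j
  proof -
    have wlog: "?l i j \<le> ?r i j" if le: "g i \<le> g j" for i j
    proof -
      let ?m = "g i" and ?n = "g j"
      have d2: "defect k \<le> 2 * q ^ g k" for k
      proof -
        have "defect k = (1 - \<rho> k) * (1 + \<rho> k)" by (simp add: defect_def power2_eq_square algebra_simps)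
        also have "\<dots> \<le> q ^ g k * 2" using g(2)[of k] radii[of k] q by (intro mult_mono) auto
        finally show ?thesis by simp
      qed
      have "(defect i * defect j) powr \<beta> \<le> ((2 * q ^ ?m) * (2 * q ^ ?n)) powr \<beta>"
        using \<beta> d2 defect_pos[of i] defect_pos[of j] q by (intro powr_mono2 mult_mono) (auto simp: less_imp_le)
      also have "\<dots> = (4 * (q ^ ?m * q ^ ?n)) powr \<beta>" by (simp add: mult_ac)
      also have "\<dots> = 4 powr \<beta> * (q powr (\<beta> * (real ?m + real ?n)))"
        using q by (simp add: powr_mult powr_realpow[symmetric] powr_add[symmetric] powr_powr mult_ac)
      finally have 1: "(defect i * defect j) powr \<beta> \<le> 4 powr \<beta> * q powr (\<beta> * (real ?m + real ?n))" .
      have "\<rho> i * \<rho> j \<le> \<rho> i" using radii[of i] radii[of j] by (simp add: mult_left_le)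
      then have "q ^ Suc ?m \<le> 1 - \<rho> i * \<rho> j" using g(1)[of i] by linarith
      then have "(1 - \<rho> i * \<rho> j) powr (1 - 2 * \<beta>) \<le> (q ^ Suc ?m) powr (1 - 2 * \<beta>)"
        using q \<beta> by (intro powr_mono2') auto
      also have "\<dots> = q powr (1 - 2 * \<beta>) * q powr ((1 - 2 * \<beta>) * real ?m)"
        using q by (simp add: powr_mult powr_realpow[symmetric] powr_powr mult_ac)
      finally have 2: "(1 - \<rho> i * \<rho> j) powr (1 - 2 * \<beta>) \<le> q powr (1 - 2 * \<beta>) * q powr ((1 - 2 * \<beta>) * real ?m)" .
      have "gap_bound (2 * \<beta>) (1 - \<rho> i * \<rho> j) \<le> c * (1 - \<rho> i * \<rho> j) powr (1 - 2 * \<beta>)"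
        unfolding c_def using \<beta> radii_mult by (intro gap_bound_large_exponent) auto
      also have "\<dots> \<le> c * (q powr (1 - 2 * \<beta>) * q powr ((1 - 2 * \<beta>) * real ?m))"
        using c 2 by (intro mult_left_mono) auto
      finally have 3: "gap_bound (2 * \<beta>) (1 - \<rho> i * \<rho> j) \<le> c * (q powr (1 - 2 * \<beta>) * q powr ((1 - 2 * \<beta>) * real ?m))" .
      have "?l i j \<le> (defect i * defect j) powr \<beta> * (c * (q powr (1 - 2 * \<beta>) * q powr ((1 - 2 * \<beta>) * real ?m)))"
        using 3 by (intro mult_left_mono) auto
      also have "\<dots> \<le> (4 powr \<beta> * q powr (\<beta> * (real ?m + real ?n))) * (c * (q powr (1 - 2 * \<beta>) * q powr ((1 - 2 * \<beta>) * real ?m)))"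
        using 1 c by (intro mult_right_mono) auto
      also have "\<dots> = c' * (q powr (\<beta> * (real ?m + real ?n)) * q powr ((1 - 2 * \<beta>) * real ?m))"
        by (simp add: c'_def mult_ac)
      also have "q powr (\<beta> * (real ?m + real ?n)) * q powr ((1 - 2 * \<beta>) * real ?m)
         = q powr (real ?m / 2) * q powr (real ?n / 2) * q powr ((\<beta> - 1/2) * real (?n - ?m))"
        unfolding powr_add[symmetric] using le by (intro arg_cong[where f="(powr) q"]) (simp add: of_nat_diff field_simps)
      also have "q powr (real ?m / 2) = sqrt q ^ ?m"
        using q by (simp add: powr_half_sqrt[symmetric] powr_realpow[symmetric] powr_powr)
      also have "q powr (real ?n / 2) = sqrt q ^ ?n"
        using q by (simp add: powr_half_sqrt[symmetric] powr_realpow[symmetric] powr_powr)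
      also have "q powr ((\<beta> - 1/2) * real (?n - ?m)) = \<kappa> ^ (?n - ?m)"
        using q by (simp add: \<kappa>_def powr_realpow[symmetric] powr_powr)
      finally show ?thesis using le by simp
    qed
    show ?thesis
    proof (cases "g i \<le> g j")
      case False
      then have "?l j i \<le> ?r j i" by (intro wlog) simp
      then show ?thesis by (simp add: mult_ac add.commute)
    qed (rule wlog)
  qed
  show ?thesis
  proof (rule AE_interpolating_square[where C="c' * (2 / (1 - \<kappa>) * (1 / (1 - q) + 4 * C))"])
    fix J assume J: "finite J" "J \<subseteq> active"
    have "(\<integral>\<^sup>+\<omega>. ennreal ((offdiag \<beta> (point i \<omega>) (point j \<omega>))\<^sup>2) \<partial>M)
       \<le> ennreal (c' * (sqrt q ^ g i * sqrt q ^ g j * \<kappa> ^ (g i - g j + (g j - g i))))" for i j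
    proof (cases "i = j")
      case False
      then show ?thesis using expectation_offdiag_sq[OF False, of \<beta>] \<beta> key[of i j] by (auto intro: order_trans ennreal_leI)
    qed (simp add: offdiag_def)
    then have "(\<Sum>i\<in>J. \<Sum>j\<in>J. \<integral>\<^sup>+\<omega>. ennreal ((offdiag \<beta> (point i \<omega>) (point j \<omega>))\<^sup>2) \<partial>M)
       \<le> (\<Sum>i\<in>J. \<Sum>j\<in>J. ennreal (c' * (sqrt q ^ g i * sqrt q ^ g j * \<kappa> ^ (g i - g j + (g j - g i)))))"
      by (intro sum_mono)
    also have "\<dots> = ennreal (\<Sum>i\<in>J. \<Sum>j\<in>J. c' * (sqrt q ^ g i * sqrt q ^ g j * \<kappa> ^ (g i - g j + (g j - g i))))"
      using c' q \<kappa> by (simp add: sum_ennreal sum_nonneg)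
    also have "(\<Sum>i\<in>J. \<Sum>j\<in>J. c' * (sqrt q ^ g i * sqrt q ^ g j * \<kappa> ^ (g i - g j + (g j - g i))))
       = c' * (\<Sum>i\<in>J. \<Sum>j\<in>J. sqrt q ^ g i * sqrt q ^ g j * \<kappa> ^ (g i - g j + (g j - g i)))"
      by (simp only: sum_distrib_left)
    also have "ennreal \<dots> \<le> ennreal (c' * (2 / (1 - \<kappa>) * (1 / (1 - q) + 4 * C)))"
      using c' by (intro ennreal_leI mult_left_mono generation_double_sum_bound q \<kappa> J C) auto
    finally show "(\<Sum>i\<in>J. \<Sum>j\<in>J. \<integral>\<^sup>+\<omega>. ennreal ((offdiag (1 - \<alpha>) (point i \<omega>) (point j \<omega>))\<^sup>2) \<partial>M)
       \<le> ennreal (c' * (2 / (1 - \<kappa>) * (1 / (1 - q) + 4 * C)))" unfolding \<beta>_def .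
  qed (use \<alpha> in auto)
qed

end

section \<open>Random zero sequences\<close>

text \<open>The coefficients of \<open>f / z ^ m\<close>, where \<open>m\<close> is the order of the zero of \<open>f\<close> at 0. Shifting the
  coefficients down does not increase the norm, because \<open>kernel_coeff\<close> is decreasing.\<close>

lemma dirichlet_space_factor_zero:
  assumes \<alpha>: "0 \<le> \<alpha>" "\<alpha> < 1" and f: "f \<in> dirichlet_space \<alpha>" and nz: "w \<in> ball 0 1" "f w \<noteq> 0"
  obtains a where "summable (\<lambda>n. (cmod (a n))\<^sup>2 / kernel_coeff (1 - \<alpha>) n)" "a 0 \<noteq> 0"
    "\<And>z. z \<in> ball 0 1 \<Longrightarrow> z \<noteq> 0 \<Longrightarrow> f z = 0 \<Longrightarrow> (\<lambda>n. a n * z ^ n) sums 0"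
proof -
  let ?c = "kernel_coeff (1 - \<alpha>)"
  have c: "?c n > 0" for n using \<alpha> by (intro kernel_coeff_pos) auto
  obtain a where a: "summable (\<lambda>n. (cmod (a n))\<^sup>2 / ?c n)"
    and af: "\<And>z. z \<in> ball 0 1 \<Longrightarrow> (\<lambda>n. a n * z ^ n) sums f z"
    using f unfolding dirichlet_space_iff[OF \<alpha>] by blast
  have "\<exists>n. a n \<noteq> 0"
  proof (rule ccontr)
    assume "\<nexists>n. a n \<noteq> 0"
    then have "(\<lambda>n. 0) sums f w" using af[OF nz(1)] by simp
    then show False using nz(2) sums_unique2[OF sums_zero] by metis
  qed
  then obtain m where m: "a m \<noteq> 0" "\<And>n. n < m \<Longrightarrow> a n = 0"
    using LeastI_ex[of "\<lambda>n. a n \<noteq> 0"] not_less_Least[of _ "\<lambda>n. a n \<noteq> 0"] by blast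
  have c_le: "?c (n + m) \<le> ?c n" for n
    by (induction m) (use kernel_coeff_antimono[of "1 - \<alpha>"] \<alpha> in \<open>auto intro: order_trans\<close>)
  have "summable (\<lambda>n. (cmod (a (n + m)))\<^sup>2 / ?c n)"
  proof (rule summable_comparison_test'[of "\<lambda>n. (cmod (a (n + m)))\<^sup>2 / ?c (n + m)" 0])
    show "summable (\<lambda>n. (cmod (a (n + m)))\<^sup>2 / ?c (n + m))" using a by (rule summable_ignore_initial_segment)
    show "norm ((cmod (a (n + m)))\<^sup>2 / ?c n) \<le> (cmod (a (n + m)))\<^sup>2 / ?c (n + m)" for n
      using c_le[of n] c[of n] c[of "n + m"] by (simp add: divide_left_mono)
  qed
  moreover have "(\<lambda>n. a (n + m) * z ^ n) sums 0" if z: "z \<in> ball 0 1" "z \<noteq> 0" "f z = 0" for z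
  proof -
    have "(\<lambda>n. a (n + m) * z ^ (n + m)) sums (f z - (\<Sum>n<m. a n * z ^ n))"
      by (subst sums_iff_shift) (simp add: af[OF z(1)])
    then have "(\<lambda>n. a (n + m) * z ^ (n + m)) sums 0" using z m(2) by simp
    from sums_divide[OF this, of "z ^ m"] show ?thesis using z by (simp add: power_add)
  qed
  ultimately show ?thesis using that[of "\<lambda>n. a (n + m)"] m(1) by simp
qed

context random_angles
begin

text \<open>Up to a kernel coefficient, the \<open>n\<close>-th coefficient of the average of the kernels at the points with
  indices in \<open>F\<close> and weights \<open>w\<close> (and conjugated).\<close>

definition harmonic_sum :: "(nat \<Rightarrow> real) \<Rightarrow> nat set \<Rightarrow> nat \<Rightarrow> 'a \<Rightarrow> complex" where
  "harmonic_sum w F n \<omega> = (\<Sum>i\<in>F. of_real (w i) * point i \<omega> ^ n)"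

lemma harmonic_sum_measurable [measurable]: "harmonic_sum w F n \<in> borel_measurable M"
  unfolding harmonic_sum_def by measurable

lemma integrable_bounded_point:
  "integrable M (\<lambda>\<omega>. point i \<omega> ^ n * cnj (point j \<omega> ^ n))"
proof (rule integrable_const_bound[where B=1])
  show "(\<lambda>\<omega>. point i \<omega> ^ n * cnj (point j \<omega> ^ n)) \<in> borel_measurable M" by measurable
  have "cmod (point k \<omega>) ^ n \<le> 1" for k \<omega> using radii[of k] by (simp add: point_def power_le_one)
  then show "AE \<omega> in M. norm (point i \<omega> ^ n * cnj (point j \<omega> ^ n)) \<le> 1"
    by (simp add: norm_mult norm_power mult_le_one)
qed

text \<open>The factors are independent, and powers of a uniformly distributed unimodular number have mean 0.\<close>

lemma expectation_point_mult:
  assumes "i \<noteq> j" "0 < n"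
  shows "(\<integral>\<omega>. point i \<omega> ^ n * cnj (point j \<omega> ^ n) \<partial>M) = 0"
proof -
  have fm: "(\<lambda>t. rcis (\<rho> k) t ^ n) \<in> borel_measurable borel" for k by measurable
  define f where "f k t = (if k = i then rcis (\<rho> k) t ^ n else cnj (rcis (\<rho> k) t ^ n))" for k t
  have [measurable]: "f k \<in> borel_measurable borel" for k
    unfolding f_def using fm[of k] by (cases "k = i") simp_all
  have ind: "indep_vars (\<lambda>_. borel) (\<lambda>k \<omega>. f k (\<theta> k \<omega>)) {i, j}"
    by (rule indep_vars_compose2[OF indep_vars_subset[OF indep]]) auto
  have bd: "cmod (point k \<omega>) ^ n \<le> 1" for k \<omega> using radii[of k] by (simp add: point_def power_le_one)
  have "integrable M (\<lambda>\<omega>. f k (\<theta> k \<omega>))" for k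
    by (rule integrable_const_bound[where B=1]) (use bd[of k] in \<open>auto simp: f_def norm_power point_def\<close>)
  then have "(\<integral>\<omega>. (\<Prod>k\<in>{i, j}. f k (\<theta> k \<omega>)) \<partial>M) = (\<Prod>k\<in>{i, j}. \<integral>\<omega>. f k (\<theta> k \<omega>) \<partial>M)"
    by (intro indep_vars_lebesgue_integral ind) auto
  then have ind: "(\<integral>\<omega>. point i \<omega> ^ n * cnj (point j \<omega> ^ n) \<partial>M) = (\<integral>\<omega>. point i \<omega> ^ n \<partial>M) * (\<integral>\<omega>. f j (\<theta> j \<omega>) \<partial>M)"
    using assms(1) by (simp add: f_def point_def)
  have "(\<integral>\<omega>. point i \<omega> ^ n \<partial>M) = (\<integral>t. rcis (\<rho> i) t ^ n \<partial>distr M borel (\<theta> i))"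
    unfolding point_def by (rule integral_distr[symmetric]) (auto intro: fm)
  also have "\<dots> = (\<integral>t. of_real (\<rho> i ^ n) * cis (of_int (int n) * t) \<partial>circle_measure)"
    unfolding uniform by (simp add: rcis_def power_mult_distrib Complex.DeMoivre)
  also have "\<dots> = 0" using circle_average_cis[of "int n"] assms(2) by simp
  finally have "(\<integral>\<omega>. point i \<omega> ^ n \<partial>M) = 0" .
  then show ?thesis unfolding ind by simp
qed

lemma expectation_harmonic_sum:
  assumes F: "finite F" and n: "0 < n"
  shows "(\<integral>\<^sup>+\<omega>. ennreal ((cmod (harmonic_sum w F n \<omega>))\<^sup>2) \<partial>M) = ennreal (\<Sum>i\<in>F. (w i)\<^sup>2 * (\<rho> i)\<^sup>2 ^ n)"
proof -
  have ex: "complex_of_real ((cmod (harmonic_sum w F n \<omega>))\<^sup>2)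
     = (\<Sum>i\<in>F. \<Sum>j\<in>F. of_real (w i * w j) * (point i \<omega> ^ n * cnj (point j \<omega> ^ n)))" for \<omega>
    unfolding complex_norm_square harmonic_sum_def cnj_sum sum_product
    by (intro sum.cong refl) simp
  have int: "integrable M (\<lambda>\<omega>. complex_of_real ((cmod (harmonic_sum w F n \<omega>))\<^sup>2))"
    unfolding ex by (intro Bochner_Integration.integrable_sum integrable_mult_right integrable_bounded_point)
  have diag: "(\<integral>\<omega>. point i \<omega> ^ n * cnj (point j \<omega> ^ n) \<partial>M) = (if j = i then of_real ((\<rho> i)\<^sup>2 ^ n) else 0)" for i j
  proof (cases "i = j")
    case True
    have "point i \<omega> ^ n * cnj (point i \<omega> ^ n) = of_real ((\<rho> i)\<^sup>2 ^ n)" for \<omega>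
      unfolding complex_norm_square[symmetric] using radii[of i]
      by (simp add: point_def norm_power power_mult[symmetric] mult.commute)
    then show ?thesis using True by (simp add: prob_space)
  qed (use expectation_point_mult n in auto)
  have "complex_of_real (\<integral>\<omega>. (cmod (harmonic_sum w F n \<omega>))\<^sup>2 \<partial>M) = (\<integral>\<omega>. complex_of_real ((cmod (harmonic_sum w F n \<omega>))\<^sup>2) \<partial>M)"
    by (simp only: integral_complex_of_real)
  also have "\<dots> = (\<Sum>i\<in>F. \<Sum>j\<in>F. of_real (w i * w j) * (\<integral>\<omega>. point i \<omega> ^ n * cnj (point j \<omega> ^ n) \<partial>M))"
    unfolding ex
    by (simp add: Bochner_Integration.integral_sum integrable_bounded_point del: complex_cnj_power of_real_mult)
  also have "\<dots> = (\<Sum>i\<in>F. \<Sum>j\<in>F. if j = i then of_real (w i * w j) * of_real ((\<rho> i)\<^sup>2 ^ n) else 0)"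
    unfolding diag by (intro sum.cong refl) simp
  also have "\<dots> = (\<Sum>i\<in>F. of_real (w i * w i) * of_real ((\<rho> i)\<^sup>2 ^ n))"
    using F by (simp del: of_real_mult)
  also have "\<dots> = of_real (\<Sum>i\<in>F. (w i)\<^sup>2 * (\<rho> i)\<^sup>2 ^ n)"
    by (simp add: power2_eq_square)
  finally have "(\<integral>\<omega>. (cmod (harmonic_sum w F n \<omega>))\<^sup>2 \<partial>M) = (\<Sum>i\<in>F. (w i)\<^sup>2 * (\<rho> i)\<^sup>2 ^ n)"
    by (simp only: of_real_eq_iff)
  moreover have "integrable M (\<lambda>\<omega>. (cmod (harmonic_sum w F n \<omega>))\<^sup>2)"
    using int by (simp only: complex_of_real_integrable_eq)
  ultimately show ?thesis by (simp add: nn_integral_eq_integral)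
qed

text \<open>If the weights sum to 1, this is the squared distance of the averaged kernel from the constant 1,
  which is the kernel at 0: the term of index 0 is the one that is missing.\<close>

definition averaged_kernel_norm :: "real \<Rightarrow> (nat \<Rightarrow> real) \<Rightarrow> nat set \<Rightarrow> 'a \<Rightarrow> ennreal" where
  "averaged_kernel_norm \<beta> w F \<omega> = (\<Sum>n. ennreal (kernel_coeff \<beta> (Suc n) * (cmod (harmonic_sum w F (Suc n) \<omega>))\<^sup>2))"

lemma averaged_kernel_norm_measurable [measurable]: "averaged_kernel_norm \<beta> w F \<in> borel_measurable M"
  unfolding averaged_kernel_norm_def by measurable

lemma expectation_averaged_kernel_norm:
  assumes \<beta>: "0 < \<beta>" and F: "finite F"
  shows "(\<integral>\<^sup>+\<omega>. averaged_kernel_norm \<beta> w F \<omega> \<partial>M) \<le> ennreal (\<Sum>i\<in>F. (w i)\<^sup>2 * defect i powr (- \<beta>))"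
proof -
  have c: "0 \<le> kernel_coeff \<beta> n" for n using kernel_coeff_pos[OF \<beta>] by (simp add: less_imp_le)
  have ks: "(\<lambda>n. kernel_coeff \<beta> n * (\<rho> i)\<^sup>2 ^ n) sums (defect i powr (- \<beta>))" for i
  proof -
    have r: "(\<rho> i)\<^sup>2 < 1" using defect_pos[of i] by (simp add: defect_def)
    then have "(\<lambda>n. of_real (kernel_coeff \<beta> n) * complex_of_real ((\<rho> i)\<^sup>2) ^ n) sums (1 - of_real ((\<rho> i)\<^sup>2)) powr (of_real (- \<beta>))"
      by (intro kernel_coeff_sums) (simp add: norm_power power_abs)
    moreover have "(1 - complex_of_real ((\<rho> i)\<^sup>2)) powr (of_real (- \<beta>)) = of_real (defect i powr (- \<beta>))"
      using powr_of_real[of "defect i" "- \<beta>"] defect_pos[of i] by (simp add: defect_def)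
    ultimately have "(\<lambda>n. complex_of_real (kernel_coeff \<beta> n * (\<rho> i)\<^sup>2 ^ n)) sums of_real (defect i powr (- \<beta>))" by simp
    then show ?thesis by (simp only: sums_of_real_iff)
  qed
  have le: "(\<Sum>n<N. kernel_coeff \<beta> (Suc n) * (\<rho> i)\<^sup>2 ^ Suc n) \<le> defect i powr (- \<beta>)" for N i
  proof -
    have "(\<Sum>n<N. kernel_coeff \<beta> (Suc n) * (\<rho> i)\<^sup>2 ^ Suc n) = (\<Sum>n\<in>Suc ` {..<N}. kernel_coeff \<beta> n * (\<rho> i)\<^sup>2 ^ n)"
      by (simp add: sum.reindex)
    also have "\<dots> \<le> defect i powr (- \<beta>)"
      using ks[of i] sum_le_suminf[of "\<lambda>n. kernel_coeff \<beta> n * (\<rho> i)\<^sup>2 ^ n" "Suc ` {..<N}"] c by (simp add: sums_iff)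
    finally show ?thesis .
  qed
  have "(\<integral>\<^sup>+\<omega>. averaged_kernel_norm \<beta> w F \<omega> \<partial>M)
     = (\<Sum>n. \<integral>\<^sup>+\<omega>. ennreal (kernel_coeff \<beta> (Suc n)) * ennreal ((cmod (harmonic_sum w F (Suc n) \<omega>))\<^sup>2) \<partial>M)"
    unfolding averaged_kernel_norm_def using c
    by (subst nn_integral_suminf) (simp_all add: ennreal_mult)
  also have "\<dots> = (\<Sum>n. ennreal (kernel_coeff \<beta> (Suc n)) * ennreal (\<Sum>i\<in>F. (w i)\<^sup>2 * (\<rho> i)\<^sup>2 ^ Suc n))"
    by (subst nn_integral_cmult) (simp_all only: expectation_harmonic_sum[OF F zero_less_Suc], measurable)
  also have "\<dots> = (\<Sum>n. ennreal (\<Sum>i\<in>F. (w i)\<^sup>2 * (kernel_coeff \<beta> (Suc n) * (\<rho> i)\<^sup>2 ^ Suc n)))"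
    using c by (intro suminf_cong) (simp add: ennreal_mult'[symmetric] sum_distrib_left mult_ac del: power_Suc)
  also have "\<dots> \<le> ennreal (\<Sum>i\<in>F. (w i)\<^sup>2 * defect i powr (- \<beta>))"
  proof (rule suminf_le_const[OF summableI])
    fix N
    have "(\<Sum>n<N. ennreal (\<Sum>i\<in>F. (w i)\<^sup>2 * (kernel_coeff \<beta> (Suc n) * (\<rho> i)\<^sup>2 ^ Suc n)))
       = ennreal (\<Sum>n<N. \<Sum>i\<in>F. (w i)\<^sup>2 * (kernel_coeff \<beta> (Suc n) * (\<rho> i)\<^sup>2 ^ Suc n))"
      using c by (intro sum_ennreal sum_nonneg mult_nonneg_nonneg) auto
    also have "(\<Sum>n<N. \<Sum>i\<in>F. (w i)\<^sup>2 * (kernel_coeff \<beta> (Suc n) * (\<rho> i)\<^sup>2 ^ Suc n))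
       = (\<Sum>i\<in>F. (w i)\<^sup>2 * (\<Sum>n<N. kernel_coeff \<beta> (Suc n) * (\<rho> i)\<^sup>2 ^ Suc n))"
      unfolding sum_distrib_left by (rule sum.swap)
    also have "ennreal \<dots> \<le> ennreal (\<Sum>i\<in>F. (w i)\<^sup>2 * defect i powr (- \<beta>))"
      by (intro ennreal_leI sum_mono mult_left_mono le) auto
    finally show "(\<Sum>n<N. ennreal (\<Sum>i\<in>F. (w i)\<^sup>2 * (kernel_coeff \<beta> (Suc n) * (\<rho> i)\<^sup>2 ^ Suc n)))
      \<le> ennreal (\<Sum>i\<in>F. (w i)\<^sup>2 * defect i powr (- \<beta>))" .
  qed
  finally show ?thesis .
qed

text \<open>The function with coefficients \<open>a\<close> vanishes at the points, so it is orthogonal to the averaged kernel,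
  and pairing it with the distance of that average from the constant 1 gives its constant term.\<close>

lemma constant_term_le_averaged_kernel_norm:
  assumes \<beta>: "0 < \<beta>" and a: "summable (\<lambda>n. (cmod (a n))\<^sup>2 / kernel_coeff \<beta> n)"
    and F: "finite F" "(\<Sum>i\<in>F. w i) = 1" and z: "\<And>i. i \<in> F \<Longrightarrow> (\<lambda>n. a n * point i \<omega> ^ n) sums 0"
  shows "ennreal ((cmod (a 0))\<^sup>2) \<le> ennreal (\<Sum>n. (cmod (a n))\<^sup>2 / kernel_coeff \<beta> n) * averaged_kernel_norm \<beta> w F \<omega>"
proof (cases "averaged_kernel_norm \<beta> w F \<omega> = \<top>")
  case True
  have c: "0 < kernel_coeff \<beta> n" for n by (rule kernel_coeff_pos[OF \<beta>])
  have "(cmod (a 0))\<^sup>2 \<le> (\<Sum>n. (cmod (a n))\<^sup>2 / kernel_coeff \<beta> n)"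
    using sum_le_suminf[OF a, of "{0}"] c by (simp add: less_imp_le)
  moreover have "0 < (cmod (a 0))\<^sup>2" if "a 0 \<noteq> 0" using that by simp
  ultimately have "a 0 = 0 \<or> 0 < (\<Sum>n. (cmod (a n))\<^sup>2 / kernel_coeff \<beta> n)" by linarith
  then show ?thesis using True by (auto simp: ennreal_mult_top ennreal_eq_0_iff not_le)
next
  case False
  have c: "0 < kernel_coeff \<beta> n" for n by (rule kernel_coeff_pos[OF \<beta>])
  define Y where "Y n = harmonic_sum w F n \<omega>" for n
  define S where "S = (\<Sum>n. (cmod (a n))\<^sup>2 / kernel_coeff \<beta> n)"
  define V where "V = (\<Sum>n. kernel_coeff \<beta> (Suc n) * (cmod (Y (Suc n)))\<^sup>2)"
  have sV: "summable (\<lambda>n. kernel_coeff \<beta> (Suc n) * (cmod (Y (Suc n)))\<^sup>2)"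
    using False c unfolding averaged_kernel_norm_def Y_def
    by (intro summable_suminf_not_top) (auto simp: less_imp_le)
  have V: "averaged_kernel_norm \<beta> w F \<omega> = ennreal V" "0 \<le> V"
    unfolding averaged_kernel_norm_def V_def Y_def[symmetric] using sV c
    by (auto intro!: suminf_ennreal2 suminf_nonneg simp: less_imp_le)
  have S: "0 \<le> S" unfolding S_def using a c by (intro suminf_nonneg) (auto simp: less_imp_le)
  define b where "b n = a (Suc n) / of_real (sqrt (kernel_coeff \<beta> (Suc n)))" for n
  define v where "v n = of_real (sqrt (kernel_coeff \<beta> (Suc n))) * Y (Suc n)" for n
  have b2: "(cmod (b n))\<^sup>2 = (cmod (a (Suc n)))\<^sup>2 / kernel_coeff \<beta> (Suc n)" for n
    using c[of "Suc n"] by (simp add: b_def norm_divide power_divide)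
  have v2: "(cmod (v n))\<^sup>2 = kernel_coeff \<beta> (Suc n) * (cmod (Y (Suc n)))\<^sup>2" for n
    using c[of "Suc n"] by (simp add: v_def norm_mult power_mult_distrib)
  have sb: "summable (\<lambda>n. (cmod (b n))\<^sup>2)" unfolding b2 using a by (subst summable_Suc_iff)
  have "(\<Sum>n. (cmod (b n))\<^sup>2) \<le> S"
    unfolding b2 S_def using suminf_split_head[OF a] c[of 0] by simp
  then have bb: "l2_bounded (sqrt S) b UNIV"
    using l2_bounded_mono[OF l2_bounded_UNIV_sums[OF summable_sums[OF sb]] _ order_refl] by simp
  have vb: "l2_bounded (sqrt V) v UNIV"
    using l2_bounded_UNIV_sums[of v V] sV by (simp add: v2 V_def summable_sums)
  have "(\<lambda>n. \<Sum>i\<in>F. of_real (w i) * (a n * point i \<omega> ^ n)) sums (\<Sum>i\<in>F. of_real (w i) * 0)"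
    by (intro sums_sum sums_mult z)
  moreover have "(\<Sum>i\<in>F. of_real (w i) * (a n * point i \<omega> ^ n)) = a n * Y n" for n
    by (simp add: Y_def harmonic_sum_def sum_distrib_left mult_ac)
  ultimately have s0: "(\<lambda>n. a n * Y n) sums 0" by simp
  have Y0: "Y 0 = 1" using F(2) by (simp add: Y_def harmonic_sum_def flip: of_real_sum)
  have "(\<lambda>n. a (Suc n) * Y (Suc n)) sums (0 - a 0 * Y 0)"
    using s0 by (subst sums_Suc_iff) simp
  moreover have "a (Suc n) * Y (Suc n) = b n * v n" for n
    using less_imp_neq[OF c[of "Suc n"]] by (simp add: b_def v_def)
  ultimately have "(\<Sum>n. b n * v n) = - a 0" using Y0 by (simp add: sums_iff)
  then have "cmod (a 0) \<le> sqrt S * sqrt V" using l2_pairing(2)[OF bb vb] by simp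
  then have "(cmod (a 0))\<^sup>2 \<le> (sqrt S * sqrt V)\<^sup>2" by (intro power_mono) auto
  also have "\<dots> = S * V" using S V by (simp add: power_mult_distrib)
  finally show ?thesis unfolding V(1) S_def[symmetric] using S by (simp add: ennreal_mult'[symmetric] ennreal_leI)
qed

text \<open>If the sum diverges, take finite sets of indices with larger and larger sums \<open>T k\<close> and weights
  proportional to \<open>defect powr \<beta>\<close>, which minimize the mean squared distance; it is at most
  \<open>1 / T k\<close>. Hence the infimum of the distances vanishes almost surely, against
  \<open>constant_term_le_averaged_kernel_norm\<close>.\<close>

theorem AE_zero_sequence_imp_bounded:
  assumes \<alpha>: "0 \<le> \<alpha>" "\<alpha> < 1" and zs: "AE \<omega> in M. zero_sequence \<alpha> (random_points \<rho> \<theta> \<omega>)"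
  shows "\<exists>S. \<forall>J. finite J \<longrightarrow> J \<subseteq> active \<longrightarrow> (\<Sum>i\<in>J. defect i powr (1 - \<alpha>)) \<le> S"
proof (rule ccontr)
  assume "\<not> ?thesis"
  then have unb: "\<exists>J. finite J \<and> J \<subseteq> active \<and> S < (\<Sum>i\<in>J. defect i powr (1 - \<alpha>))" for S by (meson not_le)
  define \<beta> where "\<beta> = 1 - \<alpha>"
  have \<beta>: "0 < \<beta>" using \<alpha> by (simp add: \<beta>_def)
  have "\<exists>F. \<forall>k. finite (F k) \<and> F k \<subseteq> active \<and> real (Suc k) < (\<Sum>i\<in>F k. defect i powr \<beta>)"
    unfolding \<beta>_def using unb by (intro choice) auto
  then obtain F where F: "\<And>k. finite (F k)" "\<And>k. F k \<subseteq> active" "\<And>k. real (Suc k) < (\<Sum>i\<in>F k. defect i powr \<beta>)" by blast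
  define T where "T k = (\<Sum>i\<in>F k. defect i powr \<beta>)" for k
  have T: "0 < T k" "real (Suc k) < T k" for k using F(3)[of k] by (auto simp: T_def intro: less_trans[of 0 "real (Suc k)"])
  define w where "w k i = defect i powr \<beta> / T k" for k i
  have w1: "(\<Sum>i\<in>F k. w k i) = 1" for k using T[of k] by (simp add: w_def sum_divide_distrib[symmetric] T_def)
  have w2: "(\<Sum>i\<in>F k. (w k i)\<^sup>2 * defect i powr (- \<beta>)) = 1 / T k" for k
  proof -
    have "(w k i)\<^sup>2 * defect i powr (- \<beta>) = w k i * (1 / T k)" for i
      using defect_pos[of i] by (simp add: w_def power2_eq_square powr_minus)
    then show ?thesis using w1[of k] by (simp add: sum_divide_distrib[symmetric])
  qed
  define Z where "Z \<omega> = (INF k. averaged_kernel_norm \<beta> (w k) (F k) \<omega>)" for \<omega>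
  have Zm: "Z \<in> borel_measurable M" unfolding Z_def by measurable
  have "(\<integral>\<^sup>+\<omega>. Z \<omega> \<partial>M) \<le> ennreal (1 / real (Suc k))" for k
  proof -
    have "(\<integral>\<^sup>+\<omega>. Z \<omega> \<partial>M) \<le> (\<integral>\<^sup>+\<omega>. averaged_kernel_norm \<beta> (w k) (F k) \<omega> \<partial>M)"
      unfolding Z_def by (intro nn_integral_mono INF_lower) simp
    also have "\<dots> \<le> ennreal (1 / T k)"
      using expectation_averaged_kernel_norm[OF \<beta> F(1), of "w k" k] by (simp only: w2)
    also have "\<dots> \<le> ennreal (1 / real (Suc k))" using T[of k] by (intro ennreal_leI divide_left_mono) auto
    finally show ?thesis .
  qed
  then have "(\<integral>\<^sup>+\<omega>. Z \<omega> \<partial>M) \<le> 0"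
    using tendsto_lowerbound[of "\<lambda>k. ennreal (1 / real (Suc k))" "ennreal 0" sequentially "\<integral>\<^sup>+\<omega>. Z \<omega> \<partial>M"]
      tendsto_ennrealI[OF LIMSEQ_Suc[OF lim_1_over_n]] by (simp add: eventually_sequentially)
  then have "AE \<omega> in M. Z \<omega> = 0" using nn_integral_0_iff_AE[OF Zm] by simp
  with zs have "AE \<omega> in M. False"
  proof eventually_elim
    fix \<omega> assume zs: "zero_sequence \<alpha> (random_points \<rho> \<theta> \<omega>)" and Z: "Z \<omega> = 0"
    obtain f x where f: "f \<in> dirichlet_space \<alpha>" "x \<in> ball 0 1" "f x \<noteq> 0"
      and fz: "\<And>x. x \<in> random_points \<rho> \<theta> \<omega> \<Longrightarrow> f x = 0" using zs unfolding zero_sequence_def by blast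
    obtain a where a: "summable (\<lambda>n. (cmod (a n))\<^sup>2 / kernel_coeff (1 - \<alpha>) n)" "a 0 \<noteq> 0"
      "\<And>z. z \<in> ball 0 1 \<Longrightarrow> z \<noteq> 0 \<Longrightarrow> f z = 0 \<Longrightarrow> (\<lambda>n. a n * z ^ n) sums 0"
      using dirichlet_space_factor_zero[OF \<alpha> f] by blast
    define S where "S = (\<Sum>n. (cmod (a n))\<^sup>2 / kernel_coeff \<beta> n)"
    have pt: "point i \<omega> \<in> random_points \<rho> \<theta> \<omega>" for i
      unfolding random_points_def point_def by (rule rangeI)
    have az: "(\<lambda>n. a n * point i \<omega> ^ n) sums 0" if "i \<in> active" for i
      using that by (intro a(3) point_ball fz pt) (simp add: point_def)
    have le: "ennreal ((cmod (a 0))\<^sup>2) \<le> ennreal S * averaged_kernel_norm \<beta> (w k) (F k) \<omega>" for k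
      unfolding S_def
      by (rule constant_term_le_averaged_kernel_norm[OF \<beta> _ F(1) w1]) (use a(1) az F(2) in \<open>auto simp: \<beta>_def\<close>)
    have S: "0 < S"
    proof -
      have "0 < kernel_coeff \<beta> n" for n by (rule kernel_coeff_pos[OF \<beta>])
      then have "(\<Sum>n\<in>{0}. (cmod (a n))\<^sup>2 / kernel_coeff \<beta> n) \<le> S"
        unfolding S_def using a(1) by (intro sum_le_suminf) (auto simp: \<beta>_def less_imp_le)
      then have "(cmod (a 0))\<^sup>2 \<le> S" by simp
      moreover have "0 < (cmod (a 0))\<^sup>2" using a(2) by simp
      ultimately show ?thesis by linarith
    qed
    have "ennreal ((cmod (a 0))\<^sup>2 / S) \<le> averaged_kernel_norm \<beta> (w k) (F k) \<omega>" for k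
    proof -
      have "ennreal (1 / S) * ennreal ((cmod (a 0))\<^sup>2) \<le> ennreal (1 / S) * (ennreal S * averaged_kernel_norm \<beta> (w k) (F k) \<omega>)"
        by (intro mult_left_mono le) simp
      also have "\<dots> = averaged_kernel_norm \<beta> (w k) (F k) \<omega>"
        using S by (simp add: mult.assoc[symmetric] ennreal_mult'[symmetric])
      finally show ?thesis using S by (simp add: ennreal_mult'[symmetric])
    qed
    then have "ennreal ((cmod (a 0))\<^sup>2 / S) \<le> Z \<omega>" unfolding Z_def by (intro INF_greatest)
    then have "(cmod (a 0))\<^sup>2 / S \<le> 0" unfolding Z by (simp add: ennreal_eq_0_iff)
    then show False using S a(2) by (simp add: divide_le_0_iff)
  qed
  then show False by simp
qed

end

section \<open>Random interpolation\<close>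

theorem corollary1p6:
  fixes M :: "'a measure" and \<rho> :: "nat \<Rightarrow> real" and \<theta> :: "nat \<Rightarrow> 'a \<Rightarrow> real"
  assumes "prob_space M"
    and "\<And>n. 0 \<le> \<rho> n \<and> \<rho> n < 1"
    and "prob_space.indep_vars M (\<lambda>_. borel) \<theta> UNIV"
    and "\<And>n. distr M borel (\<theta> n) = uniform_measure lborel {0..2 * pi}"
  shows "(\<forall>\<alpha>::real. 0 \<le> \<alpha> \<and> \<alpha> < 1/2 \<longrightarrow>
            ((AE \<omega> in M. universal_interpolating \<alpha> (random_points \<rho> \<theta> \<omega>)) \<longleftrightarrow>
             (AE \<omega> in M. separated (random_points \<rho> \<theta> \<omega>))))
       \<and> (\<forall>\<alpha>::real. 1/2 \<le> \<alpha> \<and> \<alpha> < 1 \<longrightarrow>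
            ((AE \<omega> in M. universal_interpolating \<alpha> (random_points \<rho> \<theta> \<omega>)) \<longleftrightarrow>
             (AE \<omega> in M. zero_sequence \<alpha> (random_points \<rho> \<theta> \<omega>))))"
proof -
  interpret random_angles M \<rho> \<theta>
    by (intro random_angles.intro random_angles_axioms.intro assms)
  let ?\<Lambda> = "\<lambda>\<omega>. random_points \<rho> \<theta> \<omega>"
  have "(AE \<omega> in M. universal_interpolating \<alpha> (?\<Lambda> \<omega>)) \<longleftrightarrow> (AE \<omega> in M. separated (?\<Lambda> \<omega>))"
    if \<alpha>: "0 \<le> \<alpha>" "\<alpha> < 1/2" for \<alpha>
  proof
    assume "AE \<omega> in M. universal_interpolating \<alpha> (?\<Lambda> \<omega>)"
    then show "AE \<omega> in M. separated (?\<Lambda> \<omega>)"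
      by eventually_elim (rule universal_interpolating_imp_separated, use \<alpha> in auto)
  qed (rule AE_separated_imp_AE_interpolating[OF \<alpha>])
  moreover have "(AE \<omega> in M. universal_interpolating \<alpha> (?\<Lambda> \<omega>)) \<longleftrightarrow> (AE \<omega> in M. zero_sequence \<alpha> (?\<Lambda> \<omega>))"
    if \<alpha>: "1/2 \<le> \<alpha>" "\<alpha> < 1" for \<alpha>
  proof
    assume "AE \<omega> in M. universal_interpolating \<alpha> (?\<Lambda> \<omega>)"
    then show "AE \<omega> in M. zero_sequence \<alpha> (?\<Lambda> \<omega>)"
      by eventually_elim (rule universal_interpolating_imp_zero_sequence, use \<alpha> in auto)
  next
    assume "AE \<omega> in M. zero_sequence \<alpha> (?\<Lambda> \<omega>)"
    then obtain S where S: "\<And>J. finite J \<Longrightarrow> J \<subseteq> active \<Longrightarrow> (\<Sum>i\<in>J. defect i powr (1 - \<alpha>)) \<le> S"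
      using AE_zero_sequence_imp_bounded[of \<alpha>] \<alpha> by auto
    show "AE \<omega> in M. universal_interpolating \<alpha> (?\<Lambda> \<omega>)"
    proof (cases "\<alpha> = 1/2")
      case True
      have "(\<Sum>i\<in>J. sqrt (defect i)) \<le> S" if "finite J" "J \<subseteq> active" for J
        using S[OF that] True defect_pos by (simp add: powr_half_sqrt less_imp_le)
      then show ?thesis unfolding True by (rule AE_interpolating_summable_critical)
    next
      case False
      then have "1/2 < \<alpha>" using \<alpha> by simp
      then show ?thesis using \<alpha>(2) S by (rule AE_interpolating_summable_supercritical)
    qed
  qed
  ultimately show ?thesis by blast
qed

end
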